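(* Let $S$ be a finite state space, let $\phi$ be a closed formula and $\mathcal V$ a valuation (as described in the context). For every state $s\in S$, \[ \inf_{\underline\sigma}\ \sup_{\overline\sigma}\ \int_{T^{\underline\sigma,\overline\sigma}_{\mathcal V}(\phi).s}\mathit{Val} \;=\; \sup_{\overline\sigma}\ \inf_{\underline\sigma}\ \int_{T^{\underline\sigma,\overline\sigma}_{\mathcal V}(\phi).s}\mathit{Val} \;=\;[\![\phi]\!]_{\mathcal V}.s, \] where $\underline\sigma,\overline\sigma$ range over all (colour-insensitive) strategy functions for Min and Max respectively. That is, the minimax value of the game is well defined and equals the denotation $[\![\phi]\!]_{\mathcal V}.s$.
   Context: Let $S$ be a state space and $\$\notin S$ a special "payoff" state. A sub-distribution on a set $Y$ is a function $\delta:Y\to[0,1]$ with $\sum_y\delta.y\le 1$. A (generalised probabilistic) transition is a function $t$ from $S$ to sub-distributions on $S\cup\{\$\}$. An expectation is a function $S\to[0,1]$; expectations are ordered pointwise by $\le$. Formulas are generated by $\phi ::= X \mid \mathsf A \mid \{\mathsf k\}\phi \mid \phi_1\sqcap\phi_2 \mid \phi_1\sqcup\phi_2 \mid \phi_1 \lhd \mathsf G\rhd \phi_2 \mid \mu X.\phi \mid \nu X.\phi$, where $X$ ranges over variables, $\mathsf A$ over expectation constant symbols, $\mathsf k$ over transition symbols and $\mathsf G$ over predicate symbols; a formula is closed if it has no free variables. A valuation $\mathcal V$ maps each $\mathsf A$ to an expectation $\mathcal V.\mathsf A$, each $\mathsf k$ to a transition $\mathcal V.\mathsf k$, each $\mathsf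 G$ to a predicate (Boolean function) $\mathcal V.\mathsf G$ on $S$, and each free variable $X$ to an expectation. The denotation $[\![\phi]\!]_{\mathcal V}$ (an expectation) is defined by: $[\![X]\!]_{\mathcal V}=\mathcal V.X$; $[\![\mathsf A]\!]_{\mathcal V}=\mathcal V.\mathsf A$; $[\![\{\mathsf k\}\phi]\!]_{\mathcal V}.s=\mathcal V.\mathsf k.s.\$+\sum_{s'\in S}\mathcal V.\mathsf k.s.s'\cdot[\![\phi]\!]_{\mathcal V}.s'$; $\sqcap$ and $\sqcup$ are pointwise minimum and maximum; $[\![\phi'\lhd\mathsf G\rhd\phi'']\!]_{\mathcal V}.s$ is $[\![\phi']\!]_{\mathcal V}.s$ if $\mathcal V.\mathsf G.s$ holds and $[\![\phi'']\!]_{\mathcal V}.s$ otherwise; $[\![\mu X.\phi]\!]_{\mathcal V}$ (resp. $[\![\nu X.\phi]\!]_{\mathcal V}$) is the least (resp. greatest) fixed point of the monotone map $x\mapsto[\![\phi]\!]_{\mathcal V[X\mapsto x]}$ on expectations. Game. Game positions are pairs $(\psi,s)$ with $\psi$ a formula possibly containing colours and $s\in S$, or payoff tips $(y)$ with $y\in[0,1]$. A path is a finite or infinite sequence of positions. A strategy for Min (written $\underline\sigma$) or Max (written $\overline\sigma$) is any function from finite paths to $\{\mathsf{true},\mathsf{false}\}$; strategies are colour-insensitive: they treat a position $(X_i,s)$ as if it were $(X,s)$. Given a closed formula $\phi$, strategies $\underline\sigma,\overline\sigma$ and a state $s$, the game tree $T^{\underline\sigma,\overline\sigma}_{\mathcal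 V}(\phi).s$ is built from root $(\phi,s)$ as follows, where at a node $(\psi,s)$ reached by path $\pi$ (not including the node) we write $\pi^+$ for $\pi$ followed by $(\psi,s)$: if $\psi=\mathsf A$, a probability-one edge to tip $(\mathcal V.\mathsf A.s)$; if $\psi=\{\mathsf k\}\Phi$, for each $s'\in S$ with $\mathcal V.\mathsf k.s.s'>0$ an edge with that probability to $(\Phi,s')$, and, if $p:=\sum_{s'\in S}\mathcal V.\mathsf k.s.s'<1$, one more edge with probability $1-p$ to tip $(\mathcal V.\mathsf k.s.\$/(1-p))$; if $\psi=\Phi'\sqcap\Phi''$ (resp. $\Phi'\sqcup\Phi''$), a probability-one edge to $(\Phi',s)$ if $\underline\sigma.\pi^+$ (resp. $\overline\sigma.\pi^+$) is true and to $(\Phi'',s)$ otherwise; if $\psi=\Phi'\lhd\mathsf G\rhd\Phi''$, a probability-one edge to $(\Phi',s)$ if $\mathcal V.\mathsf G.s$ and to $(\Phi'',s)$ otherwise; if $\psi=\mu X.\Phi$ or $\nu X.\Phi$, where $i$ is the length of $\pi$, a fresh colour $X_i$ (remembered as a $\mu$-colour, resp. $\nu$-colour) is created and a probability-one edge goes to $(X_i,s)$; if $\psi$ is a colour $X_i$, the $i$-th element of the path is some $(\mu X.\Phi,s')$ or $(\nu X.\Phi,s')$, and a probability-one edge goes to $(\Phi[X\mapsto X_i],s)$. The tree determines a probability measure on its maximal paths (on the sigma-algebra generated by cones of paths with a common finite prefix, the cone measure being the product of edge probabilities along the prefix); $\int_{T}F$ denotes expected value. On every infinite valid path exactly one colour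 occurs infinitely often. The payoff $\mathit{Val}$ of a maximal path $\pi$ is: $y$ if $\pi$ is finite ending in tip $(y)$; $1$ if $\pi$ is infinite and the colour occurring infinitely often is a $\nu$-colour; $0$ if it is infinite and that colour is a $\mu$-colour. *)

theory Defs
  imports "HOL-Probability.Probability" "HOL-Library.Sublist"
begin

text \<open>
  Colours \<open>X\<^sub>i\<close> live in the same syntactic place as variables but are never bound: the
  binders range over plain variables only. A colour counts as a free name, so closed formulas
  contain neither free variables nor colours.
\<close>

datatype 'v name = Plain 'v | Colour 'v nat

datatype ('v, 'a, 'k, 'g) form =
    Name "'v name"
  | Const 'a
  | Trans 'k "('v, 'a, 'k, 'g) form"
  | Meet "('v, 'a, 'k, 'g) form" "('v, 'a, 'k, 'g) form"
  | Join "('v, 'a, 'k, 'g) form" "('v, 'a, 'k, 'g) form"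
  | Cond "('v, 'a, 'k, 'g) form" 'g "('v, 'a, 'k, 'g) form"
  | Mu 'v "('v, 'a, 'k, 'g) form"
  | Nu 'v "('v, 'a, 'k, 'g) form"

primrec free_names :: "('v, 'a, 'k, 'g) form \<Rightarrow> 'v name set" where
  "free_names (Name x) = {x}"
| "free_names (Const A) = {}"
| "free_names (Trans k \<phi>) = free_names \<phi>"
| "free_names (Meet \<phi> \<psi>) = free_names \<phi> \<union> free_names \<psi>"
| "free_names (Join \<phi> \<psi>) = free_names \<phi> \<union> free_names \<psi>"
| "free_names (Cond \<phi> G \<psi>) = free_names \<phi> \<union> free_names \<psi>"
| "free_names (Mu X \<phi>) = free_names \<phi> - {Plain X}"
| "free_names (Nu X \<phi>) = free_names \<phi> - {Plain X}"

definition closed_form :: "('v, 'a, 'k, 'g) form \<Rightarrow> bool" where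
  "closed_form \<phi> \<longleftrightarrow> free_names \<phi> = {}"

text \<open>\<open>subst_colour X i \<phi>\<close> is \<open>\<phi>[X \<mapsto> X\<^sub>i]\<close>; since colours are never bound, no capture
  can occur.\<close>

primrec subst_colour ::
  "'v \<Rightarrow> nat \<Rightarrow> ('v, 'a, 'k, 'g) form \<Rightarrow> ('v, 'a, 'k, 'g) form" where
  "subst_colour X i (Name x) = Name (if x = Plain X then Colour X i else x)"
| "subst_colour X i (Const A) = Const A"
| "subst_colour X i (Trans k \<phi>) = Trans k (subst_colour X i \<phi>)"
| "subst_colour X i (Meet \<phi> \<psi>) = Meet (subst_colour X i \<phi>) (subst_colour X i \<psi>)"
| "subst_colour X i (Join \<phi> \<psi>) = Join (subst_colour X i \<phi>) (subst_colour X i \<psi>)"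
| "subst_colour X i (Cond \<phi> G \<psi>) = Cond (subst_colour X i \<phi>) G (subst_colour X i \<psi>)"
| "subst_colour X i (Mu Y \<phi>) = Mu Y (if Y = X then \<phi> else subst_colour X i \<phi>)"
| "subst_colour X i (Nu Y \<phi>) = Nu Y (if Y = X then \<phi> else subst_colour X i \<phi>)"

datatype 's outcome = State 's | Payoff

text \<open>\<open>Payoff\<close> is the special state \<open>$\<close>. A sub-distribution on \<open>S \<union> {$}\<close> is an
  \<^typ>\<open>'s outcome spmf\<close>.\<close>

definition expectations :: "('s \<Rightarrow> real) set" where
  "expectations = {f. \<forall>s. 0 \<le> f s \<and> f s \<le> 1}"

record ('v, 'a, 'k, 'g, 's) valuation =
  vname :: "'v name \<Rightarrow> 's \<Rightarrow> real"
  vconst :: "'a \<Rightarrow> 's \<Rightarrow> real"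
  vtrans :: "'k \<Rightarrow> 's \<Rightarrow> 's outcome spmf"
  vpred :: "'g \<Rightarrow> 's \<Rightarrow> bool"

definition is_valuation :: "('v, 'a, 'k, 'g, 's) valuation \<Rightarrow> bool" where
  "is_valuation V \<longleftrightarrow>
     (\<forall>A. vconst V A \<in> expectations) \<and> (\<forall>x. vname V x \<in> expectations)"

definition upd :: "('v, 'a, 'k, 'g, 's) valuation \<Rightarrow> 'v \<Rightarrow> ('s \<Rightarrow> real) \<Rightarrow>
    ('v, 'a, 'k, 'g, 's) valuation" where
  "upd V X x = V\<lparr>vname := (vname V)(Plain X := x)\<rparr>"

primrec denote :: "('v, 'a, 'k, 'g) form \<Rightarrow>
    ('v, 'a, 'k, 'g, 's :: finite) valuation \<Rightarrow> 's \<Rightarrow> real" where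
  "denote (Name x) V = vname V x"
| "denote (Const A) V = vconst V A"
| "denote (Trans k \<phi>) V = (\<lambda>s. spmf (vtrans V k s) Payoff +
     (\<Sum>s'\<in>UNIV. spmf (vtrans V k s) (State s') * denote \<phi> V s'))"
| "denote (Meet \<phi> \<psi>) V = (\<lambda>s. min (denote \<phi> V s) (denote \<psi> V s))"
| "denote (Join \<phi> \<psi>) V = (\<lambda>s. max (denote \<phi> V s) (denote \<psi> V s))"
| "denote (Cond \<phi> G \<psi>) V = (\<lambda>s. if vpred V G s then denote \<phi> V s else denote \<psi> V s)"
| "denote (Mu X \<phi>) V = (LEAST x. x \<in> expectations \<and> denote \<phi> (upd V X x) = x)"
| "denote (Nu X \<phi>) V = (GREATEST x. x \<in> expectations \<and> denote \<phi> (upd V X x) = x)"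

datatype ('v, 'a, 'k, 'g, 's) pos =
    Node "('v, 'a, 'k, 'g) form" 's
  | Tip real

datatype 'p path = Finite_path "'p list" | Infinite_path "nat \<Rightarrow> 'p"

type_synonym 'p strategy = "'p list \<Rightarrow> bool"

primrec plain_name :: "'v name \<Rightarrow> 'v name" where
  "plain_name (Plain X) = Plain X"
| "plain_name (Colour X i) = Plain X"

primrec uncolour_form :: "('v, 'a, 'k, 'g) form \<Rightarrow> ('v, 'a, 'k, 'g) form" where
  "uncolour_form (Name x) = Name (plain_name x)"
| "uncolour_form (Const A) = Const A"
| "uncolour_form (Trans k \<phi>) = Trans k (uncolour_form \<phi>)"
| "uncolour_form (Meet \<phi> \<psi>) = Meet (uncolour_form \<phi>) (uncolour_form \<psi>)"
| "uncolour_form (Join \<phi> \<psi>) = Join (uncolour_form \<phi>) (uncolour_form \<psi>)"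
| "uncolour_form (Cond \<phi> G \<psi>) = Cond (uncolour_form \<phi>) G (uncolour_form \<psi>)"
| "uncolour_form (Mu X \<phi>) = Mu X (uncolour_form \<phi>)"
| "uncolour_form (Nu X \<phi>) = Nu X (uncolour_form \<phi>)"

primrec uncolour :: "('v, 'a, 'k, 'g, 's) pos \<Rightarrow> ('v, 'a, 'k, 'g, 's) pos" where
  "uncolour (Node \<psi> s) = Node (uncolour_form \<psi>) s"
| "uncolour (Tip y) = Tip y"

text \<open>The colour-insensitive strategies, for either player.\<close>

definition strategies :: "('v, 'a, 'k, 'g, 's) pos strategy set" where
  "strategies = {\<sigma>. \<forall>\<pi>. \<sigma> (map uncolour \<pi>) = \<sigma> \<pi>}"

text \<open>
  \<open>edge_prob V \<sigma> \<tau> \<pi> p q\<close> is the probability of the edge from \<open>p\<close> to \<open>q\<close> when \<open>p\<close> is reached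
  by the path \<open>\<pi>\<close>, which excludes \<open>p\<close> itself; the value 0 means that there is no such edge.
  Here \<open>\<sigma>\<close> is the strategy of Min and \<open>\<tau>\<close> that of Max. Path elements are counted from 0, so
  that the colour created after a path of length \<open>i\<close> refers back to \<open>\<pi> ! i\<close>. Plain variables
  have no outgoing edges, but in a tree with closed root formula they never arise as nodes.
\<close>

fun edge_prob :: "('v, 'a, 'k, 'g, 's :: finite) valuation \<Rightarrow>
    ('v, 'a, 'k, 'g, 's) pos strategy \<Rightarrow> ('v, 'a, 'k, 'g, 's) pos strategy \<Rightarrow>
    ('v, 'a, 'k, 'g, 's) pos list \<Rightarrow>
    ('v, 'a, 'k, 'g, 's) pos \<Rightarrow> ('v, 'a, 'k, 'g, 's) pos \<Rightarrow> real" where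
  "edge_prob V \<sigma> \<tau> \<pi> (Tip y) q = 0"
| "edge_prob V \<sigma> \<tau> \<pi> (Node (Const A) s) q = of_bool (q = Tip (vconst V A s))"
| "edge_prob V \<sigma> \<tau> \<pi> (Node (Trans k \<Phi>) s) q =
     (let p = (\<Sum>s'\<in>UNIV. spmf (vtrans V k s) (State s')) in
      case q of
        Node \<Psi> s' \<Rightarrow> if \<Psi> = \<Phi> then spmf (vtrans V k s) (State s') else 0
      | Tip y \<Rightarrow> if p < 1 \<and> y = spmf (vtrans V k s) Payoff / (1 - p) then 1 - p else 0)"
| "edge_prob V \<sigma> \<tau> \<pi> (Node (Meet \<Phi> \<Psi>) s) q =
     of_bool (q = Node (if \<sigma> (\<pi> @ [Node (Meet \<Phi> \<Psi>) s]) then \<Phi> else \<Psi>) s)"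
| "edge_prob V \<sigma> \<tau> \<pi> (Node (Join \<Phi> \<Psi>) s) q =
     of_bool (q = Node (if \<tau> (\<pi> @ [Node (Join \<Phi> \<Psi>) s]) then \<Phi> else \<Psi>) s)"
| "edge_prob V \<sigma> \<tau> \<pi> (Node (Cond \<Phi> G \<Psi>) s) q =
     of_bool (q = Node (if vpred V G s then \<Phi> else \<Psi>) s)"
| "edge_prob V \<sigma> \<tau> \<pi> (Node (Mu X \<Phi>) s) q = of_bool (q = Node (Name (Colour X (length \<pi>))) s)"
| "edge_prob V \<sigma> \<tau> \<pi> (Node (Nu X \<Phi>) s) q = of_bool (q = Node (Name (Colour X (length \<pi>))) s)"
| "edge_prob V \<sigma> \<tau> \<pi> (Node (Name (Colour X i)) s) q =
     (case \<pi> ! i of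
        Node (Mu Y \<Phi>) s' \<Rightarrow> of_bool (q = Node (subst_colour X i \<Phi>) s)
      | Node (Nu Y \<Phi>) s' \<Rightarrow> of_bool (q = Node (subst_colour X i \<Phi>) s)
      | _ \<Rightarrow> 0)"
| "edge_prob V \<sigma> \<tau> \<pi> (Node (Name (Plain X)) s) q = 0"

definition tree_paths :: "('v, 'a, 'k, 'g, 's :: finite) valuation \<Rightarrow>
    ('v, 'a, 'k, 'g, 's) pos strategy \<Rightarrow> ('v, 'a, 'k, 'g, 's) pos strategy \<Rightarrow>
    ('v, 'a, 'k, 'g) form \<Rightarrow> 's \<Rightarrow> ('v, 'a, 'k, 'g, 's) pos list set" where
  "tree_paths V \<sigma> \<tau> \<phi> s =
     {\<pi>. \<pi> \<noteq> [] \<and> hd \<pi> = Node \<phi> s \<and>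
         (\<forall>i. Suc i < length \<pi> \<longrightarrow> edge_prob V \<sigma> \<tau> (take i \<pi>) (\<pi> ! i) (\<pi> ! Suc i) > 0)}"

definition maximal_paths :: "('v, 'a, 'k, 'g, 's :: finite) valuation \<Rightarrow>
    ('v, 'a, 'k, 'g, 's) pos strategy \<Rightarrow> ('v, 'a, 'k, 'g, 's) pos strategy \<Rightarrow>
    ('v, 'a, 'k, 'g) form \<Rightarrow> 's \<Rightarrow> ('v, 'a, 'k, 'g, 's) pos path set" where
  "maximal_paths V \<sigma> \<tau> \<phi> s =
     {Finite_path \<pi> |\<pi>. \<pi> \<in> tree_paths V \<sigma> \<tau> \<phi> s \<and>
        (\<forall>q. \<pi> @ [q] \<notin> tree_paths V \<sigma> \<tau> \<phi> s)} \<union>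
     {Infinite_path \<omega> |\<omega>. \<forall>n. map \<omega> [0..<Suc n] \<in> tree_paths V \<sigma> \<tau> \<phi> s}"

primrec has_prefix :: "'p list \<Rightarrow> 'p path \<Rightarrow> bool" where
  "has_prefix \<pi> (Finite_path \<rho>) \<longleftrightarrow> prefix \<pi> \<rho>"
| "has_prefix \<pi> (Infinite_path \<omega>) \<longleftrightarrow> \<pi> = map \<omega> [0..<length \<pi>]"

definition cone :: "('v, 'a, 'k, 'g, 's :: finite) valuation \<Rightarrow>
    ('v, 'a, 'k, 'g, 's) pos strategy \<Rightarrow> ('v, 'a, 'k, 'g, 's) pos strategy \<Rightarrow>
    ('v, 'a, 'k, 'g) form \<Rightarrow> 's \<Rightarrow> ('v, 'a, 'k, 'g, 's) pos list \<Rightarrow>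
    ('v, 'a, 'k, 'g, 's) pos path set" where
  "cone V \<sigma> \<tau> \<phi> s \<pi> = {\<rho> \<in> maximal_paths V \<sigma> \<tau> \<phi> s. has_prefix \<pi> \<rho>}"

definition path_prob :: "('v, 'a, 'k, 'g, 's :: finite) valuation \<Rightarrow>
    ('v, 'a, 'k, 'g, 's) pos strategy \<Rightarrow> ('v, 'a, 'k, 'g, 's) pos strategy \<Rightarrow>
    ('v, 'a, 'k, 'g, 's) pos list \<Rightarrow> real" where
  "path_prob V \<sigma> \<tau> \<pi> =
     (\<Prod>i<length \<pi> - 1. edge_prob V \<sigma> \<tau> (take i \<pi>) (\<pi> ! i) (\<pi> ! Suc i))"

text \<open>The measure determined by the tree: the sigma-algebra on the maximal paths is generated
  by the cones, and each cone has the probability of its prefix.\<close>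

definition tree_measure :: "('v, 'a, 'k, 'g, 's :: finite) valuation \<Rightarrow>
    ('v, 'a, 'k, 'g, 's) pos strategy \<Rightarrow> ('v, 'a, 'k, 'g, 's) pos strategy \<Rightarrow>
    ('v, 'a, 'k, 'g) form \<Rightarrow> 's \<Rightarrow> ('v, 'a, 'k, 'g, 's) pos path measure" where
  "tree_measure V \<sigma> \<tau> \<phi> s =
     extend_measure (maximal_paths V \<sigma> \<tau> \<phi> s) (tree_paths V \<sigma> \<tau> \<phi> s)
       (cone V \<sigma> \<tau> \<phi> s) (\<lambda>\<pi>. ennreal (path_prob V \<sigma> \<tau> \<pi>))"

text \<open>A colour occurs at a step when it is itself the formula of the position there; colours
  inside larger formulas do not count. A colour \<open>X\<^sub>i\<close> is a \<open>\<nu>\<close>-colour if element \<open>i\<close> of the path,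
  where it was created, is a greatest fixed point.\<close>

definition occurs_infinitely_often ::
  "'v \<Rightarrow> nat \<Rightarrow> (nat \<Rightarrow> ('v, 'a, 'k, 'g, 's) pos) \<Rightarrow> bool" where
  "occurs_infinitely_often X i \<omega> \<longleftrightarrow> (\<exists>\<^sub>\<infinity>n. \<exists>s. \<omega> n = Node (Name (Colour X i)) s)"

definition nu_colour :: "'v \<Rightarrow> nat \<Rightarrow> (nat \<Rightarrow> ('v, 'a, 'k, 'g, 's) pos) \<Rightarrow> bool" where
  "nu_colour X i \<omega> \<longleftrightarrow> (\<exists>\<Phi> s. \<omega> i = Node (Nu X \<Phi>) s)"

primrec Val :: "('v, 'a, 'k, 'g, 's) pos path \<Rightarrow> real" where
  "Val (Finite_path \<pi>) = (case last \<pi> of Tip y \<Rightarrow> y | Node \<psi> s \<Rightarrow> 0)"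
| "Val (Infinite_path \<omega>) =
     of_bool (\<exists>X i. occurs_infinitely_often X i \<omega> \<and> nu_colour X i \<omega>)"

definition expected_payoff :: "('v, 'a, 'k, 'g, 's :: finite) valuation \<Rightarrow>
    ('v, 'a, 'k, 'g, 's) pos strategy \<Rightarrow> ('v, 'a, 'k, 'g, 's) pos strategy \<Rightarrow>
    ('v, 'a, 'k, 'g) form \<Rightarrow> 's \<Rightarrow> real" where
  "expected_payoff V \<sigma> \<tau> \<phi> s = (\<integral>\<pi>. Val \<pi> \<partial>tree_measure V \<sigma> \<tau> \<phi> s)"

end

theory Submission
  imports Defs
begin

text \<open>
  By symmetry consider Max. Each \<open>\<mu>\<close>-colour is given, at its creation, a finite budget of
  iterations of its body starting from 0, chosen so that the iterate is within a small \<open>\<epsilon>\<close> of the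
  least fixed point; each later visit to the colour consumes one iteration, while \<open>\<nu>\<close>-colours keep
  the greatest fixed point itself. Interpreting the colours in this way, the denotation of the
  current position decreases by at most the chosen \<open>\<epsilon>\<close> in expectation along the tree, provided that
  Max always picks the better branch, so it is a submartingale up to a total error that can be made
  arbitrarily small. On an infinite play some colour occurs infinitely often. If it is a
  \<open>\<nu>\<close>-colour, the payoff is 1; if it is a \<open>\<mu>\<close>-colour, its budget runs out and the value is frozen
  at 0. Hence the payoff dominates the limit of the process, and by Fatou's lemma Max secures the
  denotation up to the error. The dual strategy for Min starts the \<open>\<nu>\<close>-colours at 1. The tree
  measure exists because it is the image of a product measure with one independent choice of
  successor for every finite path.
\<close>

section \<open>The measure on the plays of a tree\<close>

text \<open>Both players are treated at once: \<open>deficit\<close> measures how far a value is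
  from the player's ideal payoff (1 for Max, 0 for Min), so both claims become an upper bound for
  one nonnegative supermartingale, and Fatou's lemma points the right way. The obstacle is nesting:
  the iterate attached to a colour depends on the values of the outer colours, and these may change
  at each visit. Unfolding is sound because a visit to an outer colour makes the inner colours that
  depend on it unreachable; a later passage through the inner binder creates a new colour with a new
  budget. Hence every colour that can still be visited sees the names of its body with the values
  they had at its creation. Finiteness of the state space makes the convergence of iterates uniform,
  so that iteration up to omega and one budget for all states suffice. A colour created at position
  \<open>i\<close> is allowed an error proportional to \<open>2^-i\<close>, which is summable
  however many colours a play creates. The strategy has to read colours although strategies are
  colour-insensitive; this is why coherence of colourings is kept as an invariant.\<close>

primrec path_prefix :: "nat \<Rightarrow> 'p path \<Rightarrow> 'p list" where
  "path_prefix n (Finite_path \<pi>) = take (Suc n) \<pi>"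
| "path_prefix n (Infinite_path \<omega>) = map \<omega> [0..<Suc n]"

text \<open>The index counts moves, so prefixes have \<open>Suc n\<close> positions, and a finished
  play is padded by repetition. A cone thus becomes a fibre of a single map
  \<open>path_prefix n\<close>.\<close>

lemma has_prefix_iff_path_prefix:
  assumes "\<pi> \<noteq> []"
  shows "has_prefix \<pi> \<rho> \<longleftrightarrow> path_prefix (length \<pi> - 1) \<rho> = \<pi>"
proof (cases \<rho>)
  case (Finite_path x)
  have "Suc (length \<pi> - 1) = length \<pi>" using assms by (cases \<pi>) auto
  then show ?thesis unfolding Finite_path
    by (simp only: has_prefix.simps path_prefix.simps) (metis append_eq_conv_conj prefix_def take_is_prefix)
next
  case (Infinite_path x)
  have "Suc (length \<pi> - 1) = length \<pi>" using assms by (cases \<pi>) auto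
  then show ?thesis unfolding Infinite_path
    by (simp only: has_prefix.simps path_prefix.simps) metis
qed

text \<open>The edge rules enter the measure construction only through this dichotomy: a path either
  ends or its edges form a finitely supported distribution. So no mass is lost, and each depth
  carries finitely many paths.\<close>

locale game_tree =
  fixes V :: "('v, 'a, 'k, 'g, 's :: finite) valuation"
    and \<sigma> \<tau> :: "('v, 'a, 'k, 'g, 's) pos strategy"
    and \<phi> :: "('v, 'a, 'k, 'g) form"
    and s :: 's
  assumes successors: "\<pi> \<in> tree_paths V \<sigma> \<tau> \<phi> s \<Longrightarrow>
    (\<forall>q. edge_prob V \<sigma> \<tau> (butlast \<pi>) (last \<pi>) q = 0) \<or>
    (\<exists>p. finite (set_pmf p) \<and> (\<forall>q. pmf p q = edge_prob V \<sigma> \<tau> (butlast \<pi>) (last \<pi>) q))"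
begin

abbreviation "paths \<equiv> tree_paths V \<sigma> \<tau> \<phi> s"
abbreviation "plays \<equiv> maximal_paths V \<sigma> \<tau> \<phi> s"
abbreviation "e \<pi> q \<equiv> edge_prob V \<sigma> \<tau> (butlast \<pi>) (last \<pi>) q"
abbreviation "T \<equiv> tree_measure V \<sigma> \<tau> \<phi> s"

definition terminal :: "('v, 'a, 'k, 'g, 's) pos list \<Rightarrow> bool" where
  "terminal \<pi> \<longleftrightarrow> (\<forall>q. e \<pi> q = 0)"

lemma not_terminal: "e \<pi> q > 0 \<Longrightarrow> \<not> terminal \<pi>"
  unfolding terminal_def by (metis less_irrefl)

lemma terminal_no_succs: "terminal \<pi> \<Longrightarrow> \<not> e \<pi> q > 0"
  by (simp add: terminal_def)

lemma paths_snoc_iff: "\<pi> \<noteq> [] \<Longrightarrow> \<pi> @ [q] \<in> paths \<longleftrightarrow> \<pi> \<in> paths \<and> e \<pi> q > 0"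
proof -
  assume ne: "\<pi> \<noteq> []"
  define P where "P \<rho> i \<longleftrightarrow> edge_prob V \<sigma> \<tau> (take i \<rho>) (\<rho> ! i) (\<rho> ! Suc i) > 0" for \<rho> i
  have 1: "P (\<pi> @ [q]) i = P \<pi> i" if "Suc i < length \<pi>" for i
    using that by (auto simp: P_def nth_append)
  have 2: "P (\<pi> @ [q]) (length \<pi> - 1) \<longleftrightarrow> e \<pi> q > 0"
    using ne by (auto simp: P_def nth_append last_conv_nth butlast_conv_take)
  have "(\<forall>i. Suc i < length (\<pi> @ [q]) \<longrightarrow> P (\<pi> @ [q]) i) \<longleftrightarrow>
    (\<forall>i. Suc i < length \<pi> \<longrightarrow> P (\<pi> @ [q]) i) \<and> P (\<pi> @ [q]) (length \<pi> - 1)"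
    using ne by (cases \<pi> rule: rev_cases) (auto simp: less_Suc_eq)
  then have "(\<forall>i. Suc i < length (\<pi> @ [q]) \<longrightarrow> P (\<pi> @ [q]) i) \<longleftrightarrow>
    (\<forall>i. Suc i < length \<pi> \<longrightarrow> P \<pi> i) \<and> e \<pi> q > 0"
    using 1 2 by auto
  then show ?thesis
    using ne unfolding tree_paths_def P_def by auto
qed

lemma root_in_paths: "[Node \<phi> s] \<in> paths"
  by (auto simp: tree_paths_def)

lemma paths_not_Nil: "\<pi> \<in> paths \<Longrightarrow> \<pi> \<noteq> []"
  by (auto simp: tree_paths_def)

lemma paths_take: "\<pi> \<in> paths \<Longrightarrow> n > 0 \<Longrightarrow> take n \<pi> \<in> paths"
  by (auto simp: tree_paths_def hd_conv_nth)

lemma path_prob_snoc: "\<pi> \<noteq> [] \<Longrightarrow> path_prob V \<sigma> \<tau> (\<pi> @ [q]) = path_prob V \<sigma> \<tau> \<pi> * e \<pi> q"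
proof -
  assume ne: "\<pi> \<noteq> []"
  define k where "k = length \<pi> - 1"
  have len: "length \<pi> = Suc k" using ne by (cases \<pi>) (auto simp: k_def)
  have 1: "(\<Prod>i<k. edge_prob V \<sigma> \<tau> (take i (\<pi> @ [q])) ((\<pi> @ [q]) ! i) ((\<pi> @ [q]) ! Suc i)) =
      (\<Prod>i<k. edge_prob V \<sigma> \<tau> (take i \<pi>) (\<pi> ! i) (\<pi> ! Suc i))"
    by (intro prod.cong refl) (auto simp: len nth_append)
  show ?thesis
    unfolding path_prob_def using 1 ne
    by (simp add: len lessThan_Suc mult.commute nth_append last_conv_nth butlast_conv_take)
qed

section \<open>Independent choices of successors and the probabilities of cones\<close>

definition succ_pmf :: "('v, 'a, 'k, 'g, 's) pos list \<Rightarrow> ('v, 'a, 'k, 'g, 's) pos pmf" where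
  "succ_pmf \<pi> = (SOME p. finite (set_pmf p) \<and> (\<forall>q. pmf p q = e \<pi> q))"

lemma succ_pmf:
  assumes "\<pi> \<in> paths" "\<not> terminal \<pi>"
  shows "finite (set_pmf (succ_pmf \<pi>))" "pmf (succ_pmf \<pi>) q = e \<pi> q"
proof -
  have "\<exists>p. finite (set_pmf p) \<and> (\<forall>q. pmf p q = e \<pi> q)"
    using successors[OF assms(1)] assms(2) unfolding terminal_def by blast
  from someI_ex[OF this] show "finite (set_pmf (succ_pmf \<pi>))" "pmf (succ_pmf \<pi>) q = e \<pi> q"
    unfolding succ_pmf_def by auto
qed

lemma e_nonneg: "\<pi> \<in> paths \<Longrightarrow> e \<pi> q \<ge> 0"
  using succ_pmf(2)[of \<pi> q] pmf_nonneg[of "succ_pmf \<pi>" q] by (cases "terminal \<pi>") (simp add: terminal_def, simp)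

lemma set_succ_pmf: "\<pi> \<in> paths \<Longrightarrow> \<not> terminal \<pi> \<Longrightarrow> set_pmf (succ_pmf \<pi>) = {q. e \<pi> q > 0}"
  using e_nonneg[of \<pi>] by (auto simp: set_pmf_eq succ_pmf(2) less_le)

lemma finite_succs: "\<pi> \<in> paths \<Longrightarrow> finite {q. e \<pi> q > 0}"
  using succ_pmf(1)[of \<pi>] set_succ_pmf[of \<pi>] by (cases "terminal \<pi>") (simp add: terminal_def, simp)

lemma sum_succs: "\<pi> \<in> paths \<Longrightarrow> \<not> terminal \<pi> \<Longrightarrow> (\<Sum>q | e \<pi> q > 0. e \<pi> q) = 1"
  using sum_pmf_eq_1[OF succ_pmf(1) order_refl, of \<pi>]
  by (simp add: set_succ_pmf succ_pmf(2))

lemma path_prob_nonneg: "\<pi> \<in> paths \<Longrightarrow> path_prob V \<sigma> \<tau> \<pi> \<ge> 0"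
  unfolding path_prob_def by (intro prod_nonneg) (auto simp: tree_paths_def less_imp_le)

lemma path_prefix_paths: "\<rho> \<in> plays \<Longrightarrow> path_prefix n \<rho> \<in> paths"
  by (auto simp: maximal_paths_def intro!: paths_take simp del: upt_Suc)

text \<open>Off the support, a null event, the choice is redirected into it. Hence every
  \<open>w\<close>, not just almost every one, yields a play.\<close>

definition pick :: "(('v, 'a, 'k, 'g, 's) pos list \<Rightarrow> ('v, 'a, 'k, 'g, 's) pos) \<Rightarrow>
    ('v, 'a, 'k, 'g, 's) pos list \<Rightarrow> ('v, 'a, 'k, 'g, 's) pos" where
  "pick w \<pi> = (if w \<pi> \<in> set_pmf (succ_pmf \<pi>) then w \<pi>
     else (SOME q. q \<in> set_pmf (succ_pmf \<pi>)))"

lemma pick_in: "pick w \<pi> \<in> set_pmf (succ_pmf \<pi>)"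
  using someI_ex[of "\<lambda>q. q \<in> set_pmf (succ_pmf \<pi>)"] set_pmf_not_empty[of "succ_pmf \<pi>"]
  by (auto simp: pick_def)

primrec walk :: "(('v, 'a, 'k, 'g, 's) pos list \<Rightarrow> ('v, 'a, 'k, 'g, 's) pos) \<Rightarrow> nat \<Rightarrow>
    ('v, 'a, 'k, 'g, 's) pos list" where
  "walk w 0 = [Node \<phi> s]"
| "walk w (Suc n) = (if terminal (walk w n) then walk w n
     else walk w n @ [pick w (walk w n)])"

lemma walk_in_paths: "walk w n \<in> paths"
proof (induction n)
  case 0
  then show ?case by (simp add: root_in_paths)
next
  case (Suc n)
  then show ?case
    using pick_in[of w "walk w n"]
    by (auto simp: set_succ_pmf paths_snoc_iff[OF paths_not_Nil])
qed

lemma walk_length: "length (walk w n) = Suc n \<or> terminal (walk w n) \<and> length (walk w n) \<le> n"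
  by (induction n) auto

lemma walk_take: "m \<le> n \<Longrightarrow> walk w m = take (Suc m) (walk w n)"
proof (induction n)
  case 0
  then show ?case by simp
next
  case (Suc n)
  show ?case
  proof (cases "m = Suc n")
    case True
    then show ?thesis using walk_length[of w "Suc n"] by (simp del: walk.simps)  auto
  next
    case False
    then have "walk w m = take (Suc m) (walk w n)" using Suc by auto
    then show ?thesis using walk_length[of w n] Suc.prems False by auto
  qed
qed

definition outcome :: "(('v, 'a, 'k, 'g, 's) pos list \<Rightarrow> ('v, 'a, 'k, 'g, 's) pos) \<Rightarrow>
    ('v, 'a, 'k, 'g, 's) pos path" where
  "outcome w = (if \<exists>n. terminal (walk w n) then Finite_path (walk w (LEAST n. terminal (walk w n)))
     else Infinite_path (\<lambda>n. last (walk w n)))"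

lemma walk_terminal: "terminal (walk w n) \<Longrightarrow> n \<le> m \<Longrightarrow> walk w m = walk w n"
  by (induction m) (auto simp: le_Suc_eq)

lemma walk_eq_map: "(\<forall>n. \<not> terminal (walk w n)) \<Longrightarrow> walk w n = map (\<lambda>n. last (walk w n)) [0..<Suc n]"
proof (induction n)
  case 0
  then show ?case by simp
next
  case (Suc n)
  let ?f = "\<lambda>n. last (walk w n)"
  have "walk w (Suc n) = walk w n @ [?f (Suc n)]" using Suc.prems by simp
  also have "\<dots> = map ?f [0..<Suc n] @ [?f (Suc n)]"
    using Suc.IH[OF Suc.prems] by (rule arg_cong)
  also have "\<dots> = map ?f [0..<Suc (Suc n)]" by (simp del: walk.simps)
  finally show ?case .
qed

lemma path_prefix_outcome: "path_prefix n (outcome w) = walk w n"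
proof (cases "\<exists>n. terminal (walk w n)")
  case True
  define m where "m = (LEAST n. terminal (walk w n))"
  have m: "terminal (walk w m)" using True unfolding m_def by (metis (mono_tags, lifting) LeastI)
  have "path_prefix n (outcome w) = take (Suc n) (walk w m)"
    using True by (simp add: outcome_def m_def)
  also have "\<dots> = walk w n"
  proof (cases "n \<le> m")
    case True
    then show ?thesis using walk_take by metis
  next
    case False
    then have "walk w n = walk w m" by (intro walk_terminal[OF m]) simp
    then show ?thesis using walk_length[of w n] by auto
  qed
  finally show ?thesis .
next
  case False
  then have "outcome w = Infinite_path (\<lambda>n. last (walk w n))" by (simp add: outcome_def)
  then have "path_prefix n (outcome w) = map (\<lambda>n. last (walk w n)) [0..<Suc n]"
    by (simp only: path_prefix.simps)
  also have "\<dots> = walk w n" using False by (intro walk_eq_map[symmetric]) simp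
  finally show ?thesis .
qed

lemma outcome_in_plays: "outcome w \<in> plays"
proof (cases "\<exists>n. terminal (walk w n)")
  case True
  define m where "m = (LEAST n. terminal (walk w n))"
  have m: "terminal (walk w m)" using True unfolding m_def by (metis (mono_tags, lifting) LeastI)
  have "outcome w = Finite_path (walk w m)" using True by (simp add: outcome_def m_def)
  then show ?thesis
    using walk_in_paths[of w m] m by (auto simp: maximal_paths_def paths_snoc_iff[OF paths_not_Nil] terminal_no_succs)
next
  case False
  then have "outcome w = Infinite_path (\<lambda>n. last (walk w n))" by (simp add: outcome_def)
  moreover have "map (\<lambda>n. last (walk w n)) [0..<Suc n] \<in> paths" for n
    by (subst walk_eq_map[symmetric]) (use False walk_in_paths in simp_all)
  ultimately show ?thesis by (auto simp: maximal_paths_def simp del: upt_Suc)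
qed

text \<open>Following \<open>\<pi>\<close> constrains \<open>w\<close> only at the proper nonempty
  prefixes of \<open>\<pi>\<close>. These are distinct coordinates, so independence turns the event
  into a product.\<close>

lemma walk_eq_iff:
  assumes "\<pi> \<in> paths"
  shows "walk w (length \<pi> - 1) = \<pi> \<longleftrightarrow>
    (\<forall>\<rho>\<in>(\<lambda>i. take (Suc i) \<pi>) ` {..<length \<pi> - 1}. pick w \<rho> = \<pi> ! length \<rho>)"
  using assms
proof (induction \<pi> rule: rev_induct)
  case Nil
  then show ?case using paths_not_Nil by auto
next
  case (snoc q \<pi>)
  show ?case
  proof (cases "\<pi> = []")
    case True
    then show ?thesis using snoc.prems by (auto simp: tree_paths_def)
  next
    case False
    then obtain k where k: "length \<pi> = Suc k" by (cases \<pi>) auto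
    have \<pi>: "\<pi> \<in> paths" "e \<pi> q > 0" using snoc.prems False by (auto simp: paths_snoc_iff)
    have nt: "\<not> terminal \<pi>" using \<pi>(2) by (rule not_terminal)
    have IH: "walk w k = \<pi> \<longleftrightarrow> (\<forall>i<k. pick w (take (Suc i) \<pi>) = \<pi> ! Suc i)"
      using snoc.IH[OF \<pi>(1)] by (auto simp: k min_def)
    have "walk w (Suc k) = \<pi> @ [q] \<longleftrightarrow> walk w k = \<pi> \<and> pick w \<pi> = q"
    proof
      assume *: "walk w (Suc k) = \<pi> @ [q]"
      then have "walk w k = \<pi>" using walk_take[of k "Suc k" w] k by (simp del: walk.simps)
      then show "walk w k = \<pi> \<and> pick w \<pi> = q" using * nt by simp
    qed (use nt in auto)
    also have "\<dots> \<longleftrightarrow> (\<forall>i<Suc k. pick w (take (Suc i) \<pi>) = (\<pi> @ [q]) ! Suc i)"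
    proof -
      define Q where "Q i \<longleftrightarrow> pick w (take (Suc i) \<pi>) = (\<pi> @ [q]) ! Suc i" for i
      have "pick w (take (Suc i) \<pi>) = \<pi> ! Suc i \<longleftrightarrow> Q i" if "i < k" for i
        using that k by (simp add: Q_def nth_append)
      moreover have "pick w \<pi> = q \<longleftrightarrow> Q k" using k by (simp add: Q_def nth_append)
      moreover have "(\<forall>i<Suc k. Q i) \<longleftrightarrow> (\<forall>i<k. Q i) \<and> Q k" by (auto simp only: less_Suc_eq)
      ultimately show ?thesis unfolding IH Q_def[symmetric] by simp
    qed
    also have "\<dots> \<longleftrightarrow> (\<forall>i\<in>{..<length (\<pi> @ [q]) - 1}. pick w (take (Suc i) (\<pi> @ [q])) =
        (\<pi> @ [q]) ! length (take (Suc i) (\<pi> @ [q])))"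
    proof -
      have "take (Suc i) (\<pi> @ [q]) = take (Suc i) \<pi>" "length (take (Suc i) \<pi>) = Suc i" if "i < Suc k" for i
        using that k by auto
      then show ?thesis using k by (metis (no_types, lifting) diff_Suc_1 length_append_singleton lessThan_iff)
    qed
    finally show ?thesis using k by (simp only: length_append_singleton diff_Suc_1) blast
  qed
qed

abbreviation "choices \<equiv> PiM UNIV (\<lambda>\<pi>. measure_pmf (succ_pmf \<pi>))"

lemma emeasure_walk:
  assumes "\<pi> \<in> paths"
  shows "{w. walk w (length \<pi> - 1) = \<pi>} \<in> sets choices" (is ?A)
    and "emeasure choices {w. walk w (length \<pi> - 1) = \<pi>} = ennreal (path_prob V \<sigma> \<tau> \<pi>)" (is ?B)
proof -
  interpret P: product_prob_space "\<lambda>\<pi>. measure_pmf (succ_pmf \<pi>)" UNIV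
    by unfold_locales
  define d where "d \<rho> = (SOME q. q \<in> set_pmf (succ_pmf \<rho>))" for \<rho>
  define J where "J = (\<lambda>i. take (Suc i) \<pi>) ` {..<length \<pi> - 1}"
  define C where "C \<rho> = {x. (if x \<in> set_pmf (succ_pmf \<rho>) then x else d \<rho>) = \<pi> ! length \<rho>}" for \<rho>
  have eq: "{w. walk w (length \<pi> - 1) = \<pi>} = {w \<in> space choices. \<forall>\<rho>\<in>J. w \<rho> \<in> C \<rho>}"
    unfolding walk_eq_iff[OF assms] J_def pick_def C_def d_def by (auto simp: space_PiM)
  have fin: "finite J" by (simp add: J_def)
  show ?A unfolding eq
  proof (rule sets.sets_Collect_finite_All[OF _ fin])
    fix \<rho>
    show "{w \<in> space choices. w \<rho> \<in> C \<rho>} \<in> sets choices"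
      by (rule sets_Collect_single'[where P="\<lambda>x. x \<in> C \<rho>"]) auto
  qed
  have inj: "inj_on (\<lambda>i. take (Suc i) \<pi>) {..<length \<pi> - 1}"
  proof (rule inj_onI)
    fix x y assume "x \<in> {..<length \<pi> - 1}" "y \<in> {..<length \<pi> - 1}" "take (Suc x) \<pi> = take (Suc y) \<pi>"
    then show "x = y" by (auto dest!: arg_cong[where f=length])
  qed
  have one: "emeasure (measure_pmf (succ_pmf (take (Suc i) \<pi>))) (C (take (Suc i) \<pi>)) =
     ennreal (edge_prob V \<sigma> \<tau> (take i \<pi>) (\<pi> ! i) (\<pi> ! Suc i))" if i: "i < length \<pi> - 1" for i
  proof -
    let ?\<rho> = "take (Suc i) \<pi>"
    have ei: "e ?\<rho> = edge_prob V \<sigma> \<tau> (take i \<pi>) (\<pi> ! i)"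
      using i by (auto simp: butlast_take take_Suc_conv_app_nth)
    have pos: "e ?\<rho> (\<pi> ! Suc i) > 0" unfolding ei using assms i by (auto simp: tree_paths_def)
    have \<rho>: "?\<rho> \<in> paths" using paths_take[OF assms] by simp
    have nt: "\<not> terminal ?\<rho>" using pos by (rule not_terminal)
    have len: "length ?\<rho> = Suc i" using i by auto
    have mem: "\<pi> ! Suc i \<in> set_pmf (succ_pmf ?\<rho>)" using pos by (simp add: set_succ_pmf[OF \<rho> nt])
    have "emeasure (measure_pmf (succ_pmf ?\<rho>)) (C ?\<rho>) =
      emeasure (measure_pmf (succ_pmf ?\<rho>)) (C ?\<rho> \<inter> set_pmf (succ_pmf ?\<rho>))"
      by (simp add: emeasure_Int_set_pmf)
    \<comment> \<open>Within the support the redirection in \<open>pick\<close> does nothing, so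
      only the wanted successor remains.\<close>
    also have "C ?\<rho> \<inter> set_pmf (succ_pmf ?\<rho>) = {\<pi> ! Suc i}"
      using mem unfolding C_def len by auto
    also have "emeasure (measure_pmf (succ_pmf ?\<rho>)) {\<pi> ! Suc i} = ennreal (e ?\<rho> (\<pi> ! Suc i))"
      by (simp add: emeasure_pmf_single succ_pmf(2)[OF \<rho> nt])
    finally show ?thesis unfolding ei .
  qed
  have "emeasure choices {w. walk w (length \<pi> - 1) = \<pi>} = 
      (\<Prod>\<rho>\<in>J. emeasure (measure_pmf (succ_pmf \<rho>)) (C \<rho>))"
    unfolding eq using fin by (intro P.emeasure_PiM_Collect) auto
  also have "\<dots> = (\<Prod>i<length \<pi> - 1. ennreal (edge_prob V \<sigma> \<tau> (take i \<pi>) (\<pi> ! i) (\<pi> ! Suc i)))"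
    unfolding J_def by (subst prod.reindex[OF inj]) (auto simp: one)
  also have "\<dots> = ennreal (path_prob V \<sigma> \<tau> \<pi>)"
    unfolding path_prob_def using assms
    by (intro prod_ennreal) (auto simp: tree_paths_def less_imp_le)
  finally show ?B .
qed

lemma cone_eq: "\<pi> \<in> paths \<Longrightarrow> cone V \<sigma> \<tau> \<phi> s \<pi> = {\<rho> \<in> plays. path_prefix (length \<pi> - 1) \<rho> = \<pi>}"
  by (simp add: cone_def has_prefix_iff_path_prefix[OF paths_not_Nil])

lemma space_T: "space T = plays"
  unfolding tree_measure_def by (rule space_extend_measure) (auto simp: cone_def)

lemma sets_T: "sets T = sigma_sets plays (cone V \<sigma> \<tau> \<phi> s ` paths)"
  unfolding tree_measure_def by (rule sets_extend_measure) (auto simp: cone_def)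

lemma cone_in_sets: "\<pi> \<in> paths \<Longrightarrow> cone V \<sigma> \<tau> \<phi> s \<pi> \<in> sets T"
  unfolding sets_T by auto

text \<open>\<open>extend_measure\<close> has the prescribed values only if some measure on the same
  sigma-algebra has them. The image of \<open>choices\<close> under \<open>outcome\<close> is that
  witness.\<close>

lemma emeasure_cone:
  assumes "\<pi> \<in> paths"
  shows "emeasure T (cone V \<sigma> \<tau> \<phi> s \<pi>) = ennreal (path_prob V \<sigma> \<tau> \<pi>)"
proof -
  have preimage: "outcome -` cone V \<sigma> \<tau> \<phi> s \<rho> = {w. walk w (length \<rho> - 1) = \<rho>}" if "\<rho> \<in> paths" for \<rho>
    using outcome_in_plays by (auto simp: cone_eq[OF that] path_prefix_outcome)
  have sp: "space choices = UNIV" by (simp add: space_PiM)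
  have meas: "outcome \<in> measurable choices T"
  proof (rule measurable_sigma_sets[OF sets_T])
    show "cone V \<sigma> \<tau> \<phi> s ` paths \<subseteq> Pow plays" by (auto simp: cone_def)
    show "outcome \<in> space choices \<rightarrow> plays" using outcome_in_plays by auto
    fix y assume "y \<in> cone V \<sigma> \<tau> \<phi> s ` paths"
    then show "outcome -` y \<inter> space choices \<in> sets choices"
      using preimage emeasure_walk(1) by (auto simp: sp)
  qed
  show ?thesis
  proof (rule emeasure_extend_measure[where \<mu>'="emeasure (distr choices T outcome)",
        OF tree_measure_def])
    show "positive (sets (tree_measure V \<sigma> \<tau> \<phi> s)) (emeasure (distr choices T outcome))"
      by (simp add: positive_def)
    show "countably_additive (sets (tree_measure V \<sigma> \<tau> \<phi> s)) (emeasure (distr choices T outcome))"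
      using emeasure_countably_additive[of "distr choices T outcome"] by simp
    fix \<rho> assume "\<rho> \<in> paths"
    then show "emeasure (distr choices T outcome) (cone V \<sigma> \<tau> \<phi> s \<rho>) = ennreal (path_prob V \<sigma> \<tau> \<rho>)"
      by (simp add: emeasure_distr[OF meas cone_in_sets] sp preimage emeasure_walk(2) del: One_nat_def)
  qed (use assms in \<open>auto simp: cone_def\<close>)
qed

lemma path_prefix_0: "\<rho> \<in> plays \<Longrightarrow> path_prefix 0 \<rho> = [Node \<phi> s]"
  using path_prefix_paths[of \<rho> 0]
  by (cases \<rho>) (auto simp: tree_paths_def take_Suc split: if_splits)

lemma prob_space_T: "prob_space T"
proof
  have "cone V \<sigma> \<tau> \<phi> s [Node \<phi> s] = space T"
    using path_prefix_0 by (auto simp: cone_eq[OF root_in_paths] space_T)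
  then show "emeasure T (space T) = 1"
    using emeasure_cone[OF root_in_paths] by (simp add: path_prob_def)
qed

end

sublocale game_tree \<subseteq> T: prob_space "tree_measure V \<sigma> \<tau> \<phi> s"
  by (rule prob_space_T)

section \<open>Finite levels of the tree and integrals of functions of a prefix\<close>

context game_tree
begin

lemma path_prefix_take: "m \<le> n \<Longrightarrow> path_prefix m \<rho> = take (Suc m) (path_prefix n \<rho>)"
  by (cases \<rho>) (auto simp: min_def take_map simp del: upt_Suc)

text \<open>A finished path is its own extension, matching the padding in
  \<open>path_prefix\<close>, so that the total probability of a level stays 1.\<close>

definition extensions :: "('v, 'a, 'k, 'g, 's) pos list \<Rightarrow> ('v, 'a, 'k, 'g, 's) pos list set" where
  "extensions \<pi> = (if terminal \<pi> then {\<pi>} else (\<lambda>q. \<pi> @ [q]) ` {q. e \<pi> q > 0})"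

primrec level :: "nat \<Rightarrow> ('v, 'a, 'k, 'g, 's) pos list set" where
  "level 0 = {[Node \<phi> s]}"
| "level (Suc n) = (\<Union>\<pi>\<in>level n. extensions \<pi>)"

lemma level_paths: "\<pi> \<in> level n \<Longrightarrow> \<pi> \<in> paths"
proof (induction n arbitrary: \<pi>)
  case (Suc n)
  then obtain \<pi>' where "\<pi>' \<in> level n" "\<pi> \<in> extensions \<pi>'" by auto
  then show ?case using Suc.IH[of \<pi>']
    by (auto simp: extensions_def paths_snoc_iff[OF paths_not_Nil] split: if_splits)
qed (simp add: root_in_paths)

lemma level_length: "\<pi> \<in> level n \<Longrightarrow> length \<pi> = Suc n \<or> terminal \<pi> \<and> length \<pi> \<le> n"
proof (induction n arbitrary: \<pi>)
  case (Suc n)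
  then obtain \<pi>' where "\<pi>' \<in> level n" "\<pi> \<in> extensions \<pi>'" by auto
  then show ?case using Suc.IH[of \<pi>']
    by (auto simp: extensions_def split: if_splits)
qed simp

lemma finite_extensions: "\<pi> \<in> paths \<Longrightarrow> finite (extensions \<pi>)"
  by (simp add: extensions_def finite_succs)

lemma finite_level: "finite (level n)"
proof (induction n)
  case (Suc n)
  then show ?case using finite_extensions level_paths by auto
qed simp

text \<open>A finite play can stop only where no edge leaves: maximality rules out every positive
  edge from its last position.\<close>

lemma path_prefix_extensions:
  assumes "\<rho> \<in> plays"
  shows "path_prefix (Suc n) \<rho> \<in> extensions (path_prefix n \<rho>)"
proof -
  have snoc: "\<pi> @ [q] \<in> extensions \<pi>" if "\<pi> \<noteq> []" "\<pi> @ [q] \<in> paths" for \<pi> q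
  proof -
    have "e \<pi> q > 0" using that by (simp add: paths_snoc_iff)
    then show ?thesis using not_terminal[of \<pi> q] by (simp add: extensions_def)
  qed
  show ?thesis
  proof (cases \<rho>)
    case (Finite_path \<pi>)
    then have \<pi>: "\<pi> \<in> paths" "\<And>q. \<pi> @ [q] \<notin> paths" using assms by (auto simp: maximal_paths_def)
    show ?thesis
    proof (cases "Suc n < length \<pi>")
      case True
      then have "take (Suc (Suc n)) \<pi> = take (Suc n) \<pi> @ [\<pi> ! Suc n]"
        by (simp add: take_Suc_conv_app_nth)
      then show ?thesis
        using snoc[of "take (Suc n) \<pi>" "\<pi> ! Suc n"] paths_take[OF \<pi>(1), of "Suc (Suc n)"]
          paths_not_Nil[OF \<pi>(1)]
        by (simp add: Finite_path)
    next
      case False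
      have "terminal \<pi>"
        unfolding terminal_def using \<pi> paths_snoc_iff[OF paths_not_Nil[OF \<pi>(1)]] e_nonneg[OF \<pi>(1)]
        by (metis antisym_conv2)
      then show ?thesis using False by (simp add: Finite_path extensions_def)
    qed
  next
    case (Infinite_path \<omega>)
    have "path_prefix (Suc n) \<rho> = path_prefix n \<rho> @ [\<omega> (Suc n)]"
      by (simp add: Infinite_path)
    then show ?thesis
      using snoc[of "path_prefix n \<rho>" "\<omega> (Suc n)"] path_prefix_paths[OF assms, of "Suc n"]
        paths_not_Nil[OF path_prefix_paths[OF assms, of n]] by simp
  qed
qed

lemma path_prefix_level: "\<rho> \<in> plays \<Longrightarrow> path_prefix n \<rho> \<in> level n"
proof (induction n)
  case 0
  then show ?case using path_prefix_0 by simp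
next
  case (Suc n)
  then show ?case using path_prefix_extensions[of \<rho> n] by (simp del: path_prefix.simps) blast
qed

lemma path_prefix_terminal:
  assumes "\<rho> \<in> plays" "terminal (path_prefix m \<rho>)" "m \<le> n"
  shows "path_prefix n \<rho> = path_prefix m \<rho>"
  using assms(3)
proof (induction n rule: dec_induct)
  case (step n)
  then show ?case using path_prefix_extensions[OF assms(1), of n] assms(2)
    by (simp add: extensions_def)
qed simp

text \<open>A path of \<open>level n\<close> shorter than \<open>Suc n\<close> is finished, and from
  there on padding keeps the prefixes of its plays constant.\<close>

lemma cone_level:
  assumes "\<pi> \<in> level n"
  shows "cone V \<sigma> \<tau> \<phi> s \<pi> = {\<rho> \<in> plays. path_prefix n \<rho> = \<pi>}"
proof (cases "length \<pi> = Suc n")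
  case True
  then show ?thesis by (simp add: cone_eq[OF level_paths[OF assms]])
next
  case False
  then have t: "terminal \<pi>" "length \<pi> \<le> n" using level_length[OF assms] by auto
  have ne: "\<pi> \<noteq> []" using paths_not_Nil[OF level_paths[OF assms]] .
  have "path_prefix (length \<pi> - 1) \<rho> = \<pi> \<longleftrightarrow> path_prefix n \<rho> = \<pi>" if \<rho>: "\<rho> \<in> plays" for \<rho>
  proof
    assume *: "path_prefix (length \<pi> - 1) \<rho> = \<pi>"
    then show "path_prefix n \<rho> = \<pi>"
      using path_prefix_terminal[OF \<rho>, of "length \<pi> - 1" n] t by (metis diff_le_self le_trans)
  next
    assume *: "path_prefix n \<rho> = \<pi>"
    have "path_prefix (length \<pi> - 1) \<rho> = take (Suc (length \<pi> - 1)) (path_prefix n \<rho>)"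
      using t by (intro path_prefix_take) simp
    then show "path_prefix (length \<pi> - 1) \<rho> = \<pi>" unfolding * using ne by simp
  qed
  then show ?thesis by (auto simp: cone_eq[OF level_paths[OF assms]] simp del: One_nat_def)
qed

lemma extensions_disjoint:
  assumes "\<pi> \<in> level n" "\<pi>' \<in> level n" "\<pi> \<noteq> \<pi>'"
  shows "extensions \<pi> \<inter> extensions \<pi>' = {}"
  using assms level_length[OF assms(1)] level_length[OF assms(2)]
  by (auto simp: extensions_def split: if_splits)

lemma sum_level_Suc:
  fixes F :: "_ \<Rightarrow> real"
  shows "sum F (level (Suc n)) = (\<Sum>\<pi>\<in>level n. sum F (extensions \<pi>))"
  unfolding level.simps
  by (rule sum.UNION_disjoint)
    (use finite_level finite_extensions level_paths extensions_disjoint in blast)+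

lemma path_prefix_measurable: "path_prefix n \<in> measurable T (count_space UNIV)"
proof (rule measurableI)
  fix A :: "('v, 'a, 'k, 'g, 's) pos list set"
  have "path_prefix n -` A \<inter> space T = (\<Union>\<pi>\<in>A \<inter> level n. cone V \<sigma> \<tau> \<phi> s \<pi>)"
  proof (intro set_eqI iffI)
    fix \<rho> assume "\<rho> \<in> path_prefix n -` A \<inter> space T"
    then have "\<rho> \<in> plays" "path_prefix n \<rho> \<in> A \<inter> level n"
      using path_prefix_level by (auto simp: space_T)
    moreover from this have "\<rho> \<in> cone V \<sigma> \<tau> \<phi> s (path_prefix n \<rho>)"
      using cone_level[of "path_prefix n \<rho>" n] by simp
    ultimately show "\<rho> \<in> (\<Union>\<pi>\<in>A \<inter> level n. cone V \<sigma> \<tau> \<phi> s \<pi>)" by blast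
  qed (auto simp: space_T cone_level)
  also have "\<dots> \<in> sets T"
    using finite_level cone_in_sets level_paths by (intro sets.finite_UN) auto
  finally show "path_prefix n -` A \<inter> space T \<in> sets T" .
qed simp

lemma measurable_path_prefix_comp [measurable]: "(\<lambda>\<rho>. f (path_prefix n \<rho>)) \<in> borel_measurable T"
  by (rule measurable_compose[OF path_prefix_measurable]) simp

text \<open>The plays split into the cones of the finite set \<open>level n\<close>, so a function
  of the prefix is a simple function.\<close>

lemma integral_path_prefix:
  fixes h :: "_ \<Rightarrow> real"
  shows "integrable T (\<lambda>\<rho>. h (path_prefix n \<rho>))"
    and "(\<integral>\<rho>. h (path_prefix n \<rho>) \<partial>T) = (\<Sum>\<pi>\<in>level n. path_prob V \<sigma> \<tau> \<pi> * h \<pi>)"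
proof -
  let ?f = "\<lambda>\<rho>. \<Sum>\<pi>\<in>level n. h \<pi> * indicator (cone V \<sigma> \<tau> \<phi> s \<pi>) \<rho>"
  have eq: "h (path_prefix n \<rho>) = ?f \<rho>" if "\<rho> \<in> space T" for \<rho>
  proof -
    have \<rho>: "\<rho> \<in> plays" using that by (simp add: space_T)
    have "?f \<rho> = (\<Sum>\<pi>\<in>level n. if path_prefix n \<rho> = \<pi> then h \<pi> else 0)"
      by (intro sum.cong refl) (auto simp: cone_level \<rho>)
    also have "\<dots> = h (path_prefix n \<rho>)"
      using path_prefix_level[OF \<rho>, of n] finite_level[of n] by simp
    finally show ?thesis by simp
  qed
  have int: "integrable T (\<lambda>\<rho>. h \<pi> * indicator (cone V \<sigma> \<tau> \<phi> s \<pi>) \<rho>)" if "\<pi> \<in> level n" for \<pi>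
    using cone_in_sets[OF level_paths[OF that]]
    by (intro integrable_mult_right integrable_real_indicator)
      (simp_all add: T.emeasure_finite less_top[symmetric])
  show "integrable T (\<lambda>\<rho>. h (path_prefix n \<rho>))"
    using int by (subst Bochner_Integration.integrable_cong[OF refl eq]) (auto intro: Bochner_Integration.integrable_sum)
  have "(\<integral>\<rho>. h (path_prefix n \<rho>) \<partial>T) = (\<integral>\<rho>. ?f \<rho> \<partial>T)"
    by (intro Bochner_Integration.integral_cong refl eq)
  also have "\<dots> = (\<Sum>\<pi>\<in>level n. \<integral>\<rho>. h \<pi> * indicator (cone V \<sigma> \<tau> \<phi> s \<pi>) \<rho> \<partial>T)"
    using int by (rule Bochner_Integration.integral_sum)
  also have "\<dots> = (\<Sum>\<pi>\<in>level n. path_prob V \<sigma> \<tau> \<pi> * h \<pi>)"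
  proof (intro sum.cong refl)
    fix \<pi> assume \<pi>: "\<pi> \<in> level n"
    have c: "cone V \<sigma> \<tau> \<phi> s \<pi> \<in> sets T" using cone_in_sets level_paths[OF \<pi>] by auto
    have "measure T (cone V \<sigma> \<tau> \<phi> s \<pi>) = path_prob V \<sigma> \<tau> \<pi>"
      using emeasure_cone[OF level_paths[OF \<pi>]] path_prob_nonneg[OF level_paths[OF \<pi>]]
      by (simp add: measure_def)
    then show "(\<integral>\<rho>. h \<pi> * indicator (cone V \<sigma> \<tau> \<phi> s \<pi>) \<rho> \<partial>T) = path_prob V \<sigma> \<tau> \<pi> * h \<pi>"
      using c sets.sets_into_space[OF c] by (simp add: Int_absorb2)
  qed
  finally show "(\<integral>\<rho>. h (path_prefix n \<rho>) \<partial>T) = (\<Sum>\<pi>\<in>level n. path_prob V \<sigma> \<tau> \<pi> * h \<pi>)" .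
qed

text \<open>Every unfinished path of \<open>level n\<close> has length exactly \<open>Suc n\<close>,
  so all of them are charged the same error; finished paths keep their value.\<close>

lemma integral_path_prefix_step:
  fixes h :: "_ \<Rightarrow> real"
  assumes step: "\<And>\<pi>. \<pi> \<in> paths \<Longrightarrow> \<not> terminal \<pi> \<Longrightarrow>
      (\<Sum>q | e \<pi> q > 0. e \<pi> q * h (\<pi> @ [q])) \<le> h \<pi> + \<epsilon> (length \<pi>)"
    and \<epsilon>: "\<And>n. \<epsilon> n \<ge> 0"
  shows "(\<integral>\<rho>. h (path_prefix (Suc n) \<rho>) \<partial>T) \<le> (\<integral>\<rho>. h (path_prefix n \<rho>) \<partial>T) + \<epsilon> (Suc n)"
proof -
  let ?p = "path_prob V \<sigma> \<tau>"
  have one: "(\<Sum>\<pi>\<in>level n. ?p \<pi>) = 1"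
    using integral_path_prefix(2)[of "\<lambda>_. 1" n] by (simp add: T.prob_space)
  have "(\<integral>\<rho>. h (path_prefix (Suc n) \<rho>) \<partial>T) = (\<Sum>\<pi>\<in>level n. \<Sum>\<pi>'\<in>extensions \<pi>. ?p \<pi>' * h \<pi>')"
    unfolding integral_path_prefix(2) sum_level_Suc ..
  also have "\<dots> \<le> (\<Sum>\<pi>\<in>level n. ?p \<pi> * (h \<pi> + \<epsilon> (Suc n)))"
  proof (rule sum_mono)
    fix \<pi> assume l: "\<pi> \<in> level n"
    have \<pi>: "\<pi> \<in> paths" using level_paths[OF l] .
    show "(\<Sum>\<pi>'\<in>extensions \<pi>. ?p \<pi>' * h \<pi>') \<le> ?p \<pi> * (h \<pi> + \<epsilon> (Suc n))"
    proof (cases "terminal \<pi>")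
      case True
      then show ?thesis using path_prob_nonneg[OF \<pi>] \<epsilon>[of "Suc n"]
        by (simp add: extensions_def mult_left_mono)
    next
      case False
      have "(\<Sum>\<pi>'\<in>extensions \<pi>. ?p \<pi>' * h \<pi>') = (\<Sum>q | e \<pi> q > 0. ?p (\<pi> @ [q]) * h (\<pi> @ [q]))"
        using False by (simp add: extensions_def sum.reindex inj_on_def)
      also have "\<dots> = ?p \<pi> * (\<Sum>q | e \<pi> q > 0. e \<pi> q * h (\<pi> @ [q]))"
        by (simp add: path_prob_snoc[OF paths_not_Nil[OF \<pi>]] sum_distrib_left mult.assoc)
      also have "\<dots> \<le> ?p \<pi> * (h \<pi> + \<epsilon> (Suc n))"
        using step[OF \<pi> False] level_length[OF l] False path_prob_nonneg[OF \<pi>]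
        by (intro mult_left_mono) auto
      finally show ?thesis .
    qed
  qed
  also have "\<dots> = (\<Sum>\<pi>\<in>level n. ?p \<pi> * h \<pi>) + \<epsilon> (Suc n)"
    by (simp add: distrib_left sum.distrib one flip: sum_distrib_right)
  finally show ?thesis unfolding integral_path_prefix(2) .
qed

text \<open>The passage to the limit is Fatou's lemma along the path prefixes.\<close>

lemma integral_le_supermartingale:
  fixes h :: "_ \<Rightarrow> real"
  assumes h: "\<And>\<pi>. \<pi> \<in> paths \<Longrightarrow> 0 \<le> h \<pi>"
    and step: "\<And>\<pi>. \<pi> \<in> paths \<Longrightarrow> \<not> terminal \<pi> \<Longrightarrow>
      (\<Sum>q | e \<pi> q > 0. e \<pi> q * h (\<pi> @ [q])) \<le> h \<pi> + \<epsilon> (length \<pi>)"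
    and \<epsilon>: "\<And>n. \<epsilon> n \<ge> 0" "\<And>n. (\<Sum>k<n. \<epsilon> (Suc k)) \<le> \<delta>"
    and g: "g \<in> borel_measurable T" "\<And>\<rho>. \<rho> \<in> plays \<Longrightarrow> 0 \<le> g \<rho>"
    and ev: "\<And>\<rho>. \<rho> \<in> plays \<Longrightarrow> \<forall>\<^sub>F n in sequentially. g \<rho> \<le> h (path_prefix n \<rho>)"
  shows "(\<integral>\<rho>. g \<rho> \<partial>T) \<le> h [Node \<phi> s] + \<delta>"
proof -
  have \<delta>: "\<delta> \<ge> 0" using \<epsilon>(2)[of 0] by simp
  have root: "h [Node \<phi> s] \<ge> 0" using h[OF root_in_paths] .
  have "(\<integral>\<rho>. h (path_prefix n \<rho>) \<partial>T) \<le> h [Node \<phi> s] + (\<Sum>k<n. \<epsilon> (Suc k))" for n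
  proof (induction n)
    case 0
    have "(\<integral>\<rho>. h (path_prefix 0 \<rho>) \<partial>T) = (\<Sum>\<pi>\<in>level 0. path_prob V \<sigma> \<tau> \<pi> * h \<pi>)"
      by (rule integral_path_prefix(2))
    then show ?case by (simp add: path_prob_def)
  next
    case (Suc n)
    have "(\<integral>\<rho>. h (path_prefix (Suc n) \<rho>) \<partial>T) \<le> (\<integral>\<rho>. h (path_prefix n \<rho>) \<partial>T) + \<epsilon> (Suc n)"
      by (rule integral_path_prefix_step[OF step \<epsilon>(1)])
    then show ?case using Suc by simp
  qed
  then have bound: "(\<integral>\<rho>. h (path_prefix n \<rho>) \<partial>T) \<le> h [Node \<phi> s] + \<delta>" for n
    using \<epsilon>(2)[of n] by (meson add_left_mono order_trans)
  have nn: "(\<integral>\<^sup>+\<rho>. ennreal (h (path_prefix n \<rho>)) \<partial>T) \<le> ennreal (h [Node \<phi> s] + \<delta>)" for n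
  proof -
    have "(\<integral>\<^sup>+\<rho>. ennreal (h (path_prefix n \<rho>)) \<partial>T) = ennreal (\<integral>\<rho>. h (path_prefix n \<rho>) \<partial>T)"
      using h path_prefix_paths
      by (intro nn_integral_eq_integral integral_path_prefix(1) AE_I2) (simp add: space_T)
    then show ?thesis using bound by (simp add: ennreal_leI)
  qed
  have "(\<integral>\<^sup>+\<rho>. ennreal (g \<rho>) \<partial>T) \<le> (\<integral>\<^sup>+\<rho>. liminf (\<lambda>n. ennreal (h (path_prefix n \<rho>))) \<partial>T)"
  proof (rule nn_integral_mono)
    fix \<rho> assume "\<rho> \<in> space T"
    then have "\<rho> \<in> plays" by (simp add: space_T)
    from ev[OF this] show "ennreal (g \<rho>) \<le> liminf (\<lambda>n. ennreal (h (path_prefix n \<rho>)))"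
      by (intro Liminf_bounded) (auto elim!: eventually_mono intro: ennreal_leI)
  qed
  also have "\<dots> \<le> liminf (\<lambda>n. \<integral>\<^sup>+\<rho>. ennreal (h (path_prefix n \<rho>)) \<partial>T)"
    by (rule nn_integral_liminf) measurable
  also have "\<dots> \<le> ennreal (h [Node \<phi> s] + \<delta>)"
    by (rule Liminf_le) (use nn in simp_all)
  finally have le: "(\<integral>\<^sup>+\<rho>. ennreal (g \<rho>) \<partial>T) \<le> ennreal (h [Node \<phi> s] + \<delta>)" .
  have "(\<integral>\<rho>. g \<rho> \<partial>T) = enn2real (\<integral>\<^sup>+\<rho>. ennreal (g \<rho>) \<partial>T)"
    using g by (intro integral_eq_nn_integral) (auto simp: space_T)
  also have "\<dots> \<le> h [Node \<phi> s] + \<delta>"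
    using le root \<delta> by (intro enn2real_leI) auto
  finally show ?thesis .
qed

end

section \<open>Fixed points of nonexpansive maps and the denotation\<close>

text \<open>The third clause is the 1-Lipschitz property for the supremum distance. It takes the
  place of order continuity: it is symmetric between least and greatest fixed points, is preserved
  by both, and lets limits of iterates pass through the map.\<close>

definition nonexpansive :: "(('s \<Rightarrow> real) \<Rightarrow> 's \<Rightarrow> real) \<Rightarrow> bool" where
  "nonexpansive F \<longleftrightarrow>
     (\<forall>x\<in>expectations. F x \<in> expectations) \<and>
     (\<forall>x\<in>expectations. \<forall>y\<in>expectations. x \<le> y \<longrightarrow> F x \<le> F y) \<and>
     (\<forall>x\<in>expectations. \<forall>y\<in>expectations. \<forall>d. (\<forall>s. \<bar>x s - y s\<bar> \<le> d) \<longrightarrow> (\<forall>s. \<bar>F x s - F y s\<bar> \<le> d))"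

lemma nonexpansiveD:
  assumes "nonexpansive F"
  shows "x \<in> expectations \<Longrightarrow> F x \<in> expectations"
    and "x \<in> expectations \<Longrightarrow> y \<in> expectations \<Longrightarrow> x \<le> y \<Longrightarrow> F x \<le> F y"
    and "x \<in> expectations \<Longrightarrow> y \<in> expectations \<Longrightarrow> (\<And>s. \<bar>x s - y s\<bar> \<le> d) \<Longrightarrow> \<bar>F x s - F y s\<bar> \<le> d"
  using assms unfolding nonexpansive_def by blast+

text \<open>The flag has two readings that go together: the least fixed point with its iteration
  from 0, and Max, whose approximated colours are those of \<open>Mu\<close>.\<close>

definition start :: "bool \<Rightarrow> 's \<Rightarrow> real" where
  "start b = (\<lambda>_. if b then 0 else 1)"

definition fixp :: "bool \<Rightarrow> (('s \<Rightarrow> real) \<Rightarrow> 's \<Rightarrow> real) \<Rightarrow> 's \<Rightarrow> real" where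
  "fixp b F = (if b then LEAST x. x \<in> expectations \<and> F x = x else GREATEST x. x \<in> expectations \<and> F x = x)"

lemma start_in_expectations: "start b \<in> expectations"
  by (simp add: start_def expectations_def)

lemma funpow_in_expectations:
  "nonexpansive F \<Longrightarrow> x \<in> expectations \<Longrightarrow> (F ^^ n) x \<in> expectations"
  by (induction n) (auto simp: nonexpansiveD(1))

text \<open>Iteration stops at omega: the iterates increase to a pointwise limit, which is uniform
  because there are finitely many states, and a 1-Lipschitz map preserves uniform limits.\<close>

lemma least_fixpoint_limit:
  fixes F :: "('s :: finite \<Rightarrow> real) \<Rightarrow> 's \<Rightarrow> real"
  assumes F: "nonexpansive F"
  obtains l where "l \<in> expectations" "F l = l" "\<And>y. y \<in> expectations \<Longrightarrow> F y = y \<Longrightarrow> l \<le> y"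
    "\<And>s. (\<lambda>n. (F ^^ n) (\<lambda>_. 0) s) \<longlonglongrightarrow> l s"
proof -
  let ?z = "\<lambda>_ :: 's. 0 :: real"
  have z: "?z \<in> expectations" by (simp add: expectations_def)
  note iter = funpow_in_expectations[OF F z]
  have step: "(F ^^ n) ?z \<le> (F ^^ Suc n) ?z" for n
  proof (induction n)
    case 0
    then show ?case using nonexpansiveD(1)[OF F z] by (simp add: expectations_def le_fun_def)
  next
    case (Suc n)
    show ?case using nonexpansiveD(2)[OF F iter[of n] iter[of "Suc n"] Suc] by simp
  qed
  have "\<exists>L. (\<lambda>n. (F ^^ n) ?z s) \<longlonglongrightarrow> L" for s
  proof -
    have "incseq (\<lambda>n. (F ^^ n) ?z s)" using step by (intro incseq_SucI) (simp add: le_fun_def)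
    moreover have "(F ^^ n) ?z s \<le> 1" for n using iter[of n] by (simp add: expectations_def)
    ultimately show ?thesis by (metis incseq_convergent)
  qed
  then obtain l where lim: "\<And>s. (\<lambda>n. (F ^^ n) ?z s) \<longlonglongrightarrow> l s" by metis
  have l: "l \<in> expectations"
    unfolding expectations_def
  proof safe
    fix s
    show "0 \<le> l s" using iter
      by (intro LIMSEQ_le_const[OF lim[of s]]) (auto simp: expectations_def)
    show "l s \<le> 1" using iter
      by (intro LIMSEQ_le_const2[OF lim[of s]]) (auto simp: expectations_def)
  qed
  have "F l s = l s" for s
  proof (rule LIMSEQ_unique)
    show "(\<lambda>n. (F ^^ Suc n) ?z s) \<longlonglongrightarrow> l s" by (rule LIMSEQ_Suc[OF lim])
    show "(\<lambda>n. (F ^^ Suc n) ?z s) \<longlonglongrightarrow> F l s"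
    proof (rule metric_LIMSEQ_I)
      fix r :: real assume r: "r > 0"
      \<comment> \<open>One index serves all of the finitely many states. The half leaves room for
        the strict inequality required of a limit.\<close>
      have "\<forall>\<^sub>F n in sequentially. \<forall>s\<in>UNIV. \<bar>(F ^^ n) ?z s - l s\<bar> < r / 2"
      proof (rule eventually_ball_finite)
        show "\<forall>s\<in>UNIV. \<forall>\<^sub>F n in sequentially. \<bar>(F ^^ n) ?z s - l s\<bar> < r / 2"
          using tendstoD[OF lim, of "r / 2"] r by (simp add: dist_real_def)
      qed simp
      then obtain N where N: "\<And>n s. n \<ge> N \<Longrightarrow> \<bar>(F ^^ n) ?z s - l s\<bar> \<le> r / 2"
        unfolding eventually_sequentially by (metis UNIV_I less_imp_le)
      have "dist ((F ^^ Suc n) ?z s) (F l s) < r" if "n \<ge> N" for n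
        using nonexpansiveD(3)[OF F iter[of n] l N[OF that], of s] r by (simp add: dist_real_def)
      then show "\<exists>N. \<forall>n\<ge>N. dist ((F ^^ Suc n) ?z s) (F l s) < r" by blast
    qed
  qed
  then have "F l = l" by auto
  moreover have "l \<le> y" if y: "y \<in> expectations" "F y = y" for y
  proof -
    have "(F ^^ n) ?z \<le> y" for n
    proof (induction n)
      case 0
      then show ?case using y by (simp add: expectations_def le_fun_def)
    next
      case (Suc n)
      show ?case using nonexpansiveD(2)[OF F iter[of n] y(1) Suc] y(2) by simp
    qed
    then show ?thesis unfolding le_fun_def by (metis LIMSEQ_le_const2[OF lim])
  qed
  ultimately show ?thesis using that l lim by blast
qed

text \<open>The greatest case is the least case conjugated by \<open>1 - x\<close>, which reverses
  the order, exchanges the starting points 0 and 1 and keeps distances.\<close>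

lemma fixp:
  fixes F :: "('s :: finite \<Rightarrow> real) \<Rightarrow> 's \<Rightarrow> real"
  assumes F: "nonexpansive F"
  shows fixp_in_expectations: "fixp b F \<in> expectations"
    and fixp_unfold: "F (fixp b F) = fixp b F"
    and fixp_limit: "(\<lambda>n. (F ^^ n) (start b) s) \<longlonglongrightarrow> fixp b F s"
proof -
  have "fixp b F \<in> expectations \<and> F (fixp b F) = fixp b F \<and>
    (\<forall>s. (\<lambda>n. (F ^^ n) (start b) s) \<longlonglongrightarrow> fixp b F s)"
  proof (cases b)
    case True
    obtain l where l: "l \<in> expectations" "F l = l" "\<And>y. y \<in> expectations \<Longrightarrow> F y = y \<Longrightarrow> l \<le> y"
        "\<And>s. (\<lambda>n. (F ^^ n) (\<lambda>_. 0) s) \<longlonglongrightarrow> l s"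
      using least_fixpoint_limit[OF F] by metis
    have "fixp b F = l" unfolding fixp_def using True l(1-3)
      by simp (intro Least_equality, auto)
    then show ?thesis using l True by (simp add: start_def)
  next
    case False
    define c :: "('s \<Rightarrow> real) \<Rightarrow> 's \<Rightarrow> real" where "c x = (\<lambda>s. 1 - x s)" for x
    have cc: "c (c x) = x" for x by (auto simp: c_def)
    have cE: "c x \<in> expectations \<longleftrightarrow> x \<in> expectations" for x by (auto simp: c_def expectations_def)
    have c_le: "c x \<le> c y \<longleftrightarrow> y \<le> x" for x y by (auto simp: c_def le_fun_def)
    have c_abs: "\<bar>c x s - c y s\<bar> = \<bar>x s - y s\<bar>" for x y s by (simp add: c_def)
    define G where "G x = c (F (c x))" for x
    have "nonexpansive G"
      unfolding nonexpansive_def G_def cE c_le c_abs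
      using nonexpansiveD[OF F] cE c_le c_abs by (metis (no_types, lifting))
    then obtain l where l: "l \<in> expectations" "G l = l" "\<And>y. y \<in> expectations \<Longrightarrow> G y = y \<Longrightarrow> l \<le> y"
        "\<And>s. (\<lambda>n. (G ^^ n) (\<lambda>_. 0) s) \<longlonglongrightarrow> l s"
      using least_fixpoint_limit by metis
    have Gn: "(G ^^ n) (\<lambda>_. 0) = c ((F ^^ n) (\<lambda>_. 1))" for n
      by (induction n) (auto simp: G_def cc, simp add: c_def)
    have fx: "F (c l) = c l" using l(2) by (metis G_def cc)
    have "fixp b F = c l"
    proof -
      have "y \<le> c l" if "y \<in> expectations" "F y = y" for y
        using l(3)[of "c y"] that by (metis G_def cc cE c_le)
      then show ?thesis
        unfolding fixp_def using False fx l(1) cE by simp (intro Greatest_equality, auto)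
    qed
    moreover have "(\<lambda>n. (F ^^ n) (\<lambda>_. 1) s) \<longlonglongrightarrow> c l s" for s
    proof -
      have "(\<lambda>n. 1 - (G ^^ n) (\<lambda>_. 0) s) \<longlonglongrightarrow> 1 - l s" by (intro tendsto_intros l(4))
      then show ?thesis by (simp add: Gn c_def)
    qed
    ultimately show ?thesis using fx l(1) cE False by (simp add: start_def)
  qed
  then show "fixp b F \<in> expectations" "F (fixp b F) = fixp b F"
    "(\<lambda>n. (F ^^ n) (start b) s) \<longlonglongrightarrow> fixp b F s" by auto
qed

text \<open>The bound is uniform over the states, so a budget can be fixed when a colour is created,
  before it is known in which states it will be visited.\<close>

lemma fixp_approx:
  fixes F :: "('s :: finite \<Rightarrow> real) \<Rightarrow> 's \<Rightarrow> real"
  assumes "nonexpansive F" "\<epsilon> > 0"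
  shows "\<exists>n. \<forall>s. \<bar>(F ^^ n) (start b) s - fixp b F s\<bar> \<le> \<epsilon>"
proof -
  have "\<forall>\<^sub>F n in sequentially. \<forall>s\<in>UNIV. \<bar>(F ^^ n) (start b) s - fixp b F s\<bar> < \<epsilon>"
  proof (rule eventually_ball_finite)
    show "\<forall>s\<in>UNIV. \<forall>\<^sub>F n in sequentially. \<bar>(F ^^ n) (start b) s - fixp b F s\<bar> < \<epsilon>"
      using tendstoD[OF fixp_limit[OF assms(1)] assms(2)] by (simp add: dist_real_def)
  qed simp
  then show ?thesis
    unfolding eventually_sequentially by (metis UNIV_I less_imp_le order_refl)
qed

section \<open>Environments, and the denotation as a nonexpansive function of them\<close>

definition name_vals :: "('v name \<Rightarrow> 's \<Rightarrow> real) set" where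
  "name_vals = {r. \<forall>x. r x \<in> expectations}"

lemma name_vals_upd: "r \<in> name_vals \<Longrightarrow> x \<in> expectations \<Longrightarrow> r(n := x) \<in> name_vals"
  by (simp add: name_vals_def)

lemma nonexpansive_fun_upd:
  fixes D :: "('v name \<Rightarrow> 's \<Rightarrow> real) \<Rightarrow> 's \<Rightarrow> real"
  assumes D: "\<And>r r'. r \<in> name_vals \<Longrightarrow> r' \<in> name_vals \<Longrightarrow>
      D r \<in> expectations \<and> (r \<le> r' \<longrightarrow> D r \<le> D r') \<and>
      (\<forall>d. (\<forall>x s. \<bar>r x s - r' x s\<bar> \<le> d) \<longrightarrow> (\<forall>s. \<bar>D r s - D r' s\<bar> \<le> d))"
    and "r \<in> name_vals"
  shows "nonexpansive (\<lambda>x. D (r(n := x)))"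
  unfolding nonexpansive_def
proof (intro conjI ballI allI impI)
  fix x :: "'s \<Rightarrow> real" assume x: "x \<in> expectations"
  then show "D (r(n := x)) \<in> expectations" using D assms(2) name_vals_upd by blast
  fix y :: "'s \<Rightarrow> real" assume y: "y \<in> expectations"
  have xy: "r(n := x) \<in> name_vals" "r(n := y) \<in> name_vals"
    using x y assms(2) name_vals_upd by blast+
  show "D (r(n := x)) \<le> D (r(n := y))" if "x \<le> y"
    using D[OF xy] that by (auto simp: le_fun_def)
  fix d s assume d: "\<forall>s. \<bar>x s - y s\<bar> \<le> d"
  then have "0 \<le> d" by (meson abs_ge_zero order_trans)
  then show "\<bar>D (r(n := x)) s - D (r(n := y)) s\<bar> \<le> d"
    using D[OF xy] d by auto
qed

text \<open>Iterates started at the same constant stay ordered, or within distance \<open>d\<close>,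
  by induction on their number, and both relations survive pointwise limits.\<close>

lemma fixp_nonexpansive:
  fixes D :: "('v name \<Rightarrow> 's :: finite \<Rightarrow> real) \<Rightarrow> 's \<Rightarrow> real"
  assumes D: "\<And>r r'. r \<in> name_vals \<Longrightarrow> r' \<in> name_vals \<Longrightarrow>
      D r \<in> expectations \<and> (r \<le> r' \<longrightarrow> D r \<le> D r') \<and>
      (\<forall>d. (\<forall>x s. \<bar>r x s - r' x s\<bar> \<le> d) \<longrightarrow> (\<forall>s. \<bar>D r s - D r' s\<bar> \<le> d))"
    and r: "r \<in> name_vals" "r' \<in> name_vals"
  shows "fixp b (\<lambda>x. D (r(n := x))) \<in> expectations \<and>
     (r \<le> r' \<longrightarrow> fixp b (\<lambda>x. D (r(n := x))) \<le> fixp b (\<lambda>x. D (r'(n := x)))) \<and>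
     (\<forall>d. (\<forall>x s. \<bar>r x s - r' x s\<bar> \<le> d) \<longrightarrow>
       (\<forall>s. \<bar>fixp b (\<lambda>x. D (r(n := x))) s - fixp b (\<lambda>x. D (r'(n := x))) s\<bar> \<le> d))"
proof -
  have ne: "nonexpansive (\<lambda>x. D (r(n := x)))" if "r \<in> name_vals" for r
    using D that by (rule nonexpansive_fun_upd)
  let ?F = "\<lambda>x. D (r(n := x))" and ?F' = "\<lambda>x. D (r'(n := x))"
  note it = funpow_in_expectations[OF ne[OF r(1)] start_in_expectations]
  note it' = funpow_in_expectations[OF ne[OF r(2)] start_in_expectations]
  have mono: "D (r(n := x)) \<le> D (r'(n := y))"
    if "r \<le> r'" "x \<in> expectations" "y \<in> expectations" "x \<le> y" for x y
  proof -
    have "r(n := x) \<le> r'(n := y)" using that by (simp add: le_fun_def)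
    then show ?thesis using D[OF name_vals_upd name_vals_upd, OF r(1) that(2) r(2) that(3)] by blast
  qed
  have dist: "\<bar>D (r(n := x)) s - D (r'(n := y)) s\<bar> \<le> d"
    if "\<forall>x s. \<bar>r x s - r' x s\<bar> \<le> d" "x \<in> expectations" "y \<in> expectations" "\<forall>s. \<bar>x s - y s\<bar> \<le> d" for x y d s
  proof -
    have "\<forall>m s. \<bar>(r(n := x)) m s - (r'(n := y)) m s\<bar> \<le> d" using that by simp
    then show ?thesis using D[OF name_vals_upd name_vals_upd, OF r(1) that(2) r(2) that(3)] by blast
  qed
  have "fixp b ?F s \<le> fixp b ?F' s" if "r \<le> r'" for s
  proof -
    have "(?F ^^ k) (start b) \<le> (?F' ^^ k) (start b)" for k
    proof (induction k)
      case (Suc k)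
      show ?case unfolding funpow.simps o_apply by (rule mono[OF that it it' Suc])
    qed simp
    then show ?thesis
      by (intro LIMSEQ_le[OF fixp_limit[OF ne[OF r(1)]] fixp_limit[OF ne[OF r(2)]]])
        (auto simp: le_fun_def)
  qed
  moreover have "\<bar>fixp b ?F s - fixp b ?F' s\<bar> \<le> d"
    if d: "\<forall>x s. \<bar>r x s - r' x s\<bar> \<le> d" for d s
  proof -
    have d0: "0 \<le> d" using d by (meson abs_ge_zero order_trans)
    have "\<forall>s. \<bar>(?F ^^ k) (start b) s - (?F' ^^ k) (start b) s\<bar> \<le> d" for k
    proof (induction k)
      case (Suc k)
      show ?case unfolding funpow.simps o_apply using dist[OF d it it' Suc] by blast
    qed (simp add: d0)
    moreover have "(\<lambda>k. \<bar>(?F ^^ k) (start b) s - (?F' ^^ k) (start b) s\<bar>)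
        \<longlonglongrightarrow> \<bar>fixp b ?F s - fixp b ?F' s\<bar>"
      by (intro tendsto_intros fixp_limit ne r)
    ultimately show ?thesis by (intro LIMSEQ_le_const2) auto
  qed
  ultimately show ?thesis using fixp_in_expectations[OF ne[OF r(1)]] by (simp add: le_fun_def)
qed

locale valued =
  fixes V :: "('v, 'a, 'k, 'g, 's :: finite) valuation"
  assumes valuation: "is_valuation V"
begin

text \<open>Along a play only the values of names change, so they are split off as an argument;
  colours and bound variables are then handled alike.\<close>

definition den :: "('v, 'a, 'k, 'g) form \<Rightarrow> ('v name \<Rightarrow> 's \<Rightarrow> real) \<Rightarrow> 's \<Rightarrow> real" where
  "den \<phi> r = denote \<phi> (V\<lparr>vname := r\<rparr>)"

lemma den_simps [simp]:
  "den (Name x) r = r x"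
  "den (Const A) r = vconst V A"
  "den (Trans k \<phi>) r = (\<lambda>s. spmf (vtrans V k s) Payoff +
     (\<Sum>s'\<in>UNIV. spmf (vtrans V k s) (State s') * den \<phi> r s'))"
  "den (Meet \<phi> \<psi>) r = (\<lambda>s. min (den \<phi> r s) (den \<psi> r s))"
  "den (Join \<phi> \<psi>) r = (\<lambda>s. max (den \<phi> r s) (den \<psi> r s))"
  "den (Cond \<phi> G \<psi>) r = (\<lambda>s. if vpred V G s then den \<phi> r s else den \<psi> r s)"
  "den (Mu X \<phi>) r = fixp True (\<lambda>x. den \<phi> (r(Plain X := x)))"
  "den (Nu X \<phi>) r = fixp False (\<lambda>x. den \<phi> (r(Plain X := x)))"
  by (simp_all add: den_def upd_def fixp_def cong: if_cong)

lemma den_cong: "(\<And>x. x \<in> free_names \<phi> \<Longrightarrow> r x = r' x) \<Longrightarrow> den \<phi> r = den \<phi> r'"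
proof (induction \<phi> arbitrary: r r')
  case (Trans k \<phi>)
  have "den \<phi> r = den \<phi> r'" using Trans.prems by (intro Trans.IH) auto
  then show ?case by simp
next
  case (Meet \<phi> \<psi>)
  have "den \<phi> r = den \<phi> r'" "den \<psi> r = den \<psi> r'"
    using Meet.prems by (intro Meet.IH; auto)+
  then show ?case by simp
next
  case (Join \<phi> \<psi>)
  have "den \<phi> r = den \<phi> r'" "den \<psi> r = den \<psi> r'"
    using Join.prems by (intro Join.IH; auto)+
  then show ?case by simp
next
  case (Cond \<phi> G \<psi>)
  have "den \<phi> r = den \<phi> r'" "den \<psi> r = den \<psi> r'"
    using Cond.prems by (intro Cond.IH; auto)+
  then show ?case by (simp cong: if_cong)
next
  case (Mu X \<phi>)
  have "den \<phi> (r(Plain X := x)) = den \<phi> (r'(Plain X := x))" for x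
    using Mu.prems by (intro Mu.IH) auto
  then show ?case by simp
next
  case (Nu X \<phi>)
  have "den \<phi> (r(Plain X := x)) = den \<phi> (r'(Plain X := x))" for x
    using Nu.prems by (intro Nu.IH) auto
  then show ?case by simp
qed simp_all

text \<open>No binder binds a colour, so the updates made under inner binders leave
  \<open>r (Colour X i)\<close> as it is.\<close>

lemma den_subst_colour: "den (subst_colour X i \<phi>) r = den \<phi> (r(Plain X := r (Colour X i)))"
proof (induction \<phi> arbitrary: r)
  case (Mu Y \<phi>)
  have "(r(Plain Y := x))(Plain X := (r(Plain Y := x)) (Colour X i)) =
      (r(Plain X := r (Colour X i)))(Plain Y := x)" if "Y \<noteq> X" for x
    using that by (auto simp: fun_eq_iff)
  then show ?case
    by (cases "Y = X") (simp_all add: Mu.IH del: fun_upd_apply)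
next
  case (Nu Y \<phi>)
  have "(r(Plain Y := x))(Plain X := (r(Plain Y := x)) (Colour X i)) =
      (r(Plain X := r (Colour X i)))(Plain Y := x)" if "Y \<noteq> X" for x
    using that by (auto simp: fun_eq_iff)
  then show ?case
    by (cases "Y = X") (simp_all add: Nu.IH del: fun_upd_apply)
qed (auto cong: if_cong)

lemma sum_outcome_spmf: "spmf p Payoff + (\<Sum>s'\<in>UNIV. spmf p (State s')) \<le> 1"
  for p :: "'s outcome spmf"
proof -
  let ?A = "insert (Some Payoff) (range (\<lambda>s'. Some (State s' :: 's outcome)))"
  have "sum (pmf p) ?A \<le> 1"
    using measure_pmf.prob_le_1[of p ?A] by (subst (asm) measure_measure_pmf_finite) auto
  moreover have "sum (pmf p) ?A = pmf p (Some Payoff) + sum (pmf p) (range (\<lambda>s'. Some (State s')))"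
    by (rule sum.insert) auto
  moreover have "sum (pmf p) (range (\<lambda>s'. Some (State s'))) = (\<Sum>s'\<in>UNIV. spmf p (State s'))"
    by (subst sum.reindex) (auto simp: inj_on_def)
  ultimately show ?thesis by simp
qed

text \<open>Minimum and maximum are 1-Lipschitz, a transition averages with total weight at most 1,
  and fixed points are covered by \<open>fixp_nonexpansive\<close>.\<close>

lemma den_nonexpansive:
  assumes "r \<in> name_vals" "r' \<in> name_vals"
  shows den_in_expectations: "den \<phi> r \<in> expectations"
    and "r \<le> r' \<Longrightarrow> den \<phi> r \<le> den \<phi> r'"
    and "(\<And>x s. \<bar>r x s - r' x s\<bar> \<le> d) \<Longrightarrow> \<bar>den \<phi> r s - den \<phi> r' s\<bar> \<le> d"
proof -
  have "den \<phi> r \<in> expectations \<and> (r \<le> r' \<longrightarrow> den \<phi> r \<le> den \<phi> r') \<and>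
     (\<forall>d. (\<forall>x s. \<bar>r x s - r' x s\<bar> \<le> d) \<longrightarrow> (\<forall>s. \<bar>den \<phi> r s - den \<phi> r' s\<bar> \<le> d))"
    using assms
  proof (induction \<phi> arbitrary: r r')
    case (Name x)
    then show ?case by (auto simp: name_vals_def le_fun_def)
  next
    case (Const A)
    have "0 \<le> d" if "\<forall>x s. \<bar>r x s - r' x s\<bar> \<le> d" for d
      using that by (meson abs_ge_zero order_trans)
    then show ?case using valuation by (auto simp: is_valuation_def)
  next
    case (Trans k \<phi>)
    let ?p = "\<lambda>s s'. spmf (vtrans V k s) (State s')"
    have IH: "den \<phi> r \<in> expectations" "r \<le> r' \<longrightarrow> den \<phi> r \<le> den \<phi> r'"
        "\<And>d. (\<forall>x s. \<bar>r x s - r' x s\<bar> \<le> d) \<Longrightarrow> (\<forall>s. \<bar>den \<phi> r s - den \<phi> r' s\<bar> \<le> d)"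
      using Trans by blast+
    have le1: "(\<Sum>s'\<in>UNIV. ?p s s') \<le> 1" for s
      using sum_outcome_spmf[of "vtrans V k s"] pmf_nonneg[of "vtrans V k s" "Some Payoff"] by linarith
    have "den (Trans k \<phi>) r \<in> expectations"
    proof -
      have "(\<Sum>s'\<in>UNIV. ?p s s' * den \<phi> r s') \<le> (\<Sum>s'\<in>UNIV. ?p s s')" for s
        using IH(1) by (intro sum_mono mult_left_le) (auto simp: expectations_def)
      then have "spmf (vtrans V k s) Payoff + (\<Sum>s'\<in>UNIV. ?p s s' * den \<phi> r s') \<le> 1" for s
        using sum_outcome_spmf[of "vtrans V k s"] by (meson add_left_mono order_trans)
      moreover have "0 \<le> spmf (vtrans V k s) Payoff + (\<Sum>s'\<in>UNIV. ?p s s' * den \<phi> r s')" for s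
        using IH(1) by (intro add_nonneg_nonneg sum_nonneg mult_nonneg_nonneg) (auto simp: expectations_def)
      ultimately show ?thesis by (simp add: expectations_def)
    qed
    moreover have "den (Trans k \<phi>) r \<le> den (Trans k \<phi>) r'" if "r \<le> r'"
      using IH(2) that by (auto simp: le_fun_def intro!: sum_mono mult_left_mono)
    moreover have "\<bar>den (Trans k \<phi>) r s - den (Trans k \<phi>) r' s\<bar> \<le> d"
      if d: "\<forall>x s. \<bar>r x s - r' x s\<bar> \<le> d" for d s
    proof -
      have d0: "0 \<le> d" using d by (meson abs_ge_zero order_trans)
      have "\<bar>den (Trans k \<phi>) r s - den (Trans k \<phi>) r' s\<bar> =
          \<bar>\<Sum>s'\<in>UNIV. ?p s s' * (den \<phi> r s' - den \<phi> r' s')\<bar>"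
        by (simp add: right_diff_distrib sum_subtractf)
      also have "\<dots> \<le> (\<Sum>s'\<in>UNIV. \<bar>?p s s' * (den \<phi> r s' - den \<phi> r' s')\<bar>)" by (rule sum_abs)
      also have "\<dots> \<le> (\<Sum>s'\<in>UNIV. ?p s s' * d)"
        using IH(3)[OF d] by (intro sum_mono) (simp add: abs_mult mult_left_mono)
      also have "\<dots> \<le> d"
        using le1[of s] d0 by (simp add: mult_left_le_one_le sum_nonneg flip: sum_distrib_right)
      finally show ?thesis .
    qed
    ultimately show ?case by blast
  next
    case (Meet \<phi> \<psi>)
    have "den \<phi> r \<in> expectations" "r \<le> r' \<longrightarrow> den \<phi> r \<le> den \<phi> r'"
        "\<forall>d. (\<forall>x s. \<bar>r x s - r' x s\<bar> \<le> d) \<longrightarrow> (\<forall>s. \<bar>den \<phi> r s - den \<phi> r' s\<bar> \<le> d)"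
        "den \<psi> r \<in> expectations" "r \<le> r' \<longrightarrow> den \<psi> r \<le> den \<psi> r'"
        "\<forall>d. (\<forall>x s. \<bar>r x s - r' x s\<bar> \<le> d) \<longrightarrow> (\<forall>s. \<bar>den \<psi> r s - den \<psi> r' s\<bar> \<le> d)"
      using Meet by blast+
    moreover have "\<bar>min a b - min a' b'\<bar> \<le> d" if "\<bar>a - a'\<bar> \<le> d" "\<bar>b - b'\<bar> \<le> d" for a b a' b' d :: real
      using that by (auto simp: min_def abs_le_iff)
    ultimately show ?case by (auto simp: expectations_def le_fun_def min.coboundedI1 min.coboundedI2 intro: min.mono)
  next
    case (Join \<phi> \<psi>)
    have "den \<phi> r \<in> expectations" "r \<le> r' \<longrightarrow> den \<phi> r \<le> den \<phi> r'"
        "\<forall>d. (\<forall>x s. \<bar>r x s - r' x s\<bar> \<le> d) \<longrightarrow> (\<forall>s. \<bar>den \<phi> r s - den \<phi> r' s\<bar> \<le> d)"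
        "den \<psi> r \<in> expectations" "r \<le> r' \<longrightarrow> den \<psi> r \<le> den \<psi> r'"
        "\<forall>d. (\<forall>x s. \<bar>r x s - r' x s\<bar> \<le> d) \<longrightarrow> (\<forall>s. \<bar>den \<psi> r s - den \<psi> r' s\<bar> \<le> d)"
      using Join by blast+
    moreover have "\<bar>max a b - max a' b'\<bar> \<le> d" if "\<bar>a - a'\<bar> \<le> d" "\<bar>b - b'\<bar> \<le> d" for a b a' b' d :: real
      using that by (auto simp: max_def abs_le_iff)
    ultimately show ?case by (auto simp: expectations_def le_fun_def max.coboundedI1 max.coboundedI2)
  next
    case (Cond \<phi> G \<psi>)
    have "den \<phi> r \<in> expectations" "r \<le> r' \<longrightarrow> den \<phi> r \<le> den \<phi> r'"
        "\<forall>d. (\<forall>x s. \<bar>r x s - r' x s\<bar> \<le> d) \<longrightarrow> (\<forall>s. \<bar>den \<phi> r s - den \<phi> r' s\<bar> \<le> d)"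
        "den \<psi> r \<in> expectations" "r \<le> r' \<longrightarrow> den \<psi> r \<le> den \<psi> r'"
        "\<forall>d. (\<forall>x s. \<bar>r x s - r' x s\<bar> \<le> d) \<longrightarrow> (\<forall>s. \<bar>den \<psi> r s - den \<psi> r' s\<bar> \<le> d)"
      using Cond by blast+
    then show ?case by (auto simp: expectations_def le_fun_def)
  next
    case (Mu X \<phi>)
    show ?case unfolding den_simps
      by (rule fixp_nonexpansive[OF Mu.IH Mu.prems])
  next
    case (Nu X \<phi>)
    show ?case unfolding den_simps
      by (rule fixp_nonexpansive[OF Nu.IH Nu.prems])
  qed
  then show "den \<phi> r \<in> expectations" "r \<le> r' \<Longrightarrow> den \<phi> r \<le> den \<phi> r'"
    "(\<And>x s. \<bar>r x s - r' x s\<bar> \<le> d) \<Longrightarrow> \<bar>den \<phi> r s - den \<phi> r' s\<bar> \<le> d" by blast+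
qed

lemma body_nonexpansive:
  assumes "r \<in> name_vals"
  shows "nonexpansive (\<lambda>x. den \<phi> (r(n := x)))"
  using den_nonexpansive assms by (intro nonexpansive_fun_upd) blast+

end

section \<open>Colours along a play\<close>

text \<open>Colours all free variables at once, unlike \<open>subst_colour\<close>; a binder clears
  the entry of its variable, so bound occurrences stay plain.\<close>

primrec paint :: "('v \<Rightarrow> nat option) \<Rightarrow> ('v, 'a, 'k, 'g) form \<Rightarrow> ('v, 'a, 'k, 'g) form" where
  "paint \<rho> (Name x) = Name (case x of Plain X \<Rightarrow> (case \<rho> X of None \<Rightarrow> x | Some i \<Rightarrow> Colour X i) | Colour X i \<Rightarrow> x)"
| "paint \<rho> (Const A) = Const A"
| "paint \<rho> (Trans k \<phi>) = Trans k (paint \<rho> \<phi>)"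
| "paint \<rho> (Meet \<phi> \<psi>) = Meet (paint \<rho> \<phi>) (paint \<rho> \<psi>)"
| "paint \<rho> (Join \<phi> \<psi>) = Join (paint \<rho> \<phi>) (paint \<rho> \<psi>)"
| "paint \<rho> (Cond \<phi> G \<psi>) = Cond (paint \<rho> \<phi>) G (paint \<rho> \<psi>)"
| "paint \<rho> (Mu X \<phi>) = Mu X (paint (\<rho>(X := None)) \<phi>)"
| "paint \<rho> (Nu X \<phi>) = Nu X (paint (\<rho>(X := None)) \<phi>)"

text \<open>The free occurrences of a variable all carry one colour or are all plain, and no colour
  of \<open>X\<close> lies below a binder of \<open>X\<close>. Without this, erasing colours could
  identify two different branches of one choice.\<close>

definition coherent :: "('v, 'a, 'k, 'g) form \<Rightarrow> bool" where
  "coherent \<psi> \<longleftrightarrow> (\<exists>\<rho>. paint \<rho> (uncolour_form \<psi>) = \<psi>)"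

lemma plain_name_idem: "plain_name (plain_name x) = plain_name x"
  by (cases x) auto

lemma uncolour_form_idem: "uncolour_form (uncolour_form \<psi>) = uncolour_form \<psi>"
  by (induction \<psi>) (auto simp: plain_name_idem)

lemma uncolour_idem: "uncolour (uncolour p) = uncolour p"
  by (cases p) (auto simp: uncolour_form_idem)

lemma uncolour_form_subst_colour: "uncolour_form (subst_colour X i \<psi>) = uncolour_form \<psi>"
  by (induction \<psi>) auto

lemma coherent_colourless:
  "(\<And>X i. Colour X i \<notin> free_names \<psi>) \<Longrightarrow> coherent \<psi>"
proof -
  have "uncolour_form \<psi> = \<psi> \<and> (\<forall>\<rho>. (\<forall>X. \<rho> X = None) \<longrightarrow> paint \<rho> \<psi> = \<psi>)"
    if "\<And>X i. Colour X i \<notin> free_names \<psi>"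
    using that
  proof (induction \<psi>)
    case (Name x)
    then show ?case by (cases x) auto
  qed auto
  moreover assume "\<And>X i. Colour X i \<notin> free_names \<psi>"
  ultimately have "uncolour_form \<psi> = \<psi>" "paint (\<lambda>_. None) \<psi> = \<psi>" by auto
  then show ?thesis unfolding coherent_def by metis
qed

lemma subst_colour_paint:
  "uncolour_form u = u \<Longrightarrow> subst_colour X i (paint (\<rho>(X := None)) u) = paint (\<rho>(X := Some i)) u"
proof (induction u arbitrary: \<rho>)
  case (Name x)
  then show ?case by (cases x) (auto split: option.splits)
next
  case (Mu Y u)
  show ?case
  proof (cases "Y = X")
    case False
    then have "paint (\<rho>(X := None, Y := None)) u = paint ((\<rho>(Y := None))(X := None)) u"
      "paint (\<rho>(X := Some i, Y := None)) u = paint ((\<rho>(Y := None))(X := Some i)) u"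
      by (simp_all add: fun_upd_twist)
    then show ?thesis using False Mu by (simp del: fun_upd_apply)
  qed (simp del: fun_upd_apply)
next
  case (Nu Y u)
  show ?case
  proof (cases "Y = X")
    case False
    then have "paint (\<rho>(X := None, Y := None)) u = paint ((\<rho>(Y := None))(X := None)) u"
      "paint (\<rho>(X := Some i, Y := None)) u = paint ((\<rho>(Y := None))(X := Some i)) u"
      by (simp_all add: fun_upd_twist)
    then show ?thesis using False Nu by (simp del: fun_upd_apply)
  qed (simp del: fun_upd_apply)
qed auto

text \<open>The colouring that witnesses coherence of the fixed point formula is extended at
  \<open>X\<close>, where the binder has cleared it.\<close>

lemma coherent_subst_colour:
  assumes "coherent (Mu X \<Phi>) \<or> coherent (Nu X \<Phi>)"
  shows "coherent (subst_colour X i \<Phi>)"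
proof -
  obtain \<rho> where \<rho>: "paint (\<rho>(X := None)) (uncolour_form \<Phi>) = \<Phi>"
    using assms by (auto simp: coherent_def simp del: fun_upd_apply)
  have "subst_colour X i \<Phi> = paint (\<rho>(X := Some i)) (uncolour_form \<Phi>)"
    using subst_colour_paint[of "uncolour_form \<Phi>" X i \<rho>] \<rho> uncolour_form_idem by metis
  then show ?thesis unfolding coherent_def uncolour_form_subst_colour by metis
qed

lemma coherent_child:
  "coherent (Trans k \<Phi>) \<Longrightarrow> coherent \<Phi>"
  "coherent (Meet \<Phi> \<Psi>) \<Longrightarrow> coherent \<Phi>" "coherent (Meet \<Phi> \<Psi>) \<Longrightarrow> coherent \<Psi>"
  "coherent (Join \<Phi> \<Psi>) \<Longrightarrow> coherent \<Phi>" "coherent (Join \<Phi> \<Psi>) \<Longrightarrow> coherent \<Psi>"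
  "coherent (Cond \<Phi> G \<Psi>) \<Longrightarrow> coherent \<Phi>" "coherent (Cond \<Phi> G \<Psi>) \<Longrightarrow> coherent \<Psi>"
  by (auto simp: coherent_def)

text \<open>One and the same colouring paints both branches.\<close>

lemma coherent_branches_eq:
  assumes "coherent (Meet \<Phi> \<Psi>) \<or> coherent (Join \<Phi> \<Psi>)" "uncolour_form \<Phi> = uncolour_form \<Psi>"
  shows "\<Phi> = \<Psi>"
  using assms by (auto simp: coherent_def)

lemma coherent_Name_Colour: "coherent (Name (Colour X i))"
  unfolding coherent_def by (rule exI[of _ "\<lambda>_. Some i"]) simp

text \<open>Names have size 0, so replacing a variable by a colour preserves sizes. They decrease on
  every stretch of a play without binders and colours.\<close>

primrec fsize :: "('v, 'a, 'k, 'g) form \<Rightarrow> nat" where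
  "fsize (Name x) = 0"
| "fsize (Const A) = 0"
| "fsize (Trans k \<phi>) = Suc (fsize \<phi>)"
| "fsize (Meet \<phi> \<psi>) = Suc (fsize \<phi> + fsize \<psi>)"
| "fsize (Join \<phi> \<psi>) = Suc (fsize \<phi> + fsize \<psi>)"
| "fsize (Cond \<phi> G \<psi>) = Suc (fsize \<phi> + fsize \<psi>)"
| "fsize (Mu X \<phi>) = Suc (fsize \<phi>)"
| "fsize (Nu X \<phi>) = Suc (fsize \<phi>)"

lemma fsize_subst_colour: "fsize (subst_colour X i \<psi>) = fsize \<psi>"
  by (induction \<psi>) auto

lemma free_names_subst_colour:
  "free_names (subst_colour X i \<psi>) \<subseteq> (free_names \<psi> - {Plain X}) \<union> {Colour X i}"
  by (induction \<psi>) auto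

text \<open>The flag is \<open>True\<close> for \<open>\<mu>\<close> and \<open>False\<close> for \<open>\<nu>\<close>.\<close>

fun binding :: "('v, 'a, 'k, 'g, 's) pos \<Rightarrow> (bool \<times> 'v \<times> ('v, 'a, 'k, 'g) form) option" where
  "binding (Node (Mu X \<Phi>) t) = Some (True, X, \<Phi>)"
| "binding (Node (Nu X \<Phi>) t) = Some (False, X, \<Phi>)"
| "binding _ = None"

fun colour_of :: "('v, 'a, 'k, 'g, 's) pos \<Rightarrow> nat option" where
  "colour_of (Node (Name (Colour X i)) t) = Some i"
| "colour_of _ = None"

primrec pos_names :: "('v, 'a, 'k, 'g, 's) pos \<Rightarrow> 'v name set" where
  "pos_names (Node \<psi> t) = free_names \<psi>"
| "pos_names (Tip y) = {}"

primrec pos_size :: "('v, 'a, 'k, 'g, 's) pos \<Rightarrow> nat" where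
  "pos_size (Node \<psi> t) = fsize \<psi>"
| "pos_size (Tip y) = 0"

lemma binding_SomeE:
  assumes "binding p = Some (c, X, \<Phi>)"
  obtains t where "p = Node (if c then Mu X \<Phi> else Nu X \<Phi>) t"
  using assms by (cases p rule: binding.cases) auto

lemma binding_props:
  assumes "binding p = Some (c, X, \<Phi>)"
  shows "free_names \<Phi> - {Plain X} = pos_names p" "fsize \<Phi> < pos_size p" "colour_of p = None"
  using assms by (cases p rule: binding.cases; auto)+

lemma colour_of_SomeE:
  assumes "colour_of p = Some i"
  obtains X t where "p = Node (Name (Colour X i)) t"
  using assms by (cases p rule: colour_of.cases) auto

section \<open>Moves possible under some pair of strategies, and invariants of the resulting
  paths\<close>

context valued
begin

text \<open>Quantifying the strategies away gives invariants that are available before any strategy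
  is constructed; the approximately optimal strategy is itself defined through the paths of all
  strategy pairs.\<close>

definition moves :: "('v, 'a, 'k, 'g, 's) pos list \<Rightarrow> ('v, 'a, 'k, 'g, 's) pos \<Rightarrow>
    ('v, 'a, 'k, 'g, 's) pos \<Rightarrow> bool" where
  "moves \<pi> p q \<longleftrightarrow> (\<exists>\<sigma> \<tau>. edge_prob V \<sigma> \<tau> \<pi> p q > 0)"

lemma moves_Node: "moves \<pi> p q \<Longrightarrow> \<exists>\<psi> t. p = Node \<psi> t"
  by (cases p) (auto simp: moves_def)

lemma payoff_tip_bounds:
  fixes p :: "'s outcome spmf"
  defines "m \<equiv> (\<Sum>s'\<in>UNIV. spmf p (State s'))"
  assumes "m < 1"
  shows "0 \<le> spmf p Payoff / (1 - m)" "spmf p Payoff / (1 - m) \<le> 1"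
  using assms(2) sum_outcome_spmf[of p] unfolding m_def by (auto simp: divide_le_eq)

text \<open>In the case \<open>colour\<close> nothing yet ties \<open>Y\<close> to \<open>X\<close>
  or keeps \<open>i\<close> inside \<open>\<pi>\<close>; both are supplied later by
  \<open>game_paths_names\<close>.\<close>

lemma moves_cases [consumes 1, case_names tip sub binding colour]:
  assumes "moves \<pi> p q"
  obtains
    (tip) y where "q = Tip y" "0 \<le> y" "y \<le> 1" "colour_of p = None" "binding p = None"
  | (sub) \<psi> t \<psi>' t' where "p = Node \<psi> t" "q = Node \<psi>' t'" "free_names \<psi>' \<subseteq> free_names \<psi>"
      "fsize \<psi>' < fsize \<psi>" "coherent \<psi> \<Longrightarrow> coherent \<psi>'" "colour_of p = None" "binding p = None"
  | (binding) c X \<Phi> t where "p = Node (if c then Mu X \<Phi> else Nu X \<Phi>) t" "binding p = Some (c, X, \<Phi>)"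
      "colour_of p = None" "q = Node (Name (Colour X (length \<pi>))) t"
  | (colour) X i c Y \<Phi> t where "p = Node (Name (Colour X i)) t" "colour_of p = Some i"
      "binding (\<pi> ! i) = Some (c, Y, \<Phi>)" "q = Node (subst_colour X i \<Phi>) t" "binding p = None"
proof -
  obtain \<sigma> \<tau> where e: "edge_prob V \<sigma> \<tau> \<pi> p q > 0" using assms by (auto simp: moves_def)
  obtain \<psi> t where p: "p = Node \<psi> t" using moves_Node[OF assms] by blast
  show thesis
  proof (cases \<psi>)
    case (Name x)
    show ?thesis
    proof (cases x)
      case (Colour X i)
      show ?thesis
      proof (cases "binding (\<pi> ! i)")
        case None
        then show ?thesis using e Name Colour p by (cases "\<pi> ! i" rule: binding.cases) auto
      next
        case (Some a)
        then obtain c Y \<Phi> where b: "binding (\<pi> ! i) = Some (c, Y, \<Phi>)" by (cases a) auto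
        then have "q = Node (subst_colour X i \<Phi>) t"
          using e Name Colour p by (elim binding_SomeE) (auto split: if_splits)
        then show ?thesis using b Name Colour p by (intro colour[of X i t]) auto
      qed
    qed (use e Name p in auto)
  next
    case (Const A)
    then have "q = Tip (vconst V A t)" using e p by auto
    then show ?thesis using valuation Const p
      by (intro tip[of "vconst V A t"]) (auto simp: is_valuation_def expectations_def)
  next
    case (Trans k \<Phi>)
    show ?thesis
    proof (cases q)
      case (Node \<Phi>' t')
      then have "\<Phi>' = \<Phi>" using e Trans p by (auto simp: Let_def split: if_splits)
      then show ?thesis using Node Trans p by (intro sub[of \<psi> t \<Phi> t']) (auto dest: coherent_child)
    next
      case (Tip y)
      then show ?thesis using e Trans p payoff_tip_bounds[of "vtrans V k t"]
        by (intro tip[of y]) (auto simp: Let_def split: if_splits)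
    qed
  next
    case (Meet \<Phi> \<Psi>)
    then obtain \<Xi> where "q = Node \<Xi> t" "\<Xi> = \<Phi> \<or> \<Xi> = \<Psi>" using e p by auto
    then show ?thesis using Meet p by (intro sub[of \<psi> t \<Xi> t]) (auto dest: coherent_child)
  next
    case (Join \<Phi> \<Psi>)
    then obtain \<Xi> where "q = Node \<Xi> t" "\<Xi> = \<Phi> \<or> \<Xi> = \<Psi>" using e p by auto
    then show ?thesis using Join p by (intro sub[of \<psi> t \<Xi> t]) (auto dest: coherent_child)
  next
    case (Cond \<Phi> G \<Psi>)
    then obtain \<Xi> where "q = Node \<Xi> t" "\<Xi> = \<Phi> \<or> \<Xi> = \<Psi>" using e p by (auto split: if_splits)
    then show ?thesis using Cond p by (intro sub[of \<psi> t \<Xi> t]) (auto dest: coherent_child)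
  next
    case (Mu X \<Phi>)
    then show ?thesis using e p by (intro binding[of True X \<Phi> t]) auto
  next
    case (Nu X \<Phi>)
    then show ?thesis using e p by (intro binding[of False X \<Phi> t]) auto
  qed
qed

text \<open>Only at \<open>Meet\<close> and \<open>Join\<close> do the strategies matter, and there
  coherence separates the two branches unless they coincide. The successors of a
  \<open>Trans\<close> position differ in what uncolouring keeps: the state, or being a tip.\<close>

lemma moves_uncolour_inj:
  assumes "moves \<pi> p q" "moves \<pi> p q'" "uncolour q = uncolour q'"
    and co: "\<And>\<psi> t. p = Node \<psi> t \<Longrightarrow> coherent \<psi>"
  shows "q = q'"
proof -
  obtain \<sigma> \<tau> where e: "edge_prob V \<sigma> \<tau> \<pi> p q > 0" using assms by (auto simp: moves_def)
  obtain \<sigma>' \<tau>' where e': "edge_prob V \<sigma>' \<tau>' \<pi> p q' > 0" using assms by (auto simp: moves_def)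
  obtain \<psi> t where p: "p = Node \<psi> t" using moves_Node[OF assms(1)] by blast
  show ?thesis
  proof (cases \<psi>)
    case (Name x)
    then show ?thesis using e e' p
      by (cases x) (auto split: pos.splits form.splits)
  next
    case (Trans k \<Phi>)
    then show ?thesis using e e' p assms(3) by (auto simp: Let_def split: pos.splits if_splits)
  next
    case (Meet \<Phi> \<Psi>)
    then have "q \<in> {Node \<Phi> t, Node \<Psi> t}" "q' \<in> {Node \<Phi> t, Node \<Psi> t}" using e e' p by auto
    moreover have "coherent (Meet \<Phi> \<Psi>)" using co p Meet by simp
    ultimately show ?thesis using assms(3) coherent_branches_eq[of \<Phi> \<Psi>]
      by (metis insert_iff singletonD uncolour.simps(1) pos.inject(1))
  next
    case (Join \<Phi> \<Psi>)
    then have "q \<in> {Node \<Phi> t, Node \<Psi> t}" "q' \<in> {Node \<Phi> t, Node \<Psi> t}" using e e' p by auto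
    moreover have "coherent (Join \<Phi> \<Psi>)" using co p Join by simp
    ultimately show ?thesis using assms(3) coherent_branches_eq[of \<Phi> \<Psi>]
      by (metis insert_iff singletonD uncolour.simps(1) pos.inject(1))
  qed (use e e' p in auto)
qed

end

locale game = valued V for V :: "('v, 'a, 'k, 'g, 's :: finite) valuation" +
  fixes \<phi> :: "('v, 'a, 'k, 'g) form" and s :: 's
  assumes closed: "closed_form \<phi>"
begin

definition game_paths :: "('v, 'a, 'k, 'g, 's) pos list set" where
  "game_paths = {\<pi>. \<pi> \<noteq> [] \<and> hd \<pi> = Node \<phi> s \<and>
     (\<forall>k. Suc k < length \<pi> \<longrightarrow> moves (take k \<pi>) (\<pi> ! k) (\<pi> ! Suc k))}"

lemma tree_paths_game_paths: "tree_paths V \<sigma> \<tau> \<phi> s \<subseteq> game_paths"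
  by (auto simp: tree_paths_def game_paths_def moves_def)

lemma game_paths_moves: "\<pi> \<in> game_paths \<Longrightarrow> Suc k < length \<pi> \<Longrightarrow> moves (take k \<pi>) (\<pi> ! k) (\<pi> ! Suc k)"
  by (simp add: game_paths_def)

lemma game_paths_0: "\<pi> \<in> game_paths \<Longrightarrow> \<pi> ! 0 = Node \<phi> s"
  by (auto simp: game_paths_def simp flip: hd_conv_nth)

text \<open>The clause on names guarantees that a colour position has a successor and that its
  lookup \<open>\<pi> ! i\<close> hits a binder of the same variable. Coherence is carried along for
  \<open>moves_uncolour_inj\<close>.\<close>

definition well_formed :: "('v, 'a, 'k, 'g, 's) pos list \<Rightarrow> nat \<Rightarrow> bool" where
  "well_formed \<pi> k \<longleftrightarrow> (\<forall>y. \<pi> ! k = Tip y \<longrightarrow> 0 \<le> y \<and> y \<le> 1) \<and>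
     (\<forall>\<psi> t. \<pi> ! k = Node \<psi> t \<longrightarrow> coherent \<psi>) \<and>
     (\<forall>x\<in>pos_names (\<pi> ! k). \<exists>X i c \<Phi>. x = Colour X i \<and> i < k \<and> binding (\<pi> ! i) = Some (c, X, \<Phi>))"

text \<open>Strong induction, because visiting a colour jumps back: the new formula is the body of
  the binder at position \<open>i\<close>, so the invariant at \<open>i\<close> is used and not only
  the one at the preceding position.\<close>

lemma game_paths_well_formed:
  assumes "\<pi> \<in> game_paths" "k < length \<pi>"
  shows "well_formed \<pi> k"
  using assms(2)
proof (induction k rule: less_induct)
  case (less k)
  show ?case
  proof (cases k)
    case 0
    then show ?thesis
      using game_paths_0[OF assms(1)] closed coherent_colourless[of \<phi>]
      by (auto simp: well_formed_def closed_form_def)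
  next
    case (Suc m)
    have m: "well_formed \<pi> m" using less Suc by simp
    have "moves (take m \<pi>) (\<pi> ! m) (\<pi> ! Suc m)"
      using game_paths_moves[OF assms(1)] less.prems Suc by simp
    then show ?thesis
    proof (cases rule: moves_cases)
      case (tip y)
      then show ?thesis by (simp add: well_formed_def Suc)
    next
      case (sub \<psi> t \<psi>' t')
      then show ?thesis using m unfolding well_formed_def Suc by (auto 0 4 intro: less_SucI)
    next
      case (binding c X \<Phi> t)
      then show ?thesis using less.prems Suc
        by (auto simp: well_formed_def coherent_Name_Colour)
    next
      case (colour X i c Y \<Phi> t)
      have im: "i < m" and X: "\<exists>c \<Phi>. binding (\<pi> ! i) = Some (c, X, \<Phi>)"
        using m colour(1) by (auto simp: well_formed_def)
      then have b: "binding (\<pi> ! i) = Some (c, X, \<Phi>)" using colour(3) by auto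
      have i: "well_formed \<pi> i" using less im Suc by simp
      obtain t' where pi: "\<pi> ! i = Node (if c then Mu X \<Phi> else Nu X \<Phi>) t'"
        using binding_SomeE[OF b] .
      have "coherent (subst_colour X i \<Phi>)"
        using i pi by (intro coherent_subst_colour) (auto simp: well_formed_def split: if_splits)
      moreover have "\<exists>Z j c \<Phi>. x = Colour Z j \<and> j < k \<and> binding (\<pi> ! j) = Some (c, Z, \<Phi>)"
        if x: "x \<in> free_names (subst_colour X i \<Phi>)" for x
      proof -
        have "x \<in> pos_names (\<pi> ! i) \<or> x = Colour X i"
          using x free_names_subst_colour[of X i \<Phi>] binding_props(1)[OF b] by blast
        then show ?thesis
        proof
          assume "x \<in> pos_names (\<pi> ! i)"
          then obtain Z j c \<Phi> where "x = Colour Z j" "j < i" "binding (\<pi> ! j) = Some (c, Z, \<Phi>)"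
            using i unfolding well_formed_def by blast
          then show ?thesis using im Suc by auto
        qed (use b im Suc in auto)
      qed
      ultimately show ?thesis using colour(4) Suc by (auto simp: well_formed_def)
    qed
  qed
qed

lemma game_paths_Tip: "\<pi> \<in> game_paths \<Longrightarrow> k < length \<pi> \<Longrightarrow> \<pi> ! k = Tip y \<Longrightarrow> 0 \<le> y \<and> y \<le> 1"
  using game_paths_well_formed by (auto simp: well_formed_def)

lemma game_paths_names:
  "\<pi> \<in> game_paths \<Longrightarrow> k < length \<pi> \<Longrightarrow> x \<in> pos_names (\<pi> ! k) \<Longrightarrow>
    \<exists>X i c \<Phi>. x = Colour X i \<and> i < k \<and> binding (\<pi> ! i) = Some (c, X, \<Phi>)"
  using game_paths_well_formed by (simp add: well_formed_def)

lemma game_paths_colour_of: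
  assumes "\<pi> \<in> game_paths" "k < length \<pi>" "colour_of (\<pi> ! k) = Some i"
  obtains X t c \<Phi> where "\<pi> ! k = Node (Name (Colour X i)) t" "i < k" "binding (\<pi> ! i) = Some (c, X, \<Phi>)"
proof -
  obtain X t where k: "\<pi> ! k = Node (Name (Colour X i)) t" using colour_of_SomeE[OF assms(3)] .
  show thesis using game_paths_names[OF assms(1,2), of "Colour X i"] k that by auto
qed

text \<open>A move depends on the whole prefix through the colour lookup, so equality is carried for
  all earlier positions; the two next positions are then moves from the same position after the same
  prefix.\<close>

lemma map_uncolour_inj:
  assumes "\<pi> \<in> game_paths" "\<pi>' \<in> game_paths" "map uncolour \<pi> = map uncolour \<pi>'"
  shows "\<pi> = \<pi>'"
proof (rule nth_equalityI)
  show len: "length \<pi> = length \<pi>'" using assms(3) by (metis length_map)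
  show "\<pi> ! k = \<pi>' ! k" if "k < length \<pi>" for k
    using that
  proof (induction k rule: less_induct)
    case (less k)
    show ?case
    proof (cases k)
      case 0
      then show ?thesis using game_paths_0 assms by simp
    next
      case (Suc m)
      have take: "take m \<pi> = take m \<pi>'"
        using less len Suc by (intro nth_equalityI) auto
      have m: "\<pi> ! m = \<pi>' ! m" using less Suc by simp
      have u: "uncolour (\<pi> ! Suc m) = uncolour (\<pi>' ! Suc m)"
        using arg_cong[OF assms(3), of "\<lambda>xs. xs ! Suc m"] less.prems len Suc by simp
      have "\<pi> ! Suc m = \<pi>' ! Suc m"
      proof (rule moves_uncolour_inj[OF _ _ u])
        show "moves (take m \<pi>) (\<pi> ! m) (\<pi> ! Suc m)"
          using game_paths_moves[OF assms(1)] less.prems Suc by simp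
        show "moves (take m \<pi>) (\<pi> ! m) (\<pi>' ! Suc m)"
          using game_paths_moves[OF assms(2)] less.prems Suc len take m by simp
        show "coherent \<psi>" if "\<pi> ! m = Node \<psi> t" for \<psi> t
          using game_paths_well_formed[OF assms(1), of m] less.prems Suc that
          by (simp add: well_formed_def)
      qed
      then show ?thesis using Suc by simp
    qed
  qed
qed

text \<open>Dependence graph of colours, which are identified with their creation positions. Its
  transitive closure collects the colours reachable from position \<open>k\<close> by
  unfolding.\<close>

definition refers :: "('v, 'a, 'k, 'g, 's) pos list \<Rightarrow> (nat \<times> nat) set" where
  "refers \<pi> = {(k, i). k < length \<pi> \<and> (\<exists>X. Colour X i \<in> pos_names (\<pi> ! k))}"

lemma refers_less: "\<pi> \<in> game_paths \<Longrightarrow> (k, i) \<in> refers \<pi> \<Longrightarrow> i < k"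
  using game_paths_names by (fastforce simp: refers_def)

lemma refers_trancl_less:
  assumes "\<pi> \<in> game_paths" "(k, i) \<in> (refers \<pi>)\<^sup>+"
  shows "i < k"
  using assms(2) by (induction rule: trancl_induct) (auto dest: refers_less[OF assms(1)])

text \<open>A colour that is still reachable keeps the environment of its creation: the outer
  colours on which its body depends have not been visited since.\<close>

lemma no_visits_since_creation:
  assumes "\<pi> \<in> game_paths" "k < length \<pi>" "(k, i) \<in> (refers \<pi>)\<^sup>+" "(i, j) \<in> refers \<pi>"
    and "i \<le> m" "m < k"
  shows "colour_of (\<pi> ! m) \<noteq> Some j"
  using assms(2-)
proof (induction k arbitrary: i j m)
  case 0
  then show ?case by simp
next
  case (Suc k)
  note IH = Suc.IH
  have k: "Suc k < length \<pi>" "k < length \<pi>" using Suc.prems by auto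
  have ik: "i \<le> k" using refers_trancl_less[OF assms(1) Suc.prems(2)] by simp
  \<comment> \<open>The induction hypothesis covers the positions before \<open>k\<close>, leaving
    only a possible visit at \<open>k\<close> itself.\<close>
  have prev: "colour_of (\<pi> ! m) \<noteq> Some j" if "(k, i) \<in> (refers \<pi>)\<^sup>+" "colour_of (\<pi> ! k) \<noteq> Some j"
    using IH[OF k(2) that(1) Suc.prems(3,4)] that(2) Suc.prems(5) by (cases "m = k") auto
  have "moves (take k \<pi>) (\<pi> ! k) (\<pi> ! Suc k)" using game_paths_moves[OF assms(1) k(1)] .
  then show ?case
  proof (cases rule: moves_cases)
    case (tip y)
    then have "(Suc k, x) \<notin> refers \<pi>" for x by (simp add: refers_def)
    then show ?thesis using Suc.prems(2) by (metis tranclD)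
  next
    case (sub \<psi> t \<psi>' t')
    have "(k, x) \<in> refers \<pi>" if "(Suc k, x) \<in> refers \<pi>" for x
      using that sub k by (auto simp: refers_def)
    then have "(k, i) \<in> (refers \<pi>)\<^sup>+"
      using Suc.prems(2) by (metis rtrancl_into_trancl2 tranclD)
    then show ?thesis using prev sub by simp
  next
    case (binding c X \<Phi> t)
    have "x = k" if "(Suc k, x) \<in> refers \<pi>" for x
      using that binding k by (auto simp: refers_def)
    then have "i = k \<or> (k, i) \<in> (refers \<pi>)\<^sup>+"
      using Suc.prems(2) by (metis rtranclD tranclD)
    then show ?thesis
    proof
      assume "i = k"
      then have "m = k" using Suc.prems by simp
      then show ?thesis using binding by simp
    qed (use prev binding in simp)
  next
    case (colour X a c Y \<Phi> t)
    obtain c' \<Phi>' where ak: "a < k" and b: "binding (\<pi> ! a) = Some (c', X, \<Phi>')"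
      using game_paths_names[OF assms(1) k(2), of "Colour X a"] colour(1) by auto
    have ka: "(k, a) \<in> refers \<pi>" using colour k by (auto simp: refers_def)
    have bX: "binding (\<pi> ! a) = Some (c, X, \<Phi>)" using b colour(3) ak by auto
    have "x = a \<or> (a, x) \<in> refers \<pi>" if "(Suc k, x) \<in> refers \<pi>" for x
      using that colour(4) free_names_subst_colour[of X a \<Phi>] binding_props(1)[OF bX] ak k
      by (auto simp: refers_def)
    then have ai: "i = a \<or> (a, i) \<in> (refers \<pi>)\<^sup>+"
      using Suc.prems(2) by (metis rtranclD rtrancl_into_trancl2 tranclD)
    then have ki: "(k, i) \<in> (refers \<pi>)\<^sup>+" using ka by (metis r_into_trancl' trancl_into_trancl2)
    \<comment> \<open>Position \<open>k\<close> visits \<open>a\<close>, and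
      \<open>j < i \<le> a\<close> shows that this is not a visit to \<open>j\<close>.\<close>
    have "j < i" using refers_less[OF assms(1) Suc.prems(3)] .
    moreover have "i \<le> a" using ai refers_trancl_less[OF assms(1)] by fastforce
    ultimately show ?thesis using prev[OF ki] colour(2) by simp
  qed
qed

text \<open>Let \<open>m\<close> be least such that only finitely many bindings of size above \<open>m\<close> are met. If each
  colour were visited finitely often, then from some point on all unfolded bindings would have size
  at most \<open>m\<close>, so after one more binding the positions would stay below size \<open>m\<close>.\<close>

lemma some_colour_infinitely_often:
  assumes \<omega>: "\<And>n. map \<omega> [0..<Suc n] \<in> game_paths"
  shows "\<exists>i. \<exists>\<^sub>\<infinity>n. colour_of (\<omega> n) = Some i"
proof (rule ccontr)
  assume "\<not> ?thesis"
  then have fin_visits: "finite {n. colour_of (\<omega> n) = Some i}" for i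
    by (simp add: INFM_iff_infinite)
  let ?pre = "\<lambda>n. map \<omega> [0..<n]"
  have nth: "?pre (Suc n) ! k = \<omega> k" if "k \<le> n" for k n
    using that by (simp add: nth_append del: upt_Suc)
  have mv: "moves (?pre n) (\<omega> n) (\<omega> (Suc n))" for n
  proof -
    have "moves (take n (?pre (Suc (Suc n)))) (?pre (Suc (Suc n)) ! n) (?pre (Suc (Suc n)) ! Suc n)"
      using game_paths_moves[OF \<omega>, of n "Suc n"] by simp
    then show ?thesis using nth[of n "Suc n"] nth[of "Suc n" "Suc n"]
      by (simp add: take_map del: upt_Suc)
  qed
  have no_tip: "\<omega> n \<noteq> Tip y" for n y using moves_Node[OF mv[of n]] by auto
  have step: "(colour_of (\<omega> n) = None \<and> binding (\<omega> n) = None \<and> pos_size (\<omega> (Suc n)) < pos_size (\<omega> n)) \<or>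
      (colour_of (\<omega> n) = None \<and> binding (\<omega> n) \<noteq> None \<and> pos_size (\<omega> (Suc n)) = 0 \<and> pos_size (\<omega> n) > 0) \<or>
      (\<exists>i<n. colour_of (\<omega> n) = Some i \<and> binding (\<omega> i) \<noteq> None \<and> pos_size (\<omega> (Suc n)) < pos_size (\<omega> i))" for n
    using mv[of n]
  proof (cases rule: moves_cases)
    case (tip y)
    then show ?thesis using no_tip by simp
  next
    case (binding c X \<Phi> t)
    then show ?thesis using binding_props(2)[OF binding(2)] by simp
  next
    case (colour X i c Y \<Phi> t)
    have "i < n" using game_paths_colour_of[OF \<omega>, of n n i] colour(2) nth[of n n] by auto
    then have b: "binding (\<omega> i) = Some (c, Y, \<Phi>)" using colour(3) by simp
    then show ?thesis using colour \<open>i < n\<close> binding_props(2)[OF b] by (auto simp: fsize_subst_colour)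
  qed auto
  \<comment> \<open>A position is no larger than some earlier one: its predecessor, or the binder of
    the colour that the predecessor visits.\<close>
  have bounded: "pos_size (\<omega> n) \<le> pos_size (\<omega> 0)" for n
  proof (induction n rule: less_induct)
    case (less n)
    show ?case
    proof (cases n)
      case (Suc m)
      have "\<exists>i\<le>m. pos_size (\<omega> (Suc m)) \<le> pos_size (\<omega> i)"
        using step[of m] by (metis less_imp_le order_refl zero_le)
      then obtain i where "i < n" "pos_size (\<omega> n) \<le> pos_size (\<omega> i)"
        unfolding Suc by (metis le_imp_less_Suc)
      then show ?thesis using less.IH[of i] by simp
    qed simp
  qed
  define big where "big m = {n. binding (\<omega> n) \<noteq> None \<and> pos_size (\<omega> n) > m}" for m
  have "big (pos_size (\<omega> 0)) = {}" using bounded by (simp add: big_def not_less)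
  then have ex: "\<exists>m. finite (big m)" by (metis finite.emptyI)
  define m where "m = (LEAST m. finite (big m))"
  have fin: "finite (big m)" unfolding m_def using ex by (rule LeastI_ex)
  have "finite (\<Union>i\<in>big m. {n. colour_of (\<omega> n) = Some i})" using fin fin_visits by blast
  then have "finite (big m \<union> (\<Union>i\<in>big m. {n. colour_of (\<omega> n) = Some i}))" using fin by blast
  \<comment> \<open>From \<open>K\<close> on there is neither a binder of size above
    \<open>m\<close> nor a visit to a colour created by one; the latter is where finitely many
    visits per colour are used.\<close>
  then obtain K where K: "\<And>n. n \<in> big m \<union> (\<Union>i\<in>big m. {n. colour_of (\<omega> n) = Some i}) \<Longrightarrow> n < K"
    by (meson finite_nat_bounded lessThan_iff subsetD)
  have late: "pos_size (\<omega> (Suc n)) < m" if "n \<ge> K" "colour_of (\<omega> n) = Some i" for n i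
  proof -
    have "binding (\<omega> i) \<noteq> None" "pos_size (\<omega> (Suc n)) < pos_size (\<omega> i)" using step[of n] that by auto
    moreover have "i \<notin> big m" using K[of n] that by auto
    ultimately show ?thesis by (auto simp: big_def)
  qed
  show False
  proof (cases m)
    case 0
    \<comment> \<open>For \<open>m = 0\<close> no binders and no visits remain after
      \<open>K\<close>, so sizes would decrease forever.\<close>
    have "pos_size (\<omega> (Suc n)) < pos_size (\<omega> n)" if "n \<ge> K" for n
    proof -
      have "colour_of (\<omega> n) = None" using late[OF that] 0 by (cases "colour_of (\<omega> n)") auto
      moreover have "n \<notin> big m" using K[of n] that by auto
      ultimately show ?thesis using step[of n] 0 by (auto simp: big_def)
    qed
    then have "pos_size (\<omega> (K + n)) + n \<le> pos_size (\<omega> K)" for n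
    proof (induction n)
      case (Suc n)
      have "pos_size (\<omega> (Suc (K + n))) < pos_size (\<omega> (K + n))" by (rule Suc.prems) simp
      then show ?case using Suc.IH[OF Suc.prems] by simp
    qed simp
    from this[of "Suc (pos_size (\<omega> K))"] show False by simp
  next
    case (Suc l)
    have "infinite (big l)" using not_less_Least[of l "\<lambda>m. finite (big m)"] Suc by (auto simp: m_def)
    then obtain k where k: "k \<ge> K" "k \<in> big l" by (meson infinite_nat_iff_unbounded_le)
    \<comment> \<open>The binder at \<open>k\<close> is followed by a colour, of size 0. No later
      position climbs back to size \<open>m\<close>, because a visit leads strictly below the size
      of its binder, which is at most \<open>m\<close>.\<close>
    have small: "pos_size (\<omega> (Suc (k + n))) < m" for n
    proof (induction n)
      case 0
      have "binding (\<omega> k) \<noteq> None" using k by (simp add: big_def)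
      then show ?case using step[of k] late[of k] k Suc by auto
    next
      case (Suc n)
      show ?case
      proof (cases "colour_of (\<omega> (Suc (k + n)))")
        case None
        then show ?thesis using step[of "Suc (k + n)"] Suc.IH by auto
      next
        case (Some i)
        then show ?thesis using late[of "Suc (k + n)" i] k by simp
      qed
    qed
    obtain k' where k': "k' > k" "k' \<in> big l"
      using \<open>infinite (big l)\<close> by (meson infinite_nat_iff_unbounded)
    then obtain n where "k' = Suc (k + n)" using less_iff_Suc_add by auto
    then show False using small[of n] k' Suc by (simp add: big_def)
  qed
qed

end

section \<open>Approximately optimal strategies\<close>

lemma of_bool_pmf:
  assumes "\<And>q. f q = (of_bool (q = q0) :: real)"
  shows "\<exists>p. finite (set_pmf p) \<and> (\<forall>q. pmf p q = f q)"
  by (rule exI[of _ "return_pmf q0"]) (auto simp: assms pmf_return)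

context valued
begin

abbreviation "stay k t \<equiv> (\<Sum>s'\<in>UNIV. spmf (vtrans V k t) (State s'))"

abbreviation "tip_of k t \<equiv> Tip (spmf (vtrans V k t) Payoff / (1 - stay k t))"

lemma edge_prob_Trans:
  "edge_prob V \<sigma> \<tau> \<pi> (Node (Trans k \<Phi>) t) (Node \<Psi> s') =
     (if \<Psi> = \<Phi> then spmf (vtrans V k t) (State s') else 0)"
  "edge_prob V \<sigma> \<tau> \<pi> (Node (Trans k \<Phi>) t) (Tip y) =
     (if stay k t < 1 \<and> Tip y = tip_of k t then 1 - stay k t else 0)"
  by (simp_all add: Let_def)

lemma stay_payoff: "spmf (vtrans V k t) Payoff + stay k t \<le> 1"
  using sum_outcome_spmf .

lemma stay_le_1: "stay k t \<le> 1"
  using stay_payoff[of k t] pmf_nonneg[of "vtrans V k t" "Some Payoff"] by linarith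

text \<open>\<open>A\<close> is left open because the sum will run over the edges of positive
  probability. For \<open>stay k t = 1\<close> there is no tip edge, and the weight of
  \<open>tip_of k t\<close> in the formula is 0 as well.\<close>

lemma sum_edge_prob_Trans:
  fixes f :: "_ \<Rightarrow> real"
  assumes E_def: "E = edge_prob V \<sigma> \<tau> \<pi> (Node (Trans k \<Phi>) t)"
    and "finite A" "{q. E q \<noteq> 0} \<subseteq> A"
  shows "(\<Sum>q\<in>A. E q * f q) = (\<Sum>s'\<in>UNIV. spmf (vtrans V k t) (State s') * f (Node \<Phi> s')) +
     (1 - stay k t) * f (tip_of k t)"
proof -
  let ?B = "insert (tip_of k t) (range (Node \<Phi>))"
  have Etip: "E (tip_of k t) = 1 - stay k t"
    using stay_le_1[of k t] unfolding E_def by (subst edge_prob_Trans) auto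
  have zero: "E q = 0" if "q \<notin> ?B" for q
    using that unfolding E_def by (cases q) (auto simp: Let_def)
  have "(\<Sum>q\<in>A. E q * f q) = (\<Sum>q\<in>A \<union> ?B. E q * f q)"
    using assms by (intro sum.mono_neutral_left) auto
  also have "\<dots> = (\<Sum>q\<in>?B. E q * f q)"
    using zero assms by (intro sum.mono_neutral_right) auto
  also have "\<dots> = E (tip_of k t) * f (tip_of k t) + (\<Sum>q\<in>range (Node \<Phi>). E q * f q)"
    by (rule sum.insert) auto
  also have "(\<Sum>q\<in>range (Node \<Phi>). E q * f q) = (\<Sum>s'\<in>UNIV. E (Node \<Phi> s') * f (Node \<Phi> s'))"
    by (subst sum.reindex) (auto simp: inj_on_def)
  finally show ?thesis unfolding Etip by (simp add: E_def edge_prob_Trans)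
qed

lemma edge_prob_Trans_pmf:
  "\<exists>p. finite (set_pmf p) \<and> (\<forall>q. pmf p q = edge_prob V \<sigma> \<tau> \<pi> (Node (Trans k \<Phi>) t) q)"
proof -
  let ?E = "edge_prob V \<sigma> \<tau> \<pi> (Node (Trans k \<Phi>) t)"
  let ?B = "insert (tip_of k t) (range (Node \<Phi>))"
  have nonneg: "?E q \<ge> 0" for q
    by (cases q) (auto simp: Let_def)
  have zero: "?E q = 0" if "q \<notin> ?B" for q
    using that by (cases q) (auto simp: Let_def)
  then have B: "{q. ?E q \<noteq> 0} \<subseteq> ?B" by blast
  have sum1: "(\<Sum>q\<in>?B. ?E q) = 1"
    using sum_edge_prob_Trans[OF refl _ B, of "\<lambda>_. 1"] by simp
  have "(\<integral>\<^sup>+q. ennreal (?E q) \<partial>count_space UNIV) = (\<Sum>q\<in>?B. ennreal (?E q))"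
    using zero by (intro nn_integral_count_space') (auto simp: ennreal_neg)
  also have "\<dots> = ennreal (\<Sum>q\<in>?B. ?E q)" using nonneg by (intro sum_ennreal) auto
  finally have one: "(\<integral>\<^sup>+q. ennreal (?E q) \<partial>count_space UNIV) = 1" using sum1 by simp
  have pmf: "pmf (embed_pmf ?E) q = ?E q" for q
    using nonneg one by (rule pmf_embed_pmf)
  have "set_pmf (embed_pmf ?E) \<subseteq> ?B" using zero by (auto simp: set_pmf_eq pmf)
  then have "finite (set_pmf (embed_pmf ?E))" by (rule finite_subset) simp
  then show ?thesis using pmf by blast
qed

end

context game
begin

lemma last_butlast_nth: "\<pi> \<in> game_paths \<Longrightarrow> last \<pi> = \<pi> ! (length \<pi> - 1) \<and> length \<pi> - 1 < length \<pi>"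
  by (auto simp: game_paths_def last_conv_nth)

lemma last_names:
  assumes "\<pi> \<in> game_paths" "x \<in> pos_names (last \<pi>)"
  obtains X i c \<Phi> where "x = Colour X i" "i < length (butlast \<pi>)" "binding (butlast \<pi> ! i) = Some (c, X, \<Phi>)"
  using game_paths_names[OF assms(1), of "length \<pi> - 1" x] last_butlast_nth[OF assms(1)] assms(2) that
  by (auto simp: nth_butlast)

lemma deterministic_or_Trans:
  assumes "\<pi> \<in> game_paths"
  obtains (tip) y where "last \<pi> = Tip y" | (trans) k \<Phi> t where "last \<pi> = Node (Trans k \<Phi>) t"
  | (det) q0 where "\<And>q. edge_prob V \<sigma> \<tau> (butlast \<pi>) (last \<pi>) q = of_bool (q = q0)"
proof (cases "last \<pi>")
  case (Tip y)
  then show thesis by (rule tip)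
next
  case (Node \<psi> t)
  show thesis
  proof (cases \<psi>)
    case (Name x)
    then obtain X i c \<Phi> where x: "x = Colour X i" and b: "binding (butlast \<pi> ! i) = Some (c, X, \<Phi>)"
      using last_names[OF assms, of x] Node by (metis free_names.simps(1) pos_names.simps(1) singletonI)
    then show ?thesis using Name Node
      by (intro det[of "Node (subst_colour X i \<Phi>) t"]) (elim binding_SomeE, auto)
  next
    case (Trans k \<Phi>)
    then show ?thesis using Node by (intro trans) auto
  qed (use Node det in auto)
qed

lemma game_tree: "game_tree V \<sigma> \<tau> \<phi> s"
proof
  fix \<pi> assume "\<pi> \<in> tree_paths V \<sigma> \<tau> \<phi> s"
  then have \<pi>: "\<pi> \<in> game_paths" using tree_paths_game_paths by blast
  show "(\<forall>q. edge_prob V \<sigma> \<tau> (butlast \<pi>) (last \<pi>) q = 0) \<or>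
    (\<exists>p. finite (set_pmf p) \<and> (\<forall>q. pmf p q = edge_prob V \<sigma> \<tau> (butlast \<pi>) (last \<pi>) q))"
    using \<pi>
  proof (cases rule: deterministic_or_Trans[where \<sigma>=\<sigma> and \<tau>=\<tau>])
    case (trans k \<Phi> t)
    then show ?thesis using edge_prob_Trans_pmf by simp
  next
    case (det q0)
    from of_bool_pmf[OF this] show ?thesis ..
  qed simp
qed

text \<open>The edges of a \<open>Trans\<close> position have total weight 1, and every other
  formula met in a play has exactly one edge, so a play can end only in a tip.\<close>

lemma terminal_Tip:
  assumes "\<pi> \<in> game_paths" "\<And>q. edge_prob V \<sigma> \<tau> (butlast \<pi>) (last \<pi>) q = 0"
  obtains y where "last \<pi> = Tip y" "0 \<le> y" "y \<le> 1"
  using assms(1)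
proof (cases rule: deterministic_or_Trans[where \<sigma>=\<sigma> and \<tau>=\<tau>])
  case (tip y)
  then show ?thesis
    using game_paths_Tip[OF assms(1), of "length \<pi> - 1" y] last_butlast_nth[OF assms(1)] that by auto
next
  case (trans k \<Phi> t)
  obtain p where p: "\<And>q. pmf p q = edge_prob V \<sigma> \<tau> (butlast \<pi>) (last \<pi>) q"
    using edge_prob_Trans_pmf trans by metis
  then show ?thesis using assms(2) set_pmf_not_empty[of p] by (auto simp: set_pmf_eq)
next
  case (det q0)
  then show ?thesis using assms(2)[of q0] by simp
qed

end

section \<open>Budgets, values of colours and the potential of a path\<close>

definition visits :: "('v, 'a, 'k, 'g, 's) pos list \<Rightarrow> nat \<Rightarrow> nat" where
  "visits \<pi> i = card {k. k < length \<pi> \<and> colour_of (\<pi> ! k) = Some i}"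

lemma visits_snoc: "visits (\<pi> @ [p]) i = visits \<pi> i + (if colour_of p = Some i then 1 else 0)"
proof -
  have "{k. k < length (\<pi> @ [p]) \<and> colour_of ((\<pi> @ [p]) ! k) = Some i} =
    {k. k < length \<pi> \<and> colour_of (\<pi> ! k) = Some i} \<union> (if colour_of p = Some i then {length \<pi>} else {})"
    by (auto simp: nth_append less_Suc_eq)
  then show ?thesis unfolding visits_def by (auto simp: card_insert_if)
qed

text \<open>For \<open>b = True\<close> (Max) the \<open>\<mu>\<close>-colours, and for \<open>b = False\<close> (Min) the \<open>\<nu>\<close>-colours, are
  replaced by finite iterates of their bodies: a colour created at position \<open>i\<close> gets a budget of
  iterations that approximates the fixed point up to \<open>\<epsilon> (Suc i)\<close>, and each visit consumes one
  iteration.\<close>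

locale player = game V \<phi> s
  for V :: "('v, 'a, 'k, 'g, 's :: finite) valuation" and \<phi> s +
  fixes b :: bool and \<epsilon> :: "nat \<Rightarrow> real"
  assumes eps_pos: "\<epsilon> n > 0"
begin

definition budget :: "nat \<Rightarrow> (('s \<Rightarrow> real) \<Rightarrow> 's \<Rightarrow> real) \<Rightarrow> nat" where
  "budget i F = (SOME n. \<forall>t. \<bar>(F ^^ n) (start b) t - fixp b F t\<bar> \<le> \<epsilon> i)"

lemma budget: "nonexpansive F \<Longrightarrow> \<bar>(F ^^ budget i F) (start b) t - fixp b F t\<bar> \<le> \<epsilon> i"
  using someI_ex[OF fixp_approx[OF _ eps_pos, of F b i]] unfolding budget_def by blast

text \<open>The value of plain names is irrelevant, since the formulas of a play have none.\<close>

definition env :: "(nat \<Rightarrow> 's \<Rightarrow> real) \<Rightarrow> 'v name \<Rightarrow> 's \<Rightarrow> real" where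
  "env f n = (case n of Plain X \<Rightarrow> start b | Colour X i \<Rightarrow> f i)"

text \<open>The body of colour \<open>i\<close> is evaluated in the environment of its creation,
  that is of \<open>take i \<pi>\<close>; hence recursion on the length. In \<open>raw\<close> the
  path excludes the current position, so a visit is charged only once the colour has been evaluated
  there. Truncated subtraction freezes an overdrawn budget at \<open>start b\<close>.\<close>

function colour_val :: "('v, 'a, 'k, 'g, 's) pos list \<Rightarrow> nat \<Rightarrow> 's \<Rightarrow> real" where
  "colour_val \<pi> i = (if i < length \<pi> then
     (case binding (\<pi> ! i) of None \<Rightarrow> start b
      | Some (c, X, \<Phi>) \<Rightarrow>
         (let F = (\<lambda>x. den \<Phi> ((env (\<lambda>j. colour_val (take i \<pi>) j))(Plain X := x)))
          in if c = b then (F ^^ (budget (Suc i) F - visits \<pi> i)) (start b) else fixp c F))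
     else start b)"
  by auto
termination by (relation "Wellfounded.measure (\<lambda>(\<pi>, i). length \<pi>)") auto

declare colour_val.simps [simp del]

definition body :: "('v, 'a, 'k, 'g, 's) pos list \<Rightarrow> nat \<Rightarrow> ('s \<Rightarrow> real) \<Rightarrow> 's \<Rightarrow> real" where
  "body \<pi> i = (case binding (\<pi> ! i) of None \<Rightarrow> id
     | Some (c, X, \<Phi>) \<Rightarrow> (\<lambda>x. den \<Phi> ((env (colour_val (take i \<pi>)))(Plain X := x))))"

lemma body_eq: "binding (\<pi> ! i) = Some (c, X, \<Phi>) \<Longrightarrow>
    body \<pi> i = (\<lambda>x. den \<Phi> ((env (colour_val (take i \<pi>)))(Plain X := x)))"
  by (simp add: body_def)

lemma colour_val_eq:
  assumes "i < length \<pi>" "binding (\<pi> ! i) = Some (c, X, \<Phi>)"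
  shows "colour_val \<pi> i = (if c = b
    then (body \<pi> i ^^ (budget (Suc i) (body \<pi> i) - visits \<pi> i)) (start b) else fixp c (body \<pi> i))"
  using assms by (subst colour_val.simps) (simp add: body_eq Let_def)

lemma colour_val_in_expectations: "colour_val \<pi> i \<in> expectations"
proof (induction "length \<pi>" arbitrary: \<pi> i rule: less_induct)
  case less
  show ?case
  proof (cases "i < length \<pi> \<and> binding (\<pi> ! i) \<noteq> None")
    case False
    then have "\<not> i < length \<pi> \<or> binding (\<pi> ! i) = None" by blast
    then have "colour_val \<pi> i = start b" by (subst colour_val.simps) (elim disjE; simp)
    then show ?thesis by (simp add: start_in_expectations)
  next
    case True
    then obtain c X \<Phi> where i: "i < length \<pi>" and b: "binding (\<pi> ! i) = Some (c, X, \<Phi>)" by auto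
    have "env (colour_val (take i \<pi>)) \<in> name_vals"
      using less[of "take i \<pi>"] i
      by (auto simp: name_vals_def env_def start_in_expectations split: name.splits)
    then have "nonexpansive (body \<pi> i)" unfolding body_eq[OF b] by (rule body_nonexpansive)
    then show ?thesis unfolding colour_val_eq[OF i b]
      by (auto intro: funpow_in_expectations start_in_expectations fixp_in_expectations)
  qed
qed

lemma env_name_vals: "env (colour_val \<pi>) \<in> name_vals"
  using colour_val_in_expectations
  by (auto simp: name_vals_def env_def start_in_expectations split: name.splits)

lemma nonexpansive_body: "binding (\<pi> ! i) = Some (c, X, \<Phi>) \<Longrightarrow> nonexpansive (body \<pi> i)"
  unfolding body_eq by (rule body_nonexpansive[OF env_name_vals])

lemma body_cong:
  assumes "i < length \<pi>" "i < length \<pi>'" "take (Suc i) \<pi> = take (Suc i) \<pi>'"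
  shows "body \<pi> i = body \<pi>' i"
proof -
  have 1: "take i \<pi> = take i \<pi>'" using arg_cong[OF assms(3), of "take i"] by (simp add: min_def)
  have 2: "\<pi> ! i = \<pi>' ! i" using arg_cong[OF assms(3), of "\<lambda>xs. xs ! i"] by simp
  show ?thesis unfolding body_def 1 2 ..
qed

lemma colour_val_cong:
  assumes "i < length \<pi>" "i < length \<pi>'" "take (Suc i) \<pi> = take (Suc i) \<pi>'" "visits \<pi> i = visits \<pi>' i"
    "binding (\<pi> ! i) = Some (c, X, \<Phi>)"
  shows "colour_val \<pi> i = colour_val \<pi>' i"
proof -
  have "\<pi> ! i = \<pi>' ! i" using arg_cong[OF assms(3), of "\<lambda>xs. xs ! i"] by simp
  then show ?thesis
    using colour_val_eq[of i \<pi>] colour_val_eq[of i \<pi>'] body_cong[OF assms(1-3)] assms by simp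
qed

definition raw :: "('v, 'a, 'k, 'g, 's) pos list \<Rightarrow> ('v, 'a, 'k, 'g, 's) pos \<Rightarrow> real" where
  "raw \<pi> p = (case p of Tip y \<Rightarrow> y | Node \<psi> t \<Rightarrow> den \<psi> (env (colour_val \<pi>)) t)"

text \<open>The inequality is strict: when the budget is just used up the colour correctly has the
  value \<open>start b\<close>, and only a further visit cannot be paid for.\<close>

definition exhausted :: "('v, 'a, 'k, 'g, 's) pos list \<Rightarrow> bool" where
  "exhausted \<pi> \<longleftrightarrow> (\<exists>i<length \<pi>. \<exists>X \<Phi>. binding (\<pi> ! i) = Some (b, X, \<Phi>) \<and>
     visits \<pi> i > budget (Suc i) (body \<pi> i))"

text \<open>Shortfall from the player's ideal payoff. Being affine it commutes with averages, and it
  gives both players the same direction of inequality.\<close>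

definition deficit :: "real \<Rightarrow> real" where
  "deficit v = (if b then 1 - v else v)"

text \<open>The value 1 is the worst deficit and is absorbing. The test omits the last position: a
  visit that overdraws the budget already has deficit 1 (\<open>newly_exhausted\<close>), so
  switching to 1 causes no jump.\<close>

definition potential :: "('v, 'a, 'k, 'g, 's) pos list \<Rightarrow> real" where
  "potential \<pi> = (if exhausted (butlast \<pi>) then 1 else deficit (raw (butlast \<pi>) (last \<pi>)))"

definition best :: "('v, 'a, 'k, 'g, 's) pos list \<Rightarrow> bool" where
  "best \<pi> = (case last \<pi> of
      Node (Meet \<Phi> \<Psi>) t \<Rightarrow> raw \<pi> (Node \<Phi> t) \<le> raw \<pi> (Node \<Psi> t)
    | Node (Join \<Phi> \<Psi>) t \<Rightarrow> raw \<pi> (Node \<Phi> t) \<ge> raw \<pi> (Node \<Psi> t)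
    | _ \<Rightarrow> True)"

text \<open>A colour-insensitive strategy can recover the colours, because a play is determined by its
  uncoloured positions.\<close>

definition strat :: "('v, 'a, 'k, 'g, 's) pos strategy" where
  "strat \<pi> = best (SOME \<pi>'. \<pi>' \<in> game_paths \<and> map uncolour \<pi>' = map uncolour \<pi>)"

lemma strat_in_strategies: "strat \<in> strategies"
  by (simp add: strategies_def strat_def o_def uncolour_idem)

lemma strat_eq_best: "\<pi> \<in> game_paths \<Longrightarrow> strat \<pi> = best \<pi>"
proof -
  assume \<pi>: "\<pi> \<in> game_paths"
  have "(SOME \<pi>'. \<pi>' \<in> game_paths \<and> map uncolour \<pi>' = map uncolour \<pi>) = \<pi>"
    using \<pi> map_uncolour_inj by (intro some_equality) auto
  then show ?thesis by (simp add: strat_def)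
qed

lemma raw_bounds:
  assumes "\<pi> @ [p] \<in> game_paths"
  shows "0 \<le> raw \<pi> p" "raw \<pi> p \<le> 1"
proof -
  have "0 \<le> raw \<pi> p \<and> raw \<pi> p \<le> 1"
  proof (cases p)
    case (Node \<psi> t)
    then show ?thesis using den_in_expectations[OF env_name_vals env_name_vals, of \<psi> \<pi>]
      by (simp add: raw_def expectations_def)
  next
    case (Tip y)
    then show ?thesis using game_paths_Tip[OF assms, of "length \<pi>" y] by (simp add: raw_def)
  qed
  then show "0 \<le> raw \<pi> p" "raw \<pi> p \<le> 1" by auto
qed

lemma potential_nonneg: "\<pi> \<in> game_paths \<Longrightarrow> 0 \<le> potential \<pi>"
  using raw_bounds[of "butlast \<pi>" "last \<pi>"]
  by (auto simp: potential_def deficit_def game_paths_def)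

text \<open>The value of an existing colour depends on the path only up to its creation and on the
  number of its visits, and \<open>p\<close> is not a visit.\<close>

lemma den_snoc:
  assumes "\<pi> @ [p] \<in> game_paths" "colour_of p = None" "free_names \<psi> \<subseteq> pos_names p"
  shows "den \<psi> (env (colour_val (\<pi> @ [p]))) = den \<psi> (env (colour_val \<pi>))"
proof (rule den_cong)
  fix x assume "x \<in> free_names \<psi>"
  then have "x \<in> pos_names (last (\<pi> @ [p]))" using assms(3) by auto
  then obtain X i c \<Phi> where x: "x = Colour X i" "i < length (butlast (\<pi> @ [p]))"
      "binding (butlast (\<pi> @ [p]) ! i) = Some (c, X, \<Phi>)"
    by (rule last_names[OF assms(1)])
  note x = x[unfolded butlast_snoc]
  have "colour_val (\<pi> @ [p]) i = colour_val \<pi> i"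
    using x assms(2) by (intro colour_val_cong) (auto simp: visits_snoc nth_append)
  then show "env (colour_val (\<pi> @ [p])) x = env (colour_val \<pi>) x" by (simp add: env_def x)
qed

text \<open>A colour of the exact kind loses nothing; one with a budget has all of it at hand, and
  the choice of \<open>budget\<close> bounds the loss.\<close>

lemma raw_new_colour:
  assumes "\<pi> @ [p] \<in> game_paths" "binding p = Some (c, X, \<Phi>)" "p = Node \<psi> t"
    and q_def: "q = Node (Name (Colour X (length \<pi>))) t"
  shows "deficit (raw (\<pi> @ [p]) q) \<le> deficit (raw \<pi> p) + \<epsilon> (Suc (length \<pi>))"
proof -
  let ?i = "length \<pi>" and ?\<pi> = "\<pi> @ [p]"
  have b: "binding (?\<pi> ! ?i) = Some (c, X, \<Phi>)" using assms by simp
  have F: "body ?\<pi> ?i = (\<lambda>x. den \<Phi> ((env (colour_val \<pi>))(Plain X := x)))"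
    using body_eq[OF b] by simp
  have "{k. k < length ?\<pi> \<and> colour_of (?\<pi> ! k) = Some ?i} = {}"
  proof safe
    fix k assume k: "k < length ?\<pi>" "colour_of (?\<pi> ! k) = Some ?i"
    have "?i < k" using game_paths_colour_of[OF assms(1) k] by metis
    then show "k \<in> {}" using k by simp
  qed
  then have v: "visits ?\<pi> ?i = 0" by (simp only: visits_def card.empty)
  have "raw \<pi> p = fixp c (body ?\<pi> ?i) t"
    using assms(2,3) unfolding F by (elim binding_SomeE) (auto simp: raw_def)
  moreover have "raw ?\<pi> q = colour_val ?\<pi> ?i t" by (simp add: raw_def q_def env_def)
  ultimately show ?thesis
    using budget[OF nonexpansive_body[OF b], of "Suc ?i" t] eps_pos[of "Suc ?i"]
    by (auto simp: colour_val_eq[OF _ b] v deficit_def abs_le_iff)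
qed

text \<open>A visit trades one iteration for one application of the body,
  \<open>F ((F ^^ n) z) = (F ^^ Suc n) z\<close>, or uses the fixed point equation. This requires
  the outer colours in the body to have kept their values since creation, which
  \<open>no_visits_since_creation\<close> provides.\<close>

lemma raw_unfold:
  assumes "\<pi> @ [p] \<in> game_paths" "p = Node (Name (Colour X i)) t" "binding (\<pi> ! i) = Some (c, X, \<Phi>)"
    and "\<not> exhausted (\<pi> @ [p])"
  shows "raw (\<pi> @ [p]) (Node (subst_colour X i \<Phi>) t) = raw \<pi> p"
proof -
  let ?\<pi> = "\<pi> @ [p]"
  have last: "?\<pi> ! length \<pi> = p" by simp
  have ci: "colour_of p = Some i" using assms(2) by simp
  have i: "i < length \<pi>"
    using game_paths_colour_of[OF assms(1), of "length \<pi>" i] ci by auto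
  have b: "binding (?\<pi> ! i) = Some (c, X, \<Phi>)" using assms(3) i by (simp add: nth_append)
  have body: "body ?\<pi> i = body \<pi> i" using i by (intro body_cong) auto
  have v: "visits ?\<pi> i = Suc (visits \<pi> i)" using ci by (simp add: visits_snoc)
  have frozen: "env (colour_val ?\<pi>) x = env (colour_val (take i ?\<pi>)) x" if x: "x \<in> free_names \<Phi> - {Plain X}" for x
  proof -
    have xi: "x \<in> pos_names (?\<pi> ! i)" using x binding_props(1)[OF b] by simp
    then obtain Y j d \<Psi> where j: "x = Colour Y j" "j < i" "binding (?\<pi> ! j) = Some (d, Y, \<Psi>)"
      using game_paths_names[OF assms(1), of i x] i by auto
    have r1: "(length \<pi>, i) \<in> (refers ?\<pi>)\<^sup>+" using assms(2) by (auto simp: refers_def)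
    have r2: "(i, j) \<in> refers ?\<pi>" using xi i j by (auto simp: refers_def)
    \<comment> \<open>The last position visits \<open>i\<close>, which differs from \<open>j\<close>
      as \<open>j < i\<close>; earlier visits are excluded by the dependence graph.\<close>
    have since: "colour_of (?\<pi> ! m) \<noteq> Some j" if "i \<le> m" "m < length ?\<pi>" for m
    proof (cases "m = length \<pi>")
      case True
      then show ?thesis using ci j by simp
    next
      case False
      then show ?thesis
        using no_visits_since_creation[OF assms(1) _ r1 r2 that(1)] that(2) by simp
    qed
    have "k < length ?\<pi> \<and> colour_of (?\<pi> ! k) = Some j \<longleftrightarrow>
        k < length (take i ?\<pi>) \<and> colour_of (take i ?\<pi> ! k) = Some j" for k
    proof (cases "k < i")
      case True
      then show ?thesis using i by (simp add: nth_append)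
    next
      case False
      then show ?thesis using since[of k] by auto
    qed
    then have "visits ?\<pi> j = visits (take i ?\<pi>) j" by (simp only: visits_def)
    then have "colour_val ?\<pi> j = colour_val (take i ?\<pi>) j"
      using j i by (intro colour_val_cong) (auto simp: min_def)
    then show ?thesis by (simp add: env_def j)
  qed
  have "raw ?\<pi> (Node (subst_colour X i \<Phi>) t) =
      den \<Phi> ((env (colour_val ?\<pi>))(Plain X := colour_val ?\<pi> i)) t"
    by (simp add: raw_def den_subst_colour env_def del: fun_upd_apply)
  also have "\<dots> = body ?\<pi> i (colour_val ?\<pi> i) t"
    unfolding body_eq[OF b] by (rule fun_cong[OF den_cong]) (use frozen in auto)
  also have "\<dots> = colour_val \<pi> i t"
  proof (cases "c = b")
    case True
    have "visits ?\<pi> i \<le> budget (Suc i) (body \<pi> i)"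
    proof (rule ccontr)
      assume "\<not> visits ?\<pi> i \<le> budget (Suc i) (body \<pi> i)"
      then have "exhausted ?\<pi>"
        unfolding exhausted_def using i b True body by (intro exI[of _ i]) (simp add: not_le)
      then show False using assms(4) by simp
    qed
    \<comment> \<open>The truncated difference drops by exactly one because the budget is not yet
      overdrawn.\<close>
    then have "budget (Suc i) (body \<pi> i) - visits \<pi> i = Suc (budget (Suc i) (body \<pi> i) - visits ?\<pi> i)"
      using v by simp
    then show ?thesis
      using colour_val_eq[of i ?\<pi>] colour_val_eq[of i \<pi>] i b assms(3) True body by simp
  next
    case False
    then show ?thesis
      using colour_val_eq[of i ?\<pi>] colour_val_eq[of i \<pi>] i b assms(3) body
        fixp_unfold[OF nonexpansive_body[OF b]] by simp
  qed
  also have "\<dots> = raw \<pi> p" using assms(2) by (simp add: raw_def env_def)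
  finally show ?thesis .
qed

lemma exhausted_snoc: "exhausted \<pi> \<Longrightarrow> exhausted (\<pi> @ [p])"
proof -
  assume "exhausted \<pi>"
  then obtain i X \<Phi> where i: "i < length \<pi>" "binding (\<pi> ! i) = Some (b, X, \<Phi>)"
    "visits \<pi> i > budget (Suc i) (body \<pi> i)" by (auto simp: exhausted_def)
  moreover have "body (\<pi> @ [p]) i = body \<pi> i" using i by (intro body_cong) auto
  ultimately show ?thesis
    unfolding exhausted_def by (intro exI[of _ i]) (auto simp: nth_append visits_snoc)
qed

text \<open>The overdrawing visit is the last position \<open>p\<close>, at which the iterate has
  already come down to \<open>start b\<close>.\<close>

lemma newly_exhausted:
  assumes "\<pi> @ [p] \<in> game_paths" "exhausted (\<pi> @ [p])" "\<not> exhausted \<pi>"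
  shows "deficit (raw \<pi> p) = 1"
proof -
  let ?\<pi> = "\<pi> @ [p]"
  obtain i X \<Phi> where i: "i < length ?\<pi>" "binding (?\<pi> ! i) = Some (b, X, \<Phi>)"
    "visits ?\<pi> i > budget (Suc i) (body ?\<pi> i)" using assms(2) by (auto simp: exhausted_def)
  have "{k. k < length ?\<pi> \<and> colour_of (?\<pi> ! k) = Some i} \<noteq> {}"
    using i(3) unfolding visits_def by (metis card.empty less_zeroE)
  then obtain k where k: "k < length ?\<pi>" "colour_of (?\<pi> ! k) = Some i" by blast
  have "i < k" using game_paths_colour_of[OF assms(1) k] by metis
  then have i': "i < length \<pi>" using k by simp
  have b: "binding (\<pi> ! i) = Some (b, X, \<Phi>)" using i i' by (simp add: nth_append)
  have body: "body ?\<pi> i = body \<pi> i" using i' by (intro body_cong) auto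
  have le: "visits \<pi> i \<le> budget (Suc i) (body \<pi> i)"
    using assms(3) i' b unfolding exhausted_def by (metis not_le)
  then have ci: "colour_of p = Some i" and v: "visits \<pi> i = budget (Suc i) (body \<pi> i)"
    using i(3) by (auto simp: visits_snoc body split: if_splits)
  obtain Y t where "p = Node (Name (Colour Y i)) t" using colour_of_SomeE[OF ci] .
  then have "raw \<pi> p = start b t"
    using colour_val_eq[OF i' b] v by (simp add: raw_def env_def)
  then show ?thesis by (simp add: deficit_def start_def)
qed

lemma potential_snoc: "potential (\<pi> @ [q]) = (if exhausted \<pi> then 1 else deficit (raw \<pi> q))"
  by (simp add: potential_def)

text \<open>The potential is preserved except at two kinds of position: a choice of the opponent can
  only lower the deficit, and creating a colour costs at most its allowance. The new colour has
  index \<open>length \<pi> - 1\<close>, whence \<open>\<epsilon> (length \<pi>)\<close>.\<close>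

lemma potential_step:
  assumes own: "(if b then \<tau> else \<sigma>) = strat"
    and \<pi>: "\<pi> \<in> tree_paths V \<sigma> \<tau> \<phi> s"
    and nt: "\<not> game_tree.terminal V \<sigma> \<tau> \<pi>"
  defines "E \<equiv> edge_prob V \<sigma> \<tau> (butlast \<pi>) (last \<pi>)"
  shows "(\<Sum>q | E q > 0. E q * potential (\<pi> @ [q])) \<le> potential \<pi> + \<epsilon> (length \<pi>)"
proof -
  interpret G: game_tree V \<sigma> \<tau> \<phi> s by (rule game_tree)
  have g: "\<pi> \<in> game_paths" using \<pi> tree_paths_game_paths by blast
  obtain \<pi>' p where snoc: "\<pi> = \<pi>' @ [p]" using G.paths_not_Nil[OF \<pi>] by (cases \<pi> rule: rev_cases) auto
  have g': "\<pi>' @ [p] \<in> game_paths" using g snoc by simp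
  have E: "E = edge_prob V \<sigma> \<tau> \<pi>' p" by (simp add: E_def snoc)
  have sum1: "(\<Sum>q | E q > 0. E q) = 1" using G.sum_succs[OF \<pi> nt] by (simp add: E_def)
  have fin: "finite {q. E q > 0}" using G.finite_succs[OF \<pi>] by (simp add: E_def)
  have Enn: "E q \<ge> 0" for q using G.e_nonneg[OF \<pi>] by (simp add: E_def)
  show ?thesis
  proof (cases "exhausted \<pi>")
    case True
    then have "potential \<pi> = 1"
      using newly_exhausted[OF g'] by (auto simp: potential_def snoc)
    then show ?thesis using True sum1 eps_pos[of "length \<pi>"] by (simp add: potential_snoc)
  next
    case False
    have pot: "potential \<pi> = deficit (raw \<pi>' p)"
      using False exhausted_snoc[of \<pi>' p] by (auto simp: potential_def snoc)
    have det: ?thesis if "\<And>q. E q = of_bool (q = q0)"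
      and "deficit (raw \<pi> q0) \<le> deficit (raw \<pi>' p) + \<epsilon> (length \<pi>)" for q0
    proof -
      have "{q. E q > 0} = {q0}" using that(1) by auto
      then show ?thesis using that False by (simp add: potential_snoc pot)
    qed
    have eps: "\<epsilon> (length \<pi>) \<ge> 0" using eps_pos[of "length \<pi>"] by simp
    have deteq: ?thesis if "\<And>q. E q = of_bool (q = q0)" and "raw \<pi> q0 = raw \<pi>' p" for q0
      using det[OF that(1)] that(2) eps by simp
    have child: "raw \<pi> (Node \<Psi> t) = den \<Psi> (env (colour_val \<pi>')) t"
      if "colour_of p = None" "free_names \<Psi> \<subseteq> pos_names p" for \<Psi> t
      using den_snoc[OF g' that] by (simp add: raw_def snoc)
    show ?thesis
    proof (cases p)
      case (Tip y)
      then have "E q = 0" for q by (simp add: E)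
      then show ?thesis using sum1 by simp
    next
      case (Node \<psi> t)
      show ?thesis
      proof (cases \<psi>)
        case (Name x)
        then have "x \<in> pos_names (last \<pi>)" using Node snoc by simp
        then obtain X i c \<Phi> where x: "x = Colour X i" "i < length (butlast \<pi>)"
            and b: "binding (butlast \<pi> ! i) = Some (c, X, \<Phi>)"
          by (rule last_names[OF g])
        have p: "p = Node (Name (Colour X i)) t" using Name Node x by simp
        have b': "binding (\<pi>' ! i) = Some (c, X, \<Phi>)" using b by (simp add: snoc)
        show ?thesis
        proof (rule deteq)
          show "E q = of_bool (q = Node (subst_colour X i \<Phi>) t)" for q
            using b' unfolding E p by (elim binding_SomeE) auto
          show "raw \<pi> (Node (subst_colour X i \<Phi>) t) = raw \<pi>' p"
            using raw_unfold[OF g' p b'] False by (simp add: snoc)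
        qed
      next
        case (Const A)
        show ?thesis
          by (rule deteq[of "Tip (vconst V A t)"]) (simp_all add: E Node Const raw_def)
      next
        case (Trans k \<Phi>)
        let ?d = "\<lambda>s'. den \<Phi> (env (colour_val \<pi>')) s'"
        let ?P = "spmf (vtrans V k t) Payoff"
        have Ek: "E = edge_prob V \<sigma> \<tau> \<pi>' (Node (Trans k \<Phi>) t)" by (simp add: E Node Trans)
        have A: "{q. E q \<noteq> 0} \<subseteq> {q. E q > 0}" using Enn by (auto simp: less_le)
        have ch: "raw \<pi> (Node \<Phi> s') = ?d s'" for s' using child[of \<Phi>] Node Trans by simp
        \<comment> \<open>If \<open>stay k t = 1\<close>, no mass is left for \<open>Payoff\<close>,
          so both sides vanish.\<close>
        have pay: "(1 - stay k t) * (?P / (1 - stay k t)) = ?P"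
          using stay_payoff[of k t] stay_le_1[of k t] pmf_nonneg[of "vtrans V k t" "Some Payoff"]
          by (cases "stay k t = 1") auto
        have "(\<Sum>q | E q > 0. E q * potential (\<pi> @ [q])) = (\<Sum>q | E q > 0. E q * deficit (raw \<pi> q))"
          using False by (simp add: potential_snoc)
        also have "\<dots> = (\<Sum>s'\<in>UNIV. spmf (vtrans V k t) (State s') * deficit (raw \<pi> (Node \<Phi> s'))) +
            (1 - stay k t) * deficit (raw \<pi> (tip_of k t))"
          by (rule sum_edge_prob_Trans[OF Ek fin A])
        also have "\<dots> = (\<Sum>s'\<in>UNIV. spmf (vtrans V k t) (State s') * deficit (?d s')) +
            (1 - stay k t) * deficit (?P / (1 - stay k t))"
          by (simp add: ch) (simp add: raw_def)
        also have "\<dots> = deficit (?P + (\<Sum>s'\<in>UNIV. spmf (vtrans V k t) (State s') * ?d s'))"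
        proof -
          \<comment> \<open>With the quotient named, it remains to see that an affine map commutes
            with an average whose weights sum to 1.\<close>
          define y where "y = ?P / (1 - stay k t)"
          have "(\<Sum>s'\<in>UNIV. spmf (vtrans V k t) (State s') * deficit (d s')) + (1 - stay k t) * deficit y =
              deficit (?P + (\<Sum>s'\<in>UNIV. spmf (vtrans V k t) (State s') * d s'))" for d
          proof -
            have "(\<Sum>s'\<in>UNIV. spmf (vtrans V k t) (State s') * (1 - d s')) =
                stay k t - (\<Sum>s'\<in>UNIV. spmf (vtrans V k t) (State s') * d s')"
              by (simp add: right_diff_distrib sum_subtractf)
            moreover have y: "(1 - stay k t) * y = ?P" using pay by (simp only: y_def)
            moreover have "(1 - stay k t) * (1 - y) = 1 - stay k t - ?P"
              using y by (simp only: right_diff_distrib mult_1_right)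
            ultimately show ?thesis unfolding deficit_def by simp
          qed
          then show ?thesis unfolding y_def .
        qed
        also have "\<dots> = deficit (raw \<pi>' p)" by (simp add: raw_def Node Trans)
        finally show ?thesis using eps by (simp add: pot)
      next
        case (Meet \<Phi> \<Psi>)
        have c: "raw \<pi> (Node \<Phi> t) = den \<Phi> (env (colour_val \<pi>')) t"
          "raw \<pi> (Node \<Psi> t) = den \<Psi> (env (colour_val \<pi>')) t"
          using Node Meet by (auto intro!: child)
        have r: "raw \<pi>' p = min (raw \<pi> (Node \<Phi> t)) (raw \<pi> (Node \<Psi> t))"
          unfolding c by (simp add: raw_def Node Meet)
        have e: "E q = of_bool (q = Node (if \<sigma> \<pi> then \<Phi> else \<Psi>) t)" for q
          by (simp add: E Node Meet snoc)
        show ?thesis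
        proof (cases b)
          case True
          \<comment> \<open>Here the opponent chooses: the minimum lies below either branch, so the
            deficit does not grow.\<close>
          show ?thesis
            by (rule det[OF e], unfold deficit_def r) (use True eps in auto)
        next
          case False
          then have "\<sigma> \<pi> = best \<pi>" using own strat_eq_best[OF g] by simp
          also have "best \<pi> \<longleftrightarrow> raw \<pi> (Node \<Phi> t) \<le> raw \<pi> (Node \<Psi> t)"
            by (simp add: best_def snoc Node Meet)
          finally show ?thesis by (intro deteq[OF e]) (simp add: r)
        qed
      next
        case (Join \<Phi> \<Psi>)
        have c: "raw \<pi> (Node \<Phi> t) = den \<Phi> (env (colour_val \<pi>')) t"
          "raw \<pi> (Node \<Psi> t) = den \<Psi> (env (colour_val \<pi>')) t"
          using Node Join by (auto intro!: child)
        have r: "raw \<pi>' p = max (raw \<pi> (Node \<Phi> t)) (raw \<pi> (Node \<Psi> t))"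
          unfolding c by (simp add: raw_def Node Join)
        have e: "E q = of_bool (q = Node (if \<tau> \<pi> then \<Phi> else \<Psi>) t)" for q
          by (simp add: E Node Join snoc)
        show ?thesis
        proof (cases b)
          case False
          show ?thesis
            by (rule det[OF e], unfold deficit_def r) (use False eps in auto)
        next
          case True
          then have "\<tau> \<pi> = best \<pi>" using own strat_eq_best[OF g] by simp
          also have "best \<pi> \<longleftrightarrow> raw \<pi> (Node \<Phi> t) \<ge> raw \<pi> (Node \<Psi> t)"
            by (simp add: best_def snoc Node Join)
          finally show ?thesis by (intro deteq[OF e]) (simp add: r)
        qed
      next
        case (Cond \<Phi> G \<Psi>)
        have c: "raw \<pi> (Node \<Phi> t) = den \<Phi> (env (colour_val \<pi>')) t"
          "raw \<pi> (Node \<Psi> t) = den \<Psi> (env (colour_val \<pi>')) t"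
          using Node Cond by (auto intro!: child)
        show ?thesis
        proof (rule deteq)
          show "E q = of_bool (q = Node (if vpred V G t then \<Phi> else \<Psi>) t)" for q
            by (simp add: E Node Cond)
          show "raw \<pi> (Node (if vpred V G t then \<Phi> else \<Psi>) t) = raw \<pi>' p"
            using c by (auto simp: raw_def Node Cond)
        qed
      next
        case (Mu X \<Phi>)
        show ?thesis
        proof (rule det)
          show "E q = of_bool (q = Node (Name (Colour X (length \<pi>'))) t)" for q
            by (simp add: E Node Mu)
          show "deficit (raw \<pi> (Node (Name (Colour X (length \<pi>'))) t)) \<le> deficit (raw \<pi>' p) + \<epsilon> (length \<pi>)"
            using raw_new_colour[OF g' _ Node refl, of True X \<Phi>] by (simp add: Node Mu snoc)
        qed
      next
        case (Nu X \<Phi>)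
        show ?thesis
        proof (rule det)
          show "E q = of_bool (q = Node (Name (Colour X (length \<pi>'))) t)" for q
            by (simp add: E Node Nu)
          show "deficit (raw \<pi> (Node (Name (Colour X (length \<pi>'))) t)) \<le> deficit (raw \<pi>' p) + \<epsilon> (length \<pi>)"
            using raw_new_colour[OF g' _ Node refl, of False X \<Phi>] by (simp add: Node Nu snoc)
        qed
      qed
    qed
  qed
qed

text \<open>The budget was fixed when the colour was created, whereas the number of visits is
  unbounded.\<close>

lemma eventually_exhausted:
  assumes inf: "\<exists>\<^sub>\<infinity>n. colour_of (\<omega> n) = Some i" and b: "binding (\<omega> i) = Some (b, X, \<Phi>)"
  shows "\<forall>\<^sub>F n in sequentially. exhausted (map \<omega> [0..<n])"
proof -
  let ?pre = "\<lambda>n. map \<omega> [0..<n]"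
  \<comment> \<open>The body depends on the path only up to position \<open>i\<close>, so the budget
    can be read off the shortest prefix containing that position.\<close>
  define N where "N = budget (Suc i) (body (?pre (Suc i)) i)"
  have "infinite {n. colour_of (\<omega> n) = Some i}" using inf by (simp add: INFM_iff_infinite)
  then obtain B where B: "finite B" "card B = Suc N" "B \<subseteq> {n. colour_of (\<omega> n) = Some i}"
    using infinite_arbitrarily_large by metis
  then obtain K where K: "B \<subseteq> {..<K}" using finite_nat_bounded by blast
  have "exhausted (?pre n)" if n: "n \<ge> max K (Suc i)" for n
  proof -
    have "body (?pre n) i = body (?pre (Suc i)) i"
      using n by (intro body_cong) (auto simp: take_map simp del: upt_Suc)
    moreover have "B \<subseteq> {k. k < length (?pre n) \<and> colour_of (?pre n ! k) = Some i}"
    proof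
      fix k assume "k \<in> B"
      then have "k < n" "colour_of (\<omega> k) = Some i" using B K n by auto
      then show "k \<in> {k. k < length (?pre n) \<and> colour_of (?pre n ! k) = Some i}" by simp
    qed
    then have "card B \<le> visits (?pre n) i" unfolding visits_def by (intro card_mono) auto
    ultimately show ?thesis
      unfolding exhausted_def using n b B(2) by (intro exI[of _ i]) (auto simp: N_def)
  qed
  then show ?thesis unfolding eventually_sequentially by blast
qed

text \<open>On an infinite play either the payoff is ideal for the player and the deficit is 0, or a
  colour with a budget recurs and the potential is eventually 1. On a finite play the potential at
  the tip is its deficit, or 1 if a budget was overdrawn before.\<close>

lemma eventually_deficit_Val_le:
  assumes \<rho>: "\<rho> \<in> maximal_paths V \<sigma> \<tau> \<phi> s"
  shows "\<forall>\<^sub>F n in sequentially. deficit (Val \<rho>) \<le> potential (path_prefix n \<rho>)"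
proof -
  interpret G: game_tree V \<sigma> \<tau> \<phi> s by (rule game_tree)
  have pre: "path_prefix n \<rho> \<in> game_paths" for n
    using G.path_prefix_paths[OF \<rho>] tree_paths_game_paths by blast
  show ?thesis
  proof (cases \<rho>)
    case (Finite_path \<pi>)
    have \<pi>: "\<pi> \<in> G.paths" "\<And>q. \<pi> @ [q] \<notin> G.paths" using \<rho> Finite_path by (auto simp: maximal_paths_def)
    then have g: "\<pi> \<in> game_paths" using tree_paths_game_paths by blast
    have "edge_prob V \<sigma> \<tau> (butlast \<pi>) (last \<pi>) q = 0" for q
      using \<pi>(2)[of q] G.paths_snoc_iff[OF G.paths_not_Nil[OF \<pi>(1)]] \<pi>(1) G.e_nonneg[OF \<pi>(1), of q] by auto
    then obtain y where y: "last \<pi> = Tip y" "0 \<le> y" "y \<le> 1" by (rule terminal_Tip[OF g])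
    have "deficit (Val \<rho>) \<le> potential \<pi>"
      using y by (simp add: Finite_path potential_def raw_def deficit_def)
    then have "deficit (Val \<rho>) \<le> potential (path_prefix n \<rho>)" if "n \<ge> length \<pi>" for n
      using that by (simp add: Finite_path)
    then show ?thesis unfolding eventually_sequentially by blast
  next
    case (Infinite_path \<omega>)
    have \<omega>: "map \<omega> [0..<Suc n] \<in> game_paths" for n using pre[of n] by (simp add: Infinite_path del: upt_Suc)
    have nonneg: "0 \<le> potential (path_prefix n \<rho>)" for n using potential_nonneg[OF pre] .
    have exh: ?thesis if "\<exists>\<^sub>\<infinity>n. colour_of (\<omega> n) = Some i" "binding (\<omega> i) = Some (b, X, \<Phi>)" for i X \<Phi>
    proof -
      have "deficit (Val \<rho>) \<le> 1" by (auto simp: deficit_def Infinite_path)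
      moreover have "potential (path_prefix n \<rho>) = 1" if "exhausted (map \<omega> [0..<n])" for n
        using that by (simp add: Infinite_path potential_def)
      ultimately show ?thesis
        using eventually_exhausted[OF that] by (auto elim!: eventually_mono)
    qed
    show ?thesis
    proof (cases "\<exists>X i. occurs_infinitely_often X i \<omega> \<and> nu_colour X i \<omega>")
      case True
      then obtain X i where X: "occurs_infinitely_often X i \<omega>" "nu_colour X i \<omega>" by blast
      show ?thesis
      proof (cases b)
        case True
        then have "deficit (Val \<rho>) = 0" unfolding deficit_def using X by (auto simp: Infinite_path)
        then show ?thesis using nonneg by simp
      next
        case False
        have "\<exists>\<^sub>\<infinity>n. colour_of (\<omega> n) = Some i"
          using X(1) unfolding occurs_infinitely_often_def by (rule INFM_mono) auto
        moreover obtain \<Phi> where "binding (\<omega> i) = Some (b, X, \<Phi>)"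
          using X(2) False by (auto simp: nu_colour_def)
        ultimately show ?thesis by (rule exh)
      qed
    next
      case no: False
      then have Val: "Val \<rho> = 0" by (simp add: Infinite_path)
      show ?thesis
      proof (cases b)
        case False
        then have "deficit (Val \<rho>) = 0" unfolding deficit_def by (simp add: Val)
        then show ?thesis using nonneg by simp
      next
        case True
        obtain i where i: "\<exists>\<^sub>\<infinity>n. colour_of (\<omega> n) = Some i"
          using some_colour_infinitely_often[OF \<omega>] by blast
        have visit: "\<exists>X t c \<Phi>. \<omega> n = Node (Name (Colour X i)) t \<and> binding (\<omega> i) = Some (c, X, \<Phi>)"
          if n: "colour_of (\<omega> n) = Some i" for n
        proof -
          have eq: "map \<omega> [0..<Suc n] ! k = \<omega> k" if "k \<le> n" for k
            using that nth_map[of k "[0..<Suc n]" \<omega>] by (simp del: upt_Suc)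
          obtain X t c \<Phi> where "map \<omega> [0..<Suc n] ! n = Node (Name (Colour X i)) t" "i < n"
              "binding (map \<omega> [0..<Suc n] ! i) = Some (c, X, \<Phi>)"
            by (rule game_paths_colour_of[OF \<omega>, of n n i]) (use n eq[of n] in \<open>auto simp del: upt_Suc\<close>)
          then show ?thesis using eq[of n] eq[of i] by (metis less_imp_le order_refl)
        qed
        obtain n where "colour_of (\<omega> n) = Some i" using i INFM_EX by blast
        then obtain X c \<Phi> where b: "binding (\<omega> i) = Some (c, X, \<Phi>)" using visit by blast
        have "occurs_infinitely_often X i \<omega>"
          unfolding occurs_infinitely_often_def
          using i by (rule INFM_mono) (use visit b in fastforce)
        then have "\<not> nu_colour X i \<omega>" using no by blast
        moreover obtain t where "\<omega> i = Node (if c then Mu X \<Phi> else Nu X \<Phi>) t"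
          using binding_SomeE[OF b] .
        ultimately have "c = b" using True by (auto simp: nu_colour_def split: if_splits)
        then show ?thesis using exh[OF i] b by simp
      qed
    qed
  qed
qed

end

section \<open>Bounds and measurability of the payoff\<close>

context game
begin

lemma Val_bounds:
  assumes "\<rho> \<in> maximal_paths V \<sigma> \<tau> \<phi> s"
  shows "0 \<le> Val \<rho>" "Val \<rho> \<le> 1"
proof -
  have "0 \<le> Val \<rho> \<and> Val \<rho> \<le> 1"
  proof (cases \<rho>)
    case (Finite_path \<pi>)
    then have g: "\<pi> \<in> game_paths" using assms tree_paths_game_paths by (auto simp: maximal_paths_def)
    then show ?thesis
      using game_paths_Tip[OF g, of "length \<pi> - 1"] last_butlast_nth[OF g]
      by (auto simp: Finite_path split: pos.splits)
  qed auto
  then show "0 \<le> Val \<rho>" "Val \<rho> \<le> 1" by auto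
qed

text \<open>The type of variables may be uncountable, so recurrence is quantified over the creation
  index \<open>i\<close> alone. The variable is hidden in a predicate on a finite prefix and is
  determined by the binder at \<open>i\<close>.\<close>

lemma Val_measurable: "Val \<in> borel_measurable (tree_measure V \<sigma> \<tau> \<phi> s)"
proof -
  interpret G: game_tree V \<sigma> \<tau> \<phi> s by (rule game_tree)
  define tip :: "('v, 'a, 'k, 'g, 's) pos list \<Rightarrow> real"
    where "tip \<pi> = (case last \<pi> of Tip y \<Rightarrow> y | Node \<psi> s \<Rightarrow> 0)" for \<pi>
  \<comment> \<open>\<open>n < length \<pi>\<close> excludes the padding of finite plays, and
    \<open>i < n\<close> puts the creation of the colour into the same prefix.\<close>
  define Q :: "nat \<Rightarrow> nat \<Rightarrow> ('v, 'a, 'k, 'g, 's) pos list \<Rightarrow> bool"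
    where "Q i n \<pi> \<longleftrightarrow> n < length \<pi> \<and>
      (\<exists>X t t' \<Phi>. \<pi> ! n = Node (Name (Colour X i)) t \<and> \<pi> ! i = Node (Nu X \<Phi>) t' \<and> i < n)" for i n \<pi>
  define nu where "nu \<rho> \<longleftrightarrow> (\<exists>i. \<forall>m. \<exists>n. m \<le> n \<and> Q i n (path_prefix n \<rho>))" for \<rho>
  have Q: "Measurable.pred G.T (\<lambda>\<rho>. Q i n (path_prefix n \<rho>))" for i n
    by (rule measurable_compose[OF G.path_prefix_measurable]) simp
  have nu: "Measurable.pred G.T nu"
    unfolding nu_def using Q by (intro pred_intros_countable pred_intros_logic) simp_all
  \<comment> \<open>The limit of \<open>tip\<close> is the payoff of a finite play, and 0 on
    infinite plays, which contain no tips.\<close>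
  have "Val \<rho> = (if nu \<rho> then 1 else lim (\<lambda>n. tip (path_prefix n \<rho>)))" if \<rho>: "\<rho> \<in> space G.T" for \<rho>
  proof (cases \<rho>)
    case (Finite_path \<pi>)
    have "\<not> nu \<rho>"
    proof
      assume "nu \<rho>"
      then obtain i n where "length \<pi> \<le> n" "Q i n (path_prefix n \<rho>)" unfolding nu_def by blast
      then show False by (simp add: Q_def Finite_path)
    qed
    moreover have "(\<lambda>n. tip (path_prefix n \<rho>)) \<longlonglongrightarrow> tip \<pi>"
    proof (rule tendsto_eventually)
      show "\<forall>\<^sub>F n in sequentially. tip (path_prefix n \<rho>) = tip \<pi>"
        unfolding eventually_sequentially by (intro exI[of _ "length \<pi>"]) (simp add: Finite_path)
    qed
    ultimately show ?thesis by (simp add: limI Finite_path tip_def)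
  next
    case (Infinite_path \<omega>)
    have \<omega>: "map \<omega> [0..<Suc n] \<in> game_paths" for n
      using G.path_prefix_paths[of \<rho> n] \<rho> tree_paths_game_paths
      by (auto simp: Infinite_path G.space_T simp del: upt_Suc)
    have eq: "map \<omega> [0..<Suc n] ! k = \<omega> k" if "k \<le> n" for k n
      using that nth_map[of k "[0..<Suc n]" \<omega>] by (simp del: upt_Suc)
    have "\<omega> n \<noteq> Tip y" for n y
    proof -
      have "moves (take n (map \<omega> [0..<Suc (Suc n)])) (\<omega> n) (\<omega> (Suc n))"
        using game_paths_moves[OF \<omega>, of n "Suc n"] eq[of n "Suc n"] eq[of "Suc n" "Suc n"]
        by (simp del: upt_Suc)
      from moves_Node[OF this] show ?thesis by auto
    qed
    then have "tip (path_prefix n \<rho>) = 0" for n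
      by (auto simp: tip_def Infinite_path split: pos.splits)
    then have lim0: "lim (\<lambda>n. tip (path_prefix n \<rho>)) = 0" by simp
    have Qeq: "Q i n (path_prefix n \<rho>) \<longleftrightarrow>
        (\<exists>X. (\<exists>t. \<omega> n = Node (Name (Colour X i)) t) \<and> nu_colour X i \<omega>)" for i n
    proof -
      have "i < n" if "colour_of (\<omega> n) = Some i"
      proof (rule game_paths_colour_of[OF \<omega>, of n n i])
        show "colour_of (map \<omega> [0..<Suc n] ! n) = Some i" using that eq[of n n] by simp
      qed auto
      then show ?thesis
        unfolding Q_def nu_colour_def using eq[of n n] eq[of i n]
        by (auto simp: Infinite_path simp del: upt_Suc)
    qed
    have "nu \<rho> \<longleftrightarrow> (\<exists>i. \<exists>\<^sub>\<infinity>n. \<exists>X. (\<exists>t. \<omega> n = Node (Name (Colour X i)) t) \<and> nu_colour X i \<omega>)"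
      unfolding nu_def Qeq INFM_nat_le by auto
    also have "\<dots> \<longleftrightarrow> (\<exists>X i. occurs_infinitely_often X i \<omega> \<and> nu_colour X i \<omega>)"
    proof
      assume "\<exists>i. \<exists>\<^sub>\<infinity>n. \<exists>X. (\<exists>t. \<omega> n = Node (Name (Colour X i)) t) \<and> nu_colour X i \<omega>"
      then obtain i where i: "\<exists>\<^sub>\<infinity>n. \<exists>X. (\<exists>t. \<omega> n = Node (Name (Colour X i)) t) \<and> nu_colour X i \<omega>"
        by blast
      then obtain X where X: "nu_colour X i \<omega>" using INFM_EX by blast
      have "occurs_infinitely_often X i \<omega>"
        unfolding occurs_infinitely_often_def using i
        by (rule INFM_mono) (use X in \<open>auto simp: nu_colour_def\<close>)
      then show "\<exists>X i. occurs_infinitely_often X i \<omega> \<and> nu_colour X i \<omega>" using X by blast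
    next
      assume "\<exists>X i. occurs_infinitely_often X i \<omega> \<and> nu_colour X i \<omega>"
      then obtain X i where X: "occurs_infinitely_often X i \<omega>" "nu_colour X i \<omega>" by blast
      have "\<exists>\<^sub>\<infinity>n. \<exists>X. (\<exists>t. \<omega> n = Node (Name (Colour X i)) t) \<and> nu_colour X i \<omega>"
        using X(1) unfolding occurs_infinitely_often_def by (rule INFM_mono) (use X(2) in blast)
      then show "\<exists>i. \<exists>\<^sub>\<infinity>n. \<exists>X. (\<exists>t. \<omega> n = Node (Name (Colour X i)) t) \<and> nu_colour X i \<omega>" by blast
    qed
    finally show ?thesis using lim0 by (simp add: Infinite_path)
  qed
  then have "Val \<in> borel_measurable G.T \<longleftrightarrow>
      (\<lambda>\<rho>. if nu \<rho> then 1 else lim (\<lambda>n. tip (path_prefix n \<rho>))) \<in> borel_measurable G.T"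
    by (rule measurable_cong)
  moreover have "(\<lambda>\<rho>. lim (\<lambda>n. tip (path_prefix n \<rho>))) \<in> borel_measurable G.T"
    by (intro borel_measurable_lim_metric G.measurable_path_prefix_comp)
  ultimately show ?thesis
    using nu by (simp add: measurable_If)
qed

lemma integrable_Val: "integrable (tree_measure V \<sigma> \<tau> \<phi> s) Val"
proof -
  interpret G: game_tree V \<sigma> \<tau> \<phi> s by (rule game_tree)
  show ?thesis
    using Val_bounds by (intro G.T.integrable_const_bound[of _ 1] Val_measurable AE_I2) (auto simp: G.space_T)
qed

lemma expected_payoff_bounds:
  "0 \<le> expected_payoff V \<sigma> \<tau> \<phi> s" "expected_payoff V \<sigma> \<tau> \<phi> s \<le> 1"
proof -
  interpret G: game_tree V \<sigma> \<tau> \<phi> s by (rule game_tree)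
  show "0 \<le> expected_payoff V \<sigma> \<tau> \<phi> s"
    unfolding expected_payoff_def using Val_bounds
    by (intro integral_nonneg_AE AE_I2) (auto simp: G.space_T)
  have "(\<integral>\<rho>. Val \<rho> \<partial>G.T) \<le> (\<integral>\<rho>. 1 \<partial>G.T)"
    using Val_bounds by (intro integral_mono integrable_Val) (auto simp: G.space_T)
  then show "expected_payoff V \<sigma> \<tau> \<phi> s \<le> 1"
    unfolding expected_payoff_def by (simp add: G.T.prob_space)
qed

end

section \<open>Guarantees for either player, and the minimax equality\<close>

context player
begin

lemma integral_deficit_Val_le:
  assumes own: "(if b then \<tau> else \<sigma>) = strat"
    and eps_sum: "\<And>n. (\<Sum>k<n. \<epsilon> (Suc k)) \<le> \<delta>"
  shows "deficit (expected_payoff V \<sigma> \<tau> \<phi> s) \<le> deficit (denote \<phi> V s) + \<delta>"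
proof -
  interpret G: game_tree V \<sigma> \<tau> \<phi> s by (rule game_tree)
  have "(\<integral>\<rho>. deficit (Val \<rho>) \<partial>G.T) \<le> potential [Node \<phi> s] + \<delta>"
  proof (rule G.integral_le_supermartingale[OF _ potential_step[OF own] _ eps_sum])
    show "0 \<le> potential \<pi>" if "\<pi> \<in> G.paths" for \<pi>
      using potential_nonneg that tree_paths_game_paths by blast
    show "0 \<le> \<epsilon> n" for n using eps_pos[of n] by simp
    show "(\<lambda>\<rho>. deficit (Val \<rho>)) \<in> borel_measurable G.T"
      unfolding deficit_def using Val_measurable[of \<sigma> \<tau>] by (cases b) simp_all
    show "0 \<le> deficit (Val \<rho>)" if "\<rho> \<in> G.plays" for \<rho>
      using Val_bounds[OF that] by (simp add: deficit_def)
    show "\<forall>\<^sub>F n in sequentially. deficit (Val \<rho>) \<le> potential (path_prefix n \<rho>)" if "\<rho> \<in> G.plays" for \<rho>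
      using eventually_deficit_Val_le[OF that] .
  qed
  moreover have "(\<integral>\<rho>. deficit (Val \<rho>) \<partial>G.T) = deficit (expected_payoff V \<sigma> \<tau> \<phi> s)"
    unfolding deficit_def expected_payoff_def using integrable_Val[of \<sigma> \<tau>]
    by (cases b) (simp_all add: G.T.prob_space)
  moreover have "potential [Node \<phi> s] = deficit (denote \<phi> V s)"
  proof -
    \<comment> \<open>No colour exists at the root, and a closed formula does not see the default
      values in \<open>env\<close>.\<close>
    have "den \<phi> (env (colour_val [])) = den \<phi> (vname V)"
      using closed by (intro den_cong) (simp add: closed_form_def)
    then show ?thesis by (simp add: potential_def exhausted_def raw_def den_def)
  qed
  ultimately show ?thesis by simp
qed

end

lemma (in game) near_optimal_strategy:
  assumes "\<delta> > 0"
  shows "\<exists>\<tau>\<in>strategies. \<forall>\<sigma>. denote \<phi> V s - \<delta> \<le> expected_payoff V \<sigma> \<tau> \<phi> s"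
    and "\<exists>\<sigma>\<in>strategies. \<forall>\<tau>. expected_payoff V \<sigma> \<tau> \<phi> s \<le> denote \<phi> V s + \<delta>"
proof -
  \<comment> \<open>Geometric allowances: over all positions of a play they sum to at most
    \<open>\<delta>\<close>, whatever the length.\<close>
  define \<epsilon> :: "nat \<Rightarrow> real" where "\<epsilon> n = \<delta> * (1 / 2) ^ n" for n
  have eps_sum: "(\<Sum>k<n. \<epsilon> (Suc k)) \<le> \<delta>" for n
  proof -
    have "(\<Sum>k<n. \<epsilon> (Suc k)) = \<delta> * (1 - (1 / 2) ^ n)"
      by (induction n) (auto simp: \<epsilon>_def algebra_simps)
    then show ?thesis using assms by (simp add: mult_left_le)
  qed
  interpret Max: player V \<phi> s True \<epsilon>
    by unfold_locales (use assms in \<open>simp add: \<epsilon>_def\<close>)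
  interpret Min: player V \<phi> s False \<epsilon>
    by unfold_locales (use assms in \<open>simp add: \<epsilon>_def\<close>)
  have "denote \<phi> V s - \<delta> \<le> expected_payoff V \<sigma> Max.strat \<phi> s" for \<sigma>
    using Max.integral_deficit_Val_le[of Max.strat \<sigma> \<delta>] eps_sum by (simp add: Max.deficit_def)
  then show "\<exists>\<tau>\<in>strategies. \<forall>\<sigma>. denote \<phi> V s - \<delta> \<le> expected_payoff V \<sigma> \<tau> \<phi> s"
    using Max.strat_in_strategies by blast
  have "expected_payoff V Min.strat \<tau> \<phi> s \<le> denote \<phi> V s + \<delta>" for \<tau>
    using Min.integral_deficit_Val_le[of \<tau> Min.strat \<delta>] eps_sum by (simp add: Min.deficit_def)
  then show "\<exists>\<sigma>\<in>strategies. \<forall>\<tau>. expected_payoff V \<sigma> \<tau> \<phi> s \<le> denote \<phi> V s + \<delta>"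
    using Min.strat_in_strategies by blast
qed

text \<open>The reals are only conditionally complete; \<open>S \<noteq> {}\<close> and the bounds
  on \<open>E\<close> make the infima and suprema meaningful. Weak duality then closes the chain
  \<open>d \<le> SUP INF \<le> INF SUP \<le> d\<close>.\<close>

lemma minimax_eqI:
  fixes E :: "'x \<Rightarrow> 'x \<Rightarrow> real"
  assumes S: "S \<noteq> {}" and E: "\<And>\<sigma> \<tau>. 0 \<le> E \<sigma> \<tau>" "\<And>\<sigma> \<tau>. E \<sigma> \<tau> \<le> 1"
    and max: "\<And>\<delta>. \<delta> > 0 \<Longrightarrow> \<exists>\<tau>\<in>S. \<forall>\<sigma>. d - \<delta> \<le> E \<sigma> \<tau>"
    and min: "\<And>\<delta>. \<delta> > 0 \<Longrightarrow> \<exists>\<sigma>\<in>S. \<forall>\<tau>. E \<sigma> \<tau> \<le> d + \<delta>"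
  shows "(INF \<sigma>\<in>S. SUP \<tau>\<in>S. E \<sigma> \<tau>) = d" "(SUP \<tau>\<in>S. INF \<sigma>\<in>S. E \<sigma> \<tau>) = d"
proof -
  have bdd: "bdd_above ((\<lambda>\<tau>. E \<sigma> \<tau>) ` S)" "bdd_below ((\<lambda>\<sigma>. E \<sigma> \<tau>) ` S)" for \<sigma> \<tau>
    using E by (auto intro!: bdd_aboveI[of _ 1] bdd_belowI[of _ 0])
  have sup_ge: "0 \<le> (SUP \<tau>\<in>S. E \<sigma> \<tau>)" for \<sigma>
    using S E(1) by (metis bdd(1) cSUP_upper2 ex_in_conv)
  have inf_le: "(INF \<sigma>\<in>S. E \<sigma> \<tau>) \<le> 1" for \<tau>
    using S E(2) by (metis bdd(2) cINF_lower2 ex_in_conv)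
  have bdd': "bdd_below ((\<lambda>\<sigma>. SUP \<tau>\<in>S. E \<sigma> \<tau>) ` S)" "bdd_above ((\<lambda>\<tau>. INF \<sigma>\<in>S. E \<sigma> \<tau>) ` S)"
    using sup_ge inf_le by (auto intro!: bdd_aboveI[of _ 1] bdd_belowI[of _ 0])
  have weak: "(INF \<sigma>'\<in>S. E \<sigma>' \<tau>) \<le> (SUP \<tau>'\<in>S. E \<sigma> \<tau>')" if "\<sigma> \<in> S" "\<tau> \<in> S" for \<sigma> \<tau>
    using cINF_lower[OF bdd(2) that(1), of \<tau>] cSUP_upper[OF that(2) bdd(1), of \<sigma>] by simp
  have "(SUP \<tau>\<in>S. INF \<sigma>\<in>S. E \<sigma> \<tau>) \<le> (INF \<sigma>\<in>S. SUP \<tau>\<in>S. E \<sigma> \<tau>)"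
    using S weak by (intro cSUP_least cINF_greatest) auto
  moreover have "(INF \<sigma>\<in>S. SUP \<tau>\<in>S. E \<sigma> \<tau>) \<le> d"
  proof (rule field_le_epsilon)
    fix \<delta> :: real assume "\<delta> > 0"
    then obtain \<sigma> where \<sigma>: "\<sigma> \<in> S" "\<And>\<tau>. E \<sigma> \<tau> \<le> d + \<delta>" using min by blast
    have "(SUP \<tau>\<in>S. E \<sigma> \<tau>) \<le> d + \<delta>" using S \<sigma>(2) by (intro cSUP_least) auto
    then show "(INF \<sigma>\<in>S. SUP \<tau>\<in>S. E \<sigma> \<tau>) \<le> d + \<delta>" by (rule cINF_lower2[OF bdd'(1) \<sigma>(1)])
  qed
  moreover have "d \<le> (SUP \<tau>\<in>S. INF \<sigma>\<in>S. E \<sigma> \<tau>)"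
  proof (rule field_le_epsilon)
    fix \<delta> :: real assume "\<delta> > 0"
    then obtain \<tau> where \<tau>: "\<tau> \<in> S" "\<And>\<sigma>. d - \<delta> \<le> E \<sigma> \<tau>" using max by blast
    have "d - \<delta> \<le> (INF \<sigma>\<in>S. E \<sigma> \<tau>)" using S \<tau>(2) by (intro cINF_greatest) auto
    then have "d - \<delta> \<le> (SUP \<tau>\<in>S. INF \<sigma>\<in>S. E \<sigma> \<tau>)" by (rule cSUP_upper2[OF bdd'(2) \<tau>(1)])
    then show "d \<le> (SUP \<tau>\<in>S. INF \<sigma>\<in>S. E \<sigma> \<tau>) + \<delta>" by simp
  qed
  ultimately show "(INF \<sigma>\<in>S. SUP \<tau>\<in>S. E \<sigma> \<tau>) = d" "(SUP \<tau>\<in>S. INF \<sigma>\<in>S. E \<sigma> \<tau>) = d" by auto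
qed

theorem theorem1:
  fixes \<phi> :: "('v, 'a, 'k, 'g) form"
    and V :: "('v, 'a, 'k, 'g, 's :: finite) valuation"
    and s :: 's
  assumes "closed_form \<phi>" and "is_valuation V"
  shows "(INF \<sigma>\<in>strategies. SUP \<tau>\<in>strategies. expected_payoff V \<sigma> \<tau> \<phi> s) =
         (SUP \<tau>\<in>strategies. INF \<sigma>\<in>strategies. expected_payoff V \<sigma> \<tau> \<phi> s) \<and>
         (SUP \<tau>\<in>strategies. INF \<sigma>\<in>strategies. expected_payoff V \<sigma> \<tau> \<phi> s) = denote \<phi> V s"
proof -
  interpret game V \<phi> s by unfold_locales (fact assms)+
  have "(strategies :: ('v, 'a, 'k, 'g, 's) pos strategy set) \<noteq> {}"
    using near_optimal_strategy(1)[of 1] by auto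
  from minimax_eqI[of strategies "\<lambda>\<sigma> \<tau>. expected_payoff V \<sigma> \<tau> \<phi> s", OF this
      expected_payoff_bounds near_optimal_strategy]
  show ?thesis by simp
qed

end
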